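(* Let $H$ be a Hopf algebra having an $ad$-invariant integral (e.g. $H$ finite-dimensional cosemisimple), and let $(R,m,u,\delta,\varepsilon)$ be an $N$-dimensional pre-bialgebra in ${}_H^H\mathcal{YD}$ with cocycle $\xi$. Assume that $R$ is a thin coalgebra with $P(R)=Ky$, let $(H,g,\chi)$ be the Yetter-Drinfeld datum associated to $y$ and let $q=\chi(g)$. Then there exists $\lambda(N)\in K$ such that for all $a,b\in\mathbb N$ (powers of $y$ taken in $R$) $$\xi(y^a\otimes y^b)=\begin{cases}1_H & \text{if } a+b=0,\\ \lambda(N)(1_H-g^N) & \text{if } a+b=N,\ a\ne 0,\ b\neq 0,\\ 0&\text{otherwise,}\end{cases}$$ and $(H,g,\chi,\lambda(N))$ is a compatible datum for $q$. Moreover, in this case, $R=R_q(H,g,\chi)$ is a quantum line and, if $\xi\neq\varepsilon\otimes\varepsilon$, then $$\chi^N=\varepsilon_H\qquad\text{and}\qquad g^N\in Z(H)\setminus\{1_H\}.$$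
   Context: $K$ is a field of characteristic $0$; everything is over $K$; $\mathbb N$ contains $0$; $Z(H)$ is the center of $H$. $\xi=\varepsilon\otimes\varepsilon$ means $\xi(r\otimes s)=\varepsilon(r)\varepsilon(s)1_H$. $ad$-invariant integral. An $ad$-invariant integral for a Hopf algebra $H$ with antipode $S$ is a $K$-linear map $\gamma:H\to K$ with $\sum h_{(1)}\gamma(h_{(2)})=1_H\gamma(h)$, $\gamma(1_H)=1_K$ and $\sum\gamma[h_{(1)}xS(h_{(2)})]=\varepsilon_H(h)\gamma(x)$ for all $h,x\in H$. Yetter-Drinfeld modules. An object $V$ of ${}_H^H\mathcal{YD}$ is a left $H$-module and left $H$-comodule (coaction $\rho(v)=\sum v_{\langle -1\rangle}\otimes v_{\langle 0\rangle}$) with $\rho(hv)=\sum h_{(1)}v_{\langle -1\rangle}S(h_{(3)})\otimes h_{(2)}v_{\langle 0\rangle}$. Tensor products carry the diagonal action and codiagonal coaction; the unit object is $K$; $c_{V,W}(v\otimes w)=\sum v_{\langle -1\rangle}w\otimes v_{\langle 0\rangle}$. If $(R,\delta,\varepsilon)$ is a coalgebra in ${}_H^H\mathcal{YD}$, with $\delta(r)=\sum r^{(1)}\otimes r^{(2)}$, then $R\otimes R$ is a coalgebra via $\delta_{R\otimes R}(r\otimes s)=\sum r^{(1)}\otimes r^{(2)}_{\langle -1\rangle}s^{(1)}\otimes r^{(2)}_{\langle 0\rangle}\otimes s^{(2)}$. Pre-bialgebra. A pre-bialgebra $(R,m,u,\delta,\varepsilon)$ in ${}_H^H\mathcal{YD}$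 is a coalgebra $(R,\delta,\varepsilon)$ in ${}_H^H\mathcal{YD}$ with $K$-linear maps $m:R\otimes R\to R$, $u:K\to R$ (write $1_R=u(1)$) such that $h1_R=\varepsilon_H(h)1_R$, $\rho(1_R)=1_H\otimes 1_R$, $\delta(1_R)=1_R\otimes 1_R$, $\varepsilon(1_R)=1$, $h\,m(r\otimes s)=\sum m(h_{(1)}r\otimes h_{(2)}s)$, $\delta m=(m\otimes m)\delta_{R\otimes R}$, $\varepsilon m=\varepsilon\otimes\varepsilon$, $m(r\otimes 1_R)=r=m(1_R\otimes r)$. (Associativity and $H$-colinearity of $m$ are not required.) Cocycle. A cocycle for it is a $K$-linear map $\xi:R\otimes R\to H$ such that, with $m_H$ the multiplication of $H$, $\mu_R:H\otimes R\to R$ the action, $c_{R,H}(r\otimes h)=\sum r_{\langle -1\rangle}h\otimes r_{\langle 0\rangle}$ and $c_{H,R}(h\otimes r)=\sum h_{(1)}r\otimes h_{(2)}$: $\sum\xi(h_{(1)}r\otimes h_{(2)}s)=\sum h_{(1)}\xi(r\otimes s)S(h_{(2)})$; $\Delta_H\xi=(m_H\otimes\xi)(\xi\otimes\rho_{R\otimes R})\delta_{R\otimes R}$ and $\varepsilon_H\xi=\varepsilon\otimes\varepsilon$; $c_{R,H}(m\otimes\xi)\delta_{R\otimes R}=(m_H\otimes m)(\xi\otimes\rho_{R\otimes R})\delta_{R\otimes R}$; $m(R\otimes m)=m(R\otimes\mu_R)[(m\otimes\xi)\delta_{R\otimes R}\otimes R]$; $m_H(\xi\otimes H)[R\otimes(m\otimes\xi)\delta_{R\otimes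 R}]=m_H(\xi\otimes H)(R\otimes c_{H,R})[(m\otimes\xi)\delta_{R\otimes R}\otimes R]$; $\xi(r\otimes 1_R)=\xi(1_R\otimes r)=\varepsilon(r)1_H$. Thin. A coalgebra $C$ is thin if its coradical and its space $P(C)$ of primitive elements are both one-dimensional. Yetter-Drinfeld datum. For $q$ a primitive $\theta$-th root of unity, a Yetter-Drinfeld datum $(H,g,\chi)$ for $q$ consists of $g\in G(H)$ and an algebra map $\chi:H\to K$ with $\chi(g)=q$ and $g\sum\chi(h_{(1)})h_{(2)}=\sum h_{(1)}\chi(h_{(2)})g$ for all $h\in H$. If $R$ is a finite-dimensional pre-bialgebra which is thin with $P(R)=Ky$, it is known that there are a primitive $\theta$-th root of unity $q$ ($2\le\theta\le\dim R$) and a Yetter-Drinfeld datum $(H,g,\chi)$ for $q$ with $\rho(y)=g\otimes y$ and $hy=\chi(h)y$; it is called the Yetter-Drinfeld datum associated to $y$. It is known that, when $R$ has a cocycle, $R$ is an associative algebra, $q$ has order $N=\dim R$, and $y^N=0$ in $R$. Compatible datum. For $q$ a primitive $N$-th root of unity, a compatible datum for $q$ is $(H,g,\chi,\lambda(N))$ with $(H,g,\chi)$ a Yetter-Drinfeld datum for $q$ and $\lambda(N)\in K$, where $\lambda(N)=0$ is required if $g^N=1_H$ or if $\chi^N(h)(1_H-g^N)\ne\sum h_{(1)}(1_H-g^N)S(h_{(2)})$ for some $h\in H$ ($\chi^N$ the convolution power), and $\lambda(N)$ is arbitrary otherwise. Quantum line. For a Yetter-Drinfeld datum $(H,g,\chi)$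 for a primitive $N$-th root of unity $q$, $R_q(H,g,\chi)$ is the algebra $K[X]/(X^N)$, $y$ the class of $X$, with its unique structure of braided bialgebra in ${}_H^H\mathcal{YD}$ such that $hy=\chi(h)y$, $\rho(y)=g\otimes y$, $\delta(y)=y\otimes 1+1\otimes y$. *)

theory Defs
  imports "HOL-Library.Poly_Mapping" "HOL-Computational_Algebra.Polynomial"
begin

section \<open>Tensor products\<close>

text \<open>
  A vector space over \<open>'k\<close> is a type together with a scalar multiplication \<open>sV\<close>
  (\<open>vector_space sV\<close>). An element of \<open>V \<otimes> W\<close> is written as a list
  \<open>[(v\<^sub>1, w\<^sub>1), \<dots>]\<close> standing for \<open>v\<^sub>1 \<otimes> w\<^sub>1 + \<dots>\<close>; scalars are absorbed in the entries.
  Two lists denote the same element of \<open>V \<otimes> W\<close> iff the difference of the corresponding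
  elements of the free vector space on \<open>V \<times> W\<close> lies in the subspace spanned by the bilinearity
  relations, that is, iff they agree in the usual quotient construction of \<open>V \<otimes> W\<close>.

  A linear map into \<open>V \<otimes> W\<close> is given by a choice of representing lists, so that
  \<open>(a, b) \<leftarrow> \<Delta> x\<close> is Sweedler notation; a linear map out of \<open>V \<otimes> W\<close> is
  given as a bilinear map in two arguments.
\<close>

definition formal_scale :: "'k::field \<Rightarrow> ('a \<Rightarrow>\<^sub>0 'k) \<Rightarrow> ('a \<Rightarrow>\<^sub>0 'k)" where
  "formal_scale c = Poly_Mapping.map ((*) c)"

definition formal_sum :: "'a list \<Rightarrow> ('a \<Rightarrow>\<^sub>0 'k::field)" where
  "formal_sum xs = (\<Sum>x\<leftarrow>xs. Poly_Mapping.single x 1)"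

definition tensor_rels ::
  "('k::field \<Rightarrow> 'v::ab_group_add \<Rightarrow> 'v) \<Rightarrow> ('k \<Rightarrow> 'w::ab_group_add \<Rightarrow> 'w) \<Rightarrow>
   ('v \<times> 'w \<Rightarrow>\<^sub>0 'k) set" where
  "tensor_rels sV sW =
     {formal_sum [(v + v', w)] - formal_sum [(v, w), (v', w)] | v v' w. True} \<union>
     {formal_sum [(v, w + w')] - formal_sum [(v, w), (v, w')] | v w w'. True} \<union>
     {formal_sum [(sV c v, w)] - formal_scale c (formal_sum [(v, w)]) | c v w. True} \<union>
     {formal_sum [(v, sW c w)] - formal_scale c (formal_sum [(v, w)]) | c v w. True}"

definition tensor_eq ::
  "('k::field \<Rightarrow> 'v::ab_group_add \<Rightarrow> 'v) \<Rightarrow> ('k \<Rightarrow> 'w::ab_group_add \<Rightarrow> 'w) \<Rightarrow>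
   ('v \<times> 'w) list \<Rightarrow> ('v \<times> 'w) list \<Rightarrow> bool" where
  "tensor_eq sV sW xs ys \<longleftrightarrow>
     formal_sum xs - formal_sum ys \<in> module.span formal_scale (tensor_rels sV sW)"

definition tensor3_rels ::
  "('k::field \<Rightarrow> 'u::ab_group_add \<Rightarrow> 'u) \<Rightarrow> ('k \<Rightarrow> 'v::ab_group_add \<Rightarrow> 'v) \<Rightarrow>
   ('k \<Rightarrow> 'w::ab_group_add \<Rightarrow> 'w) \<Rightarrow> ('u \<times> 'v \<times> 'w \<Rightarrow>\<^sub>0 'k) set" where
  "tensor3_rels sU sV sW =
     {formal_sum [(u + u', v, w)] - formal_sum [(u, v, w), (u', v, w)] | u u' v w. True} \<union>
     {formal_sum [(u, v + v', w)] - formal_sum [(u, v, w), (u, v', w)] | u v v' w. True} \<union>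
     {formal_sum [(u, v, w + w')] - formal_sum [(u, v, w), (u, v, w')] | u v w w'. True} \<union>
     {formal_sum [(sU c u, v, w)] - formal_scale c (formal_sum [(u, v, w)]) | c u v w. True} \<union>
     {formal_sum [(u, sV c v, w)] - formal_scale c (formal_sum [(u, v, w)]) | c u v w. True} \<union>
     {formal_sum [(u, v, sW c w)] - formal_scale c (formal_sum [(u, v, w)]) | c u v w. True}"

definition tensor3_eq ::
  "('k::field \<Rightarrow> 'u::ab_group_add \<Rightarrow> 'u) \<Rightarrow> ('k \<Rightarrow> 'v::ab_group_add \<Rightarrow> 'v) \<Rightarrow>
   ('k \<Rightarrow> 'w::ab_group_add \<Rightarrow> 'w) \<Rightarrow>
   ('u \<times> 'v \<times> 'w) list \<Rightarrow> ('u \<times> 'v \<times> 'w) list \<Rightarrow> bool" where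
  "tensor3_eq sU sV sW xs ys \<longleftrightarrow>
     formal_sum xs - formal_sum ys \<in> module.span formal_scale (tensor3_rels sU sV sW)"

definition linear_into_tensor ::
  "('k::field \<Rightarrow> 'u::ab_group_add \<Rightarrow> 'u) \<Rightarrow> ('k \<Rightarrow> 'v::ab_group_add \<Rightarrow> 'v) \<Rightarrow>
   ('k \<Rightarrow> 'w::ab_group_add \<Rightarrow> 'w) \<Rightarrow> ('u \<Rightarrow> ('v \<times> 'w) list) \<Rightarrow> bool" where
  "linear_into_tensor sU sV sW f \<longleftrightarrow>
     (\<forall>x y. tensor_eq sV sW (f (x + y)) (f x @ f y)) \<and>
     (\<forall>c x. tensor_eq sV sW (f (sU c x)) [(sV c a, b). (a, b) \<leftarrow> f x])"

definition bilinear_map ::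
  "('k::field \<Rightarrow> 'u::ab_group_add \<Rightarrow> 'u) \<Rightarrow> ('k \<Rightarrow> 'v::ab_group_add \<Rightarrow> 'v) \<Rightarrow>
   ('k \<Rightarrow> 'w::ab_group_add \<Rightarrow> 'w) \<Rightarrow> ('u \<Rightarrow> 'v \<Rightarrow> 'w) \<Rightarrow> bool" where
  "bilinear_map sU sV sW f \<longleftrightarrow>
     (\<forall>x. Vector_Spaces.linear sV sW (f x)) \<and> (\<forall>y. Vector_Spaces.linear sU sW (\<lambda>x. f x y))"

definition has_dimension ::
  "('k::field \<Rightarrow> 'v::ab_group_add \<Rightarrow> 'v) \<Rightarrow> nat \<Rightarrow> bool" where
  "has_dimension sV n \<longleftrightarrow>
     (\<exists>B. finite B \<and> card B = n \<and> \<not> module.dependent sV B \<and> module.span sV B = UNIV)"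


section \<open>Algebras, coalgebras, Hopf algebras\<close>

locale k_algebra = vector_space sA
  for sA :: "'k::field \<Rightarrow> 'a::ring_1 \<Rightarrow> 'a" +
  assumes scale_mult_left: "sA c x * y = sA c (x * y)"
    and scale_mult_right: "x * sA c y = sA c (x * y)"

locale k_coalgebra = vector_space sC
  for sC :: "'k::field \<Rightarrow> 'c::ab_group_add \<Rightarrow> 'c"
    and \<Delta> :: "'c \<Rightarrow> ('c \<times> 'c) list"
    and \<epsilon> :: "'c \<Rightarrow> 'k" +
  assumes comult_linear: "linear_into_tensor sC sC sC \<Delta>"
    and counit_linear: "Vector_Spaces.linear sC (*) \<epsilon>"
    and coassoc: "tensor3_eq sC sC sC
      [(a1, a2, b). (a, b) \<leftarrow> \<Delta> x, (a1, a2) \<leftarrow> \<Delta> a]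
      [(a, b1, b2). (a, b) \<leftarrow> \<Delta> x, (b1, b2) \<leftarrow> \<Delta> b]"
    and counit_left: "(\<Sum>(a, b)\<leftarrow>\<Delta> x. sC (\<epsilon> a) b) = x"
    and counit_right: "(\<Sum>(a, b)\<leftarrow>\<Delta> x. sC (\<epsilon> b) a) = x"

locale hopf_algebra = k_algebra sH + k_coalgebra sH \<Delta> \<epsilon>
  for sH :: "'k::field \<Rightarrow> 'h::ring_1 \<Rightarrow> 'h"
    and \<Delta> :: "'h \<Rightarrow> ('h \<times> 'h) list"
    and \<epsilon> :: "'h \<Rightarrow> 'k"
    and S :: "'h \<Rightarrow> 'h" +
  assumes comult_one: "tensor_eq sH sH (\<Delta> 1) [(1, 1)]"
    and comult_mult: "tensor_eq sH sH (\<Delta> (x * y))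
      [(a * c, b * d). (a, b) \<leftarrow> \<Delta> x, (c, d) \<leftarrow> \<Delta> y]"
    and counit_one: "\<epsilon> 1 = 1"
    and counit_mult: "\<epsilon> (x * y) = \<epsilon> x * \<epsilon> y"
    and antipode_linear: "Vector_Spaces.linear sH sH S"
    and antipode_left: "(\<Sum>(a, b)\<leftarrow>\<Delta> x. S a * b) = sH (\<epsilon> x) 1"
    and antipode_right: "(\<Sum>(a, b)\<leftarrow>\<Delta> x. a * S b) = sH (\<epsilon> x) 1"

definition ad_invariant_integral ::
  "('k::field \<Rightarrow> 'h::ring_1 \<Rightarrow> 'h) \<Rightarrow> ('h \<Rightarrow> ('h \<times> 'h) list) \<Rightarrow> ('h \<Rightarrow> 'k) \<Rightarrow> ('h \<Rightarrow> 'h) \<Rightarrow>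
   ('h \<Rightarrow> 'k) \<Rightarrow> bool" where
  "ad_invariant_integral sH \<Delta> \<epsilon> S \<gamma> \<longleftrightarrow>
     Vector_Spaces.linear sH (*) \<gamma> \<and>
     (\<forall>h. (\<Sum>(a, b)\<leftarrow>\<Delta> h. sH (\<gamma> b) a) = sH (\<gamma> h) 1) \<and>
     \<gamma> 1 = 1 \<and>
     (\<forall>h x. (\<Sum>(a, b)\<leftarrow>\<Delta> h. \<gamma> (a * x * S b)) = \<epsilon> h * \<gamma> x)"

definition grouplikes ::
  "('k::field \<Rightarrow> 'c::ab_group_add \<Rightarrow> 'c) \<Rightarrow> ('c \<Rightarrow> ('c \<times> 'c) list) \<Rightarrow> ('c \<Rightarrow> 'k) \<Rightarrow> 'c set" where
  "grouplikes sC \<Delta> \<epsilon> = {g. tensor_eq sC sC (\<Delta> g) [(g, g)] \<and> \<epsilon> g = 1}"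

definition center :: "'h::ring_1 set" where
  "center = {z. \<forall>h. z * h = h * z}"

fun convolution_power ::
  "('h \<Rightarrow> ('h \<times> 'h) list) \<Rightarrow> ('h \<Rightarrow> 'k::field) \<Rightarrow> ('h \<Rightarrow> 'k) \<Rightarrow> nat \<Rightarrow> 'h \<Rightarrow> 'k" where
  "convolution_power \<Delta> \<epsilon> \<chi> 0 = \<epsilon>"
| "convolution_power \<Delta> \<epsilon> \<chi> (Suc n) =
     (\<lambda>h. \<Sum>(a, b)\<leftarrow>\<Delta> h. \<chi> a * convolution_power \<Delta> \<epsilon> \<chi> n b)"


section \<open>Thin coalgebras\<close>

definition subcoalgebra ::
  "('k::field \<Rightarrow> 'c::ab_group_add \<Rightarrow> 'c) \<Rightarrow> ('c \<Rightarrow> ('c \<times> 'c) list) \<Rightarrow> 'c set \<Rightarrow> bool" where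
  "subcoalgebra sC \<Delta> D \<longleftrightarrow> module.subspace sC D \<and>
     (\<forall>x\<in>D. \<exists>xs. set xs \<subseteq> D \<times> D \<and> tensor_eq sC sC (\<Delta> x) xs)"

definition simple_subcoalgebra ::
  "('k::field \<Rightarrow> 'c::ab_group_add \<Rightarrow> 'c) \<Rightarrow> ('c \<Rightarrow> ('c \<times> 'c) list) \<Rightarrow> 'c set \<Rightarrow> bool" where
  "simple_subcoalgebra sC \<Delta> D \<longleftrightarrow> subcoalgebra sC \<Delta> D \<and> D \<noteq> {0} \<and>
     (\<forall>E. subcoalgebra sC \<Delta> E \<longrightarrow> E \<subseteq> D \<longrightarrow> E = {0} \<or> E = D)"

definition coradical ::
  "('k::field \<Rightarrow> 'c::ab_group_add \<Rightarrow> 'c) \<Rightarrow> ('c \<Rightarrow> ('c \<times> 'c) list) \<Rightarrow> 'c set" where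
  "coradical sC \<Delta> = module.span sC (\<Union> {D. simple_subcoalgebra sC \<Delta> D})"

text \<open>
  Primitive elements are taken with respect to a distinguished grouplike element \<open>e\<close>. If the
  coradical is one-dimensional then there is only one grouplike element; in a pre-bialgebra it is
  the unit.
\<close>

definition primitives ::
  "('k::field \<Rightarrow> 'c::ab_group_add \<Rightarrow> 'c) \<Rightarrow> ('c \<Rightarrow> ('c \<times> 'c) list) \<Rightarrow> 'c \<Rightarrow> 'c set" where
  "primitives sC \<Delta> e = {x. tensor_eq sC sC (\<Delta> x) [(x, e), (e, x)]}"

definition thin ::
  "('k::field \<Rightarrow> 'c::ab_group_add \<Rightarrow> 'c) \<Rightarrow> ('c \<Rightarrow> ('c \<times> 'c) list) \<Rightarrow> 'c \<Rightarrow> bool" where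
  "thin sC \<Delta> e \<longleftrightarrow> vector_space.dim sC (coradical sC \<Delta>) = 1 \<and>
     vector_space.dim sC (primitives sC \<Delta> e) = 1"


section \<open>Yetter-Drinfeld modules, pre-bialgebras and cocycles\<close>

locale yd_module = hopf_algebra sH \<Delta> \<epsilon> S + V: vector_space sV
  for sH :: "'k::field \<Rightarrow> 'h::ring_1 \<Rightarrow> 'h"
    and \<Delta> :: "'h \<Rightarrow> ('h \<times> 'h) list"
    and \<epsilon> :: "'h \<Rightarrow> 'k"
    and S :: "'h \<Rightarrow> 'h"
    and sV :: "'k \<Rightarrow> 'v::ab_group_add \<Rightarrow> 'v"
    and act :: "'h \<Rightarrow> 'v \<Rightarrow> 'v"
    and \<rho> :: "'v \<Rightarrow> ('h \<times> 'v) list" +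
  assumes act_bilinear: "bilinear_map sH sV sV act"
    and act_one: "act 1 v = v"
    and act_mult: "act (h * k) v = act h (act k v)"
    and coact_linear: "linear_into_tensor sV sH sV \<rho>"
    and coact_coassoc: "tensor3_eq sH sH sV
      [(u1, u2, w). (u, w) \<leftarrow> \<rho> v, (u1, u2) \<leftarrow> \<Delta> u]
      [(u, t, x). (u, w) \<leftarrow> \<rho> v, (t, x) \<leftarrow> \<rho> w]"
    and coact_counit: "(\<Sum>(u, w)\<leftarrow>\<rho> v. sV (\<epsilon> u) w) = v"
    and yetter_drinfeld: "tensor_eq sH sV (\<rho> (act h v))
      [(h1 * u * S h3, act h2 w).
        (h1, h') \<leftarrow> \<Delta> h, (h2, h3) \<leftarrow> \<Delta> h', (u, w) \<leftarrow> \<rho> v]"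

definition coact_tensor ::
  "('r \<Rightarrow> ('h::ring_1 \<times> 'r) list) \<Rightarrow> 'r \<Rightarrow> 'r \<Rightarrow> ('h \<times> 'r \<times> 'r) list" where
  "coact_tensor \<rho> r s = [(u * v, r0, s0). (u, r0) \<leftarrow> \<rho> r, (v, s0) \<leftarrow> \<rho> s]"

locale yd_coalgebra = yd_module sH \<Delta> \<epsilon> S sR act \<rho> + R: k_coalgebra sR \<delta> \<epsilon>R
  for sH :: "'k::field \<Rightarrow> 'h::ring_1 \<Rightarrow> 'h"
    and \<Delta> :: "'h \<Rightarrow> ('h \<times> 'h) list"
    and \<epsilon> :: "'h \<Rightarrow> 'k"
    and S :: "'h \<Rightarrow> 'h"
    and sR :: "'k \<Rightarrow> 'r::ab_group_add \<Rightarrow> 'r"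
    and act :: "'h \<Rightarrow> 'r \<Rightarrow> 'r"
    and \<rho> :: "'r \<Rightarrow> ('h \<times> 'r) list"
    and \<delta> :: "'r \<Rightarrow> ('r \<times> 'r) list"
    and \<epsilon>R :: "'r \<Rightarrow> 'k" +
  assumes comult_act: "tensor_eq sR sR (\<delta> (act h r))
      [(act h1 r1, act h2 r2). (h1, h2) \<leftarrow> \<Delta> h, (r1, r2) \<leftarrow> \<delta> r]"
    and counit_act: "\<epsilon>R (act h r) = \<epsilon> h * \<epsilon>R r"
    and comult_coact: "tensor3_eq sH sR sR
      [(u, r1, r2). (u, r0) \<leftarrow> \<rho> r, (r1, r2) \<leftarrow> \<delta> r0]
      [x. (r1, r2) \<leftarrow> \<delta> r, x \<leftarrow> coact_tensor \<rho> r1 r2]"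
    and counit_coact: "(\<Sum>(u, r0)\<leftarrow>\<rho> r. sH (\<epsilon>R r0) u) = sH (\<epsilon>R r) 1"

text \<open>The comultiplication of \<open>R \<otimes> R\<close>, an element of \<open>(R \<otimes> R) \<otimes> (R \<otimes> R)\<close>.\<close>

definition comult_tensor ::
  "('h \<Rightarrow> 'r \<Rightarrow> 'r) \<Rightarrow> ('r \<Rightarrow> ('h \<times> 'r) list) \<Rightarrow> ('r \<Rightarrow> ('r \<times> 'r) list) \<Rightarrow>
   'r \<Rightarrow> 'r \<Rightarrow> (('r \<times> 'r) \<times> 'r \<times> 'r) list" where
  "comult_tensor act \<rho> \<delta> r s =
     [((r1, act u s1), (r20, s2)). (r1, r2) \<leftarrow> \<delta> r, (u, r20) \<leftarrow> \<rho> r2, (s1, s2) \<leftarrow> \<delta> s]"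

locale pre_bialgebra = yd_coalgebra sH \<Delta> \<epsilon> S sR act \<rho> \<delta> \<epsilon>R
  for sH :: "'k::field \<Rightarrow> 'h::ring_1 \<Rightarrow> 'h"
    and \<Delta> :: "'h \<Rightarrow> ('h \<times> 'h) list"
    and \<epsilon> :: "'h \<Rightarrow> 'k"
    and S :: "'h \<Rightarrow> 'h"
    and sR :: "'k \<Rightarrow> 'r::ab_group_add \<Rightarrow> 'r"
    and act :: "'h \<Rightarrow> 'r \<Rightarrow> 'r"
    and \<rho> :: "'r \<Rightarrow> ('h \<times> 'r) list"
    and \<delta> :: "'r \<Rightarrow> ('r \<times> 'r) list"
    and \<epsilon>R :: "'r \<Rightarrow> 'k"
    and m :: "'r \<Rightarrow> 'r \<Rightarrow> 'r"
    and oneR :: "'r" +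
  assumes m_bilinear: "bilinear_map sR sR sR m"
    and act_oneR: "act h oneR = sR (\<epsilon> h) oneR"
    and coact_oneR: "tensor_eq sH sR (\<rho> oneR) [(1, oneR)]"
    and comult_oneR: "tensor_eq sR sR (\<delta> oneR) [(oneR, oneR)]"
    and counit_oneR: "\<epsilon>R oneR = 1"
    and act_m: "act h (m r s) = (\<Sum>(h1, h2)\<leftarrow>\<Delta> h. m (act h1 r) (act h2 s))"
    and comult_m: "tensor_eq sR sR (\<delta> (m r s))
      [(m p1 p2, m p3 p4). ((p1, p2), (p3, p4)) \<leftarrow> comult_tensor act \<rho> \<delta> r s]"
    and counit_m: "\<epsilon>R (m r s) = \<epsilon>R r * \<epsilon>R s"
    and m_oneR_right: "m r oneR = r"
    and m_oneR_left: "m oneR r = r"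

text \<open>\<open>(m \<otimes> \<xi>) \<delta>\<^bsub>R\<otimes>R\<^esub> (r \<otimes> s)\<close>, an element of \<open>R \<otimes> H\<close>.\<close>

definition m_xi_comult ::
  "('h \<Rightarrow> 'r \<Rightarrow> 'r) \<Rightarrow> ('r \<Rightarrow> ('h \<times> 'r) list) \<Rightarrow> ('r \<Rightarrow> ('r \<times> 'r) list) \<Rightarrow>
   ('r \<Rightarrow> 'r \<Rightarrow> 'r) \<Rightarrow> ('r \<Rightarrow> 'r \<Rightarrow> 'h) \<Rightarrow> 'r \<Rightarrow> 'r \<Rightarrow> ('r \<times> 'h) list" where
  "m_xi_comult act \<rho> \<delta> m \<xi> r s =
     [(m p1 p2, \<xi> p3 p4). ((p1, p2), (p3, p4)) \<leftarrow> comult_tensor act \<rho> \<delta> r s]"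

locale pre_bialgebra_cocycle = pre_bialgebra sH \<Delta> \<epsilon> S sR act \<rho> \<delta> \<epsilon>R m oneR
  for sH :: "'k::field \<Rightarrow> 'h::ring_1 \<Rightarrow> 'h"
    and \<Delta> :: "'h \<Rightarrow> ('h \<times> 'h) list"
    and \<epsilon> :: "'h \<Rightarrow> 'k"
    and S :: "'h \<Rightarrow> 'h"
    and sR :: "'k \<Rightarrow> 'r::ab_group_add \<Rightarrow> 'r"
    and act :: "'h \<Rightarrow> 'r \<Rightarrow> 'r"
    and \<rho> :: "'r \<Rightarrow> ('h \<times> 'r) list"
    and \<delta> :: "'r \<Rightarrow> ('r \<times> 'r) list"
    and \<epsilon>R :: "'r \<Rightarrow> 'k"
    and m :: "'r \<Rightarrow> 'r \<Rightarrow> 'r"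
    and oneR :: "'r"
    and \<xi> :: "'r \<Rightarrow> 'r \<Rightarrow> 'h" +
  assumes xi_bilinear: "bilinear_map sR sR sH \<xi>"
    and xi_act: "(\<Sum>(h1, h2)\<leftarrow>\<Delta> h. \<xi> (act h1 r) (act h2 s)) =
      (\<Sum>(h1, h2)\<leftarrow>\<Delta> h. h1 * \<xi> r s * S h2)"
    and comult_xi: "tensor_eq sH sH (\<Delta> (\<xi> r s))
      [(\<xi> p1 p2 * u, \<xi> t3 t4).
        ((p1, p2), (p3, p4)) \<leftarrow> comult_tensor act \<rho> \<delta> r s, (u, t3, t4) \<leftarrow> coact_tensor \<rho> p3 p4]"
    and counit_xi: "\<epsilon> (\<xi> r s) = \<epsilon>R r * \<epsilon>R s"
    and xi_m_compat: "tensor_eq sH sR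
      [(u * h, t0). (t, h) \<leftarrow> m_xi_comult act \<rho> \<delta> m \<xi> r s, (u, t0) \<leftarrow> \<rho> t]
      [(\<xi> p1 p2 * u, m t3 t4).
        ((p1, p2), (p3, p4)) \<leftarrow> comult_tensor act \<rho> \<delta> r s, (u, t3, t4) \<leftarrow> coact_tensor \<rho> p3 p4]"
    and m_quasi_assoc: "m r (m s t) =
      (\<Sum>(x, h)\<leftarrow>m_xi_comult act \<rho> \<delta> m \<xi> r s. m x (act h t))"
    and xi_cocycle: "(\<Sum>(x, h)\<leftarrow>m_xi_comult act \<rho> \<delta> m \<xi> s t. \<xi> r x * h) =
      (\<Sum>(x, h)\<leftarrow>m_xi_comult act \<rho> \<delta> m \<xi> r s. \<Sum>(h1, h2)\<leftarrow>\<Delta> h. \<xi> x (act h1 t) * h2)"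
    and xi_oneR_right: "\<xi> r oneR = sH (\<epsilon>R r) 1"
    and xi_oneR_left: "\<xi> oneR r = sH (\<epsilon>R r) 1"

locale braided_bialgebra = pre_bialgebra sH \<Delta> \<epsilon> S sR act \<rho> \<delta> \<epsilon>R m oneR
  for sH :: "'k::field \<Rightarrow> 'h::ring_1 \<Rightarrow> 'h"
    and \<Delta> :: "'h \<Rightarrow> ('h \<times> 'h) list"
    and \<epsilon> :: "'h \<Rightarrow> 'k"
    and S :: "'h \<Rightarrow> 'h"
    and sR :: "'k \<Rightarrow> 'r::ab_group_add \<Rightarrow> 'r"
    and act :: "'h \<Rightarrow> 'r \<Rightarrow> 'r"
    and \<rho> :: "'r \<Rightarrow> ('h \<times> 'r) list"
    and \<delta> :: "'r \<Rightarrow> ('r \<times> 'r) list"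
    and \<epsilon>R :: "'r \<Rightarrow> 'k"
    and m :: "'r \<Rightarrow> 'r \<Rightarrow> 'r"
    and oneR :: "'r" +
  assumes m_assoc: "m (m r s) t = m r (m s t)"
    and coact_m: "tensor_eq sH sR (\<rho> (m r s)) [(u, m r0 s0). (u, r0, s0) \<leftarrow> coact_tensor \<rho> r s]"

text \<open>
  The multiplication of a pre-bialgebra need not be associative, so the bracketing is fixed as
  \<open>y\<^sup>n\<^sup>+\<^sup>1 = y \<cdot> y\<^sup>n\<close>.
\<close>

fun mpower :: "('r \<Rightarrow> 'r \<Rightarrow> 'r) \<Rightarrow> 'r \<Rightarrow> 'r \<Rightarrow> nat \<Rightarrow> 'r" where
  "mpower m e y 0 = e"
| "mpower m e y (Suc n) = m y (mpower m e y n)"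


section \<open>Yetter-Drinfeld data and quantum lines\<close>

definition primitive_root_of_unity :: "nat \<Rightarrow> 'k::field \<Rightarrow> bool" where
  "primitive_root_of_unity n q \<longleftrightarrow> n > 0 \<and> q ^ n = 1 \<and> (\<forall>k. 0 < k \<and> k < n \<longrightarrow> q ^ k \<noteq> 1)"

definition yd_datum ::
  "('k::field \<Rightarrow> 'h::ring_1 \<Rightarrow> 'h) \<Rightarrow> ('h \<Rightarrow> ('h \<times> 'h) list) \<Rightarrow> ('h \<Rightarrow> 'k) \<Rightarrow>
   nat \<Rightarrow> 'k \<Rightarrow> 'h \<Rightarrow> ('h \<Rightarrow> 'k) \<Rightarrow> bool" where
  "yd_datum sH \<Delta> \<epsilon> \<theta> q g \<chi> \<longleftrightarrow>
     primitive_root_of_unity \<theta> q \<and>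
     g \<in> grouplikes sH \<Delta> \<epsilon> \<and>
     Vector_Spaces.linear sH (*) \<chi> \<and> \<chi> 1 = 1 \<and> (\<forall>h k. \<chi> (h * k) = \<chi> h * \<chi> k) \<and>
     \<chi> g = q \<and>
     (\<forall>h. g * (\<Sum>(a, b)\<leftarrow>\<Delta> h. sH (\<chi> a) b) = (\<Sum>(a, b)\<leftarrow>\<Delta> h. sH (\<chi> b) a) * g)"

definition associated_yd_datum ::
  "('k::field \<Rightarrow> 'h::ring_1 \<Rightarrow> 'h) \<Rightarrow> ('h \<Rightarrow> ('h \<times> 'h) list) \<Rightarrow> ('h \<Rightarrow> 'k) \<Rightarrow>
   ('k \<Rightarrow> 'r::ab_group_add \<Rightarrow> 'r) \<Rightarrow> ('h \<Rightarrow> 'r \<Rightarrow> 'r) \<Rightarrow> ('r \<Rightarrow> ('h \<times> 'r) list) \<Rightarrow>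
   nat \<Rightarrow> 'r \<Rightarrow> 'h \<Rightarrow> ('h \<Rightarrow> 'k) \<Rightarrow> bool" where
  "associated_yd_datum sH \<Delta> \<epsilon> sR act \<rho> N y g \<chi> \<longleftrightarrow>
     (\<exists>\<theta> q. 2 \<le> \<theta> \<and> \<theta> \<le> N \<and> yd_datum sH \<Delta> \<epsilon> \<theta> q g \<chi>) \<and>
     tensor_eq sH sR (\<rho> y) [(g, y)] \<and>
     (\<forall>h. act h y = sR (\<chi> h) y)"

definition compatible_datum ::
  "('k::field \<Rightarrow> 'h::ring_1 \<Rightarrow> 'h) \<Rightarrow> ('h \<Rightarrow> ('h \<times> 'h) list) \<Rightarrow> ('h \<Rightarrow> 'k) \<Rightarrow> ('h \<Rightarrow> 'h) \<Rightarrow>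
   nat \<Rightarrow> 'k \<Rightarrow> 'h \<Rightarrow> ('h \<Rightarrow> 'k) \<Rightarrow> 'k \<Rightarrow> bool" where
  "compatible_datum sH \<Delta> \<epsilon> S N q g \<chi> lam \<longleftrightarrow>
     yd_datum sH \<Delta> \<epsilon> N q g \<chi> \<and>
     (g ^ N = 1 \<or>
      (\<exists>h. sH (convolution_power \<Delta> \<epsilon> \<chi> N h) (1 - g ^ N) \<noteq>
           (\<Sum>(a, b)\<leftarrow>\<Delta> h. a * (1 - g ^ N) * S b)) \<longrightarrow> lam = 0)"

text \<open>
  \<open>R = R\<^sub>q(H, g, \<chi>)\<close> with \<open>y\<close> the class of \<open>X\<close>: the map \<open>\<phi>\<close> below induces an algebra
  isomorphism from \<open>K[X]/(X\<^sup>N)\<close> to \<open>R\<close> sending the class of \<open>X\<close> to \<open>y\<close>. The braided bialgebra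
  structure is determined by the last three conditions.
\<close>

definition is_quantum_line ::
  "('k::field \<Rightarrow> 'h::ring_1 \<Rightarrow> 'h) \<Rightarrow> ('h \<Rightarrow> ('h \<times> 'h) list) \<Rightarrow> ('h \<Rightarrow> 'k) \<Rightarrow> ('h \<Rightarrow> 'h) \<Rightarrow>
   ('k \<Rightarrow> 'r::ab_group_add \<Rightarrow> 'r) \<Rightarrow> ('h \<Rightarrow> 'r \<Rightarrow> 'r) \<Rightarrow> ('r \<Rightarrow> ('h \<times> 'r) list) \<Rightarrow>
   ('r \<Rightarrow> ('r \<times> 'r) list) \<Rightarrow> ('r \<Rightarrow> 'k) \<Rightarrow> ('r \<Rightarrow> 'r \<Rightarrow> 'r) \<Rightarrow> 'r \<Rightarrow>
   nat \<Rightarrow> 'k \<Rightarrow> 'h \<Rightarrow> ('h \<Rightarrow> 'k) \<Rightarrow> 'r \<Rightarrow> bool" where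
  "is_quantum_line sH \<Delta> \<epsilon> S sR act \<rho> \<delta> \<epsilon>R m oneR N q g \<chi> y \<longleftrightarrow>
     yd_datum sH \<Delta> \<epsilon> N q g \<chi> \<and>
     braided_bialgebra sH \<Delta> \<epsilon> S sR act \<rho> \<delta> \<epsilon>R m oneR \<and>
     (\<exists>\<phi> :: 'k poly \<Rightarrow> 'r.
        Vector_Spaces.linear smult sR \<phi> \<and> \<phi> 1 = oneR \<and> (\<forall>p p'. \<phi> (p * p') = m (\<phi> p) (\<phi> p')) \<and>
        surj \<phi> \<and> (\<forall>p. \<phi> p = 0 \<longleftrightarrow> [:0, 1:] ^ N dvd p) \<and> \<phi> [:0, 1:] = y) \<and>
     (\<forall>h. act h y = sR (\<chi> h) y) \<and>
     tensor_eq sH sR (\<rho> y) [(g, y)] \<and>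
     tensor_eq sR sR (\<delta> y) [(y, oneR), (oneR, y)]"

end

theory Submission
  imports Defs
begin

text \<open>Everything is computed on the powers \<open>y\<^sup>0, y\<^sup>1, \<dots>\<close>, written \<open>pw n\<close>. Let \<open>\<theta>\<close> be the order of
  \<open>q = \<chi>(g)\<close>. On powers the action is \<open>h y\<^sup>n = \<chi>\<^sup>n(h) y\<^sup>n\<close> and the comultiplication is given by the
  Gaussian binomial coefficients (\<open>comult_pw_sum\<close>). Those of level \<open>\<theta>\<close> vanish, so \<open>y\<^sup>\<theta>\<close> is primitive,
  hence a multiple of \<open>y\<close>; but \<open>g\<close> fixes it and multiplies \<open>y\<close> by \<open>q \<noteq> 1\<close>, so \<open>y\<^sup>\<theta> = 0\<close>.

  The cocycle is determined degree by degree. Put \<open>w = \<xi>(y\<^sup>a \<otimes> y\<^sup>b)\<close> and \<open>n = a + b > 0\<close>. If every middle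
  term of \<open>\<Delta>(w)\<close> has a vanishing factor, then \<open>\<Delta>(w) = w \<otimes> 1 + g\<^sup>n \<otimes> w\<close>. Applying the
  integral \<open>\<gamma>\<close> to the second factor gives \<open>w = \<gamma>(w) (1 - g\<^sup>n)\<close> (\<open>xi_eq_multiple\<close>), so \<open>w\<close> commutes
  with \<open>g\<close>; on the other hand conjugation by \<open>g\<close> multiplies \<open>w\<close> by \<open>q\<^sup>n\<close>. Hence \<open>w = 0\<close> whenever
  \<open>q\<^sup>n \<noteq> 1\<close> (\<open>xi_eq_0\<close>). Since \<open>a, b < \<theta>\<close> may be assumed, only \<open>n = \<theta>\<close> survives. The cocycle identity
  shows that all the values in degree \<open>\<theta>\<close> agree (\<open>xi_shift\<close>). If their common value is not zero, then
  applying \<open>\<gamma>\<close> to its transformation law under the adjoint action gives \<open>\<chi>\<^sup>\<theta> = \<epsilon>\<close>,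
  and an element on which the adjoint action is trivial is central.

  It remains to see that \<open>1, y, \<dots>, y\<^sup>\<theta>\<^sup>-\<^sup>1\<close> span \<open>R\<close>. Choose a functional \<open>t\<close> with \<open>t(1) = 0\<close> and
  \<open>t(y) = 1\<close>, and let \<open>shift\<close> be the operator \<open>r \<mapsto> r\<^sub>1 t(r\<^sub>2)\<close>. If the coradical is \<open>K 1\<close>, then
  every nonzero left coideal contains \<open>1\<close> (\<open>e_in_left_coideal\<close>). It follows that \<open>shift\<close> is nilpotent
  and, as the primitives are \<open>K y\<close>, that its kernel is \<open>K 1\<close>; so \<open>R\<close> is a single Jordan block and
  \<open>layer n = ker shift\<^sup>n\<close> is a full flag. If the powers of \<open>y\<close> did not fill the flag, there would be
  \<open>d\<close> with \<open>shift d = y\<^sup>\<theta>\<^sup>-\<^sup>1\<close>. Let \<open>D\<close> be a functional with \<open>D(d) = 1\<close> that vanishes on the powers of \<open>y\<close>.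
  The operators \<open>A : r \<mapsto> r\<^sub>1 D(r\<^sub>2)\<close> and \<open>B : r \<mapsto> d r\<close> satisfy \<open>A B = B A + 1 + E\<close> where \<open>E\<close>
  strictly lowers the flag. Taking traces gives \<open>dim R = 0\<close> in \<open>K\<close>, which is impossible in
  characteristic \<open>0\<close>. In effect \<open>d\<close> would behave like a variable of a polynomial ring, and no such
  variable exists in finite dimension.\<close>

section \<open>Tensor products and multilinear maps\<close>

lemma formal_scale_lookup [simp]:
  "Poly_Mapping.lookup (formal_scale c p) x = c * Poly_Mapping.lookup p x"
  unfolding formal_scale_def by (simp add: Poly_Mapping.map.rep_eq when_def)

lemma vector_space_formal_scale:
  "vector_space (formal_scale :: 'k::field \<Rightarrow> ('a \<Rightarrow>\<^sub>0 'k) \<Rightarrow> ('a \<Rightarrow>\<^sub>0 'k))"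
  by unfold_locales (auto intro!: poly_mapping_eqI simp: lookup_add algebra_simps)

lemma vector_space_field: "vector_space ((*) :: 'k::field \<Rightarrow> 'k \<Rightarrow> 'k)"
  by unfold_locales (auto simp: algebra_simps)

definition formal_extend ::
  "('k::field \<Rightarrow> 'v::ab_group_add \<Rightarrow> 'v) \<Rightarrow> ('a \<Rightarrow> 'v) \<Rightarrow> ('a \<Rightarrow>\<^sub>0 'k) \<Rightarrow> 'v" where
  "formal_extend sV f p = (\<Sum>x\<in>Poly_Mapping.keys p. sV (Poly_Mapping.lookup p x) (f x))"

context vector_space
begin

lemma formal_extend_superset:
  assumes "finite A" "Poly_Mapping.keys p \<subseteq> A"
  shows "formal_extend scale f p = (\<Sum>x\<in>A. scale (Poly_Mapping.lookup p x) (f x))"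
  unfolding formal_extend_def using assms
  by (intro sum.mono_neutral_left) (auto simp: in_keys_iff)

lemma linear_formal_extend:
  "Vector_Spaces.linear formal_scale scale (formal_extend scale f)"
proof -
  have add: "formal_extend scale f (p + q) = formal_extend scale f p + formal_extend scale f q" for p q
  proof -
    let ?A = "Poly_Mapping.keys p \<union> Poly_Mapping.keys q"
    have "Poly_Mapping.keys (p + q) \<subseteq> ?A" by (rule keys_add)
    then show ?thesis
      by (simp add: formal_extend_superset[of ?A] lookup_add scale_left_distrib sum.distrib)
  qed
  have hom: "formal_extend scale f (formal_scale c p) = scale c (formal_extend scale f p)" for c p
  proof -
    have "Poly_Mapping.keys (formal_scale c p) \<subseteq> Poly_Mapping.keys p" by (auto simp: in_keys_iff)
    then show ?thesis
      by (simp add: formal_extend_superset[of "Poly_Mapping.keys p"] scale_sum_right)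
  qed
  show ?thesis
    unfolding Vector_Spaces.linear_iff
    using add hom vector_space_formal_scale vector_space_axioms by blast
qed

lemma formal_extend_sum: "formal_extend scale f (formal_sum xs) = (\<Sum>x\<leftarrow>xs. f x)"
proof -
  interpret e: Vector_Spaces.linear formal_scale scale "formal_extend scale f"
    by (rule linear_formal_extend)
  have single: "formal_extend scale f (Poly_Mapping.single x 1) = f x" for x
    by (simp add: formal_extend_def)
  show ?thesis
    by (induction xs) (simp_all add: formal_sum_def single e.add)
qed

end

text \<open>Extend a basis of the span of \<open>A\<close> by \<open>x\<close> and prescribe the values on the extended basis.\<close>

lemma separating_functional:
  fixes sV :: "'k::field \<Rightarrow> 'v::ab_group_add \<Rightarrow> 'v"
  assumes "vector_space sV" "x \<notin> module.span sV A"
  shows "\<exists>f. Vector_Spaces.linear sV (*) f \<and> f x = 1 \<and> (\<forall>a\<in>A. f a = 0)"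
proof -
  interpret v: vector_space sV by fact
  interpret k: vector_space_pair sV "(*) :: 'k \<Rightarrow> _"
    using assms(1) vector_space_field by (simp add: vector_space_pair_def)
  obtain B where B: "B \<subseteq> A" "v.independent B" "A \<subseteq> v.span B"
    by (rule v.maximal_independent_subset)
  have x: "x \<notin> v.span B" using assms(2) v.span_mono[OF B(1)] by blast
  then have "v.independent (insert x B)" using B(2) v.independent_insertI by blast
  then obtain f where f: "Vector_Spaces.linear sV (*) f" "\<forall>b\<in>insert x B. f b = (if b = x then 1 else 0)"
    using k.linear_independent_extend[of "insert x B" "\<lambda>b. if b = x then 1 else 0"] by blast
  interpret f: Vector_Spaces.linear sV "(*)" f by (rule f(1))
  have "x \<notin> B" using x v.span_base by blast
  then have 0: "f b = 0" if "b \<in> B" for b using f(2) that by auto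
  have "f a = 0" if "a \<in> A" for a
    using B(3) that f.eq_0_on_span[OF 0, of B] by (meson subsetD)
  moreover have "f x = 1" using f(2) by simp
  ultimately show ?thesis using f(1) by blast
qed

definition trilinear_map ::
  "('k::field \<Rightarrow> 'u::ab_group_add \<Rightarrow> 'u) \<Rightarrow> ('k \<Rightarrow> 'v::ab_group_add \<Rightarrow> 'v) \<Rightarrow>
   ('k \<Rightarrow> 'w::ab_group_add \<Rightarrow> 'w) \<Rightarrow> ('k \<Rightarrow> 'x::ab_group_add \<Rightarrow> 'x) \<Rightarrow>
   ('u \<Rightarrow> 'v \<Rightarrow> 'w \<Rightarrow> 'x) \<Rightarrow> bool" where
  "trilinear_map sU sV sW sX f \<longleftrightarrow>
     (\<forall>v w. Vector_Spaces.linear sU sX (\<lambda>u. f u v w)) \<and>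
     (\<forall>u w. Vector_Spaces.linear sV sX (\<lambda>v. f u v w)) \<and>
     (\<forall>u v. Vector_Spaces.linear sW sX (\<lambda>w. f u v w))"

lemma bilinear_mapI:
  assumes "\<And>b. Vector_Spaces.linear sU sW (\<lambda>a. f a b)" "\<And>a. Vector_Spaces.linear sV sW (\<lambda>b. f a b)"
  shows "bilinear_map sU sV sW f"
  using assms by (simp add: bilinear_map_def)

lemma trilinear_mapI:
  assumes "\<And>b c. Vector_Spaces.linear sU sX (\<lambda>a. f a b c)"
    "\<And>a c. Vector_Spaces.linear sV sX (\<lambda>b. f a b c)"
    "\<And>a b. Vector_Spaces.linear sW sX (\<lambda>c. f a b c)"
  shows "trilinear_map sU sV sW sX f"
  using assms by (simp add: trilinear_map_def)

text \<open>The linear extension of a bilinear map to the free space vanishes on the bilinearity relations.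
  All identities between representing lists are used in this form.\<close>

lemma tensor_eq_sum_eq:
  assumes f: "bilinear_map sV sW sU f" and eq: "tensor_eq sV sW xs ys"
  shows "(\<Sum>(a, b)\<leftarrow>xs. f a b) = (\<Sum>(a, b)\<leftarrow>ys. f a b)"
proof -
  have l: "Vector_Spaces.linear sV sU (\<lambda>a. f a b)" "Vector_Spaces.linear sW sU (\<lambda>b. f a b)" for a b
    using f by (simp_all add: bilinear_map_def)
  interpret u: vector_space sU using l(1) by (simp add: Vector_Spaces.linear_iff)
  let ?F = "formal_extend sU (case_prod f)"
  interpret e: Vector_Spaces.linear formal_scale sU ?F
    by (rule u.linear_formal_extend)
  have "?F r = 0" if "r \<in> tensor_rels sV sW" for r
    using that l
    by (auto simp: tensor_rels_def e.diff e.scale u.formal_extend_sum Vector_Spaces.linear_iff)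
  then have "?F (formal_sum xs - formal_sum ys) = 0"
    using eq e.eq_0_on_span unfolding tensor_eq_def by blast
  then show ?thesis by (simp add: e.diff u.formal_extend_sum)
qed

lemma tensor3_eq_sum_eq:
  assumes f: "trilinear_map sU sV sW sX f" and eq: "tensor3_eq sU sV sW xs ys"
  shows "(\<Sum>(a, b, c)\<leftarrow>xs. f a b c) = (\<Sum>(a, b, c)\<leftarrow>ys. f a b c)"
proof -
  have l: "Vector_Spaces.linear sU sX (\<lambda>a. f a b c)" "Vector_Spaces.linear sV sX (\<lambda>b. f a b c)"
      "Vector_Spaces.linear sW sX (\<lambda>c. f a b c)" for a b c
    using f by (simp_all add: trilinear_map_def)
  interpret u: vector_space sX using l(1) by (simp add: Vector_Spaces.linear_iff)
  let ?F = "formal_extend sX (\<lambda>(a, b, c). f a b c)"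
  interpret e: Vector_Spaces.linear formal_scale sX ?F
    by (rule u.linear_formal_extend)
  have "?F r = 0" if "r \<in> tensor3_rels sU sV sW" for r
    using that l
    by (auto simp: tensor3_rels_def e.diff e.scale u.formal_extend_sum Vector_Spaces.linear_iff)
  then have "?F (formal_sum xs - formal_sum ys) = 0"
    using eq e.eq_0_on_span unfolding tensor3_eq_def by blast
  then show ?thesis by (simp add: e.diff u.formal_extend_sum)
qed

text \<open>Bilinear forms separate the elements of \<open>V \<otimes> W\<close>: a functional on the free space that
  vanishes on the bilinearity relations is a bilinear form.\<close>

lemma tensor_eqI:
  fixes sV :: "'k::field \<Rightarrow> 'v::ab_group_add \<Rightarrow> 'v" and sW :: "'k \<Rightarrow> 'w::ab_group_add \<Rightarrow> 'w"
  assumes "vector_space sV" "vector_space sW"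
    and eq: "\<And>f. bilinear_map sV sW (*) f \<Longrightarrow> (\<Sum>(a, b)\<leftarrow>xs. f a b) = (\<Sum>(a, b)\<leftarrow>ys. f a b)"
  shows "tensor_eq sV sW xs ys"
proof (rule ccontr)
  assume "\<not> tensor_eq sV sW xs ys"
  then have "formal_sum xs - formal_sum ys \<notin> module.span formal_scale (tensor_rels sV sW)"
    by (simp add: tensor_eq_def)
  then obtain F where F: "Vector_Spaces.linear formal_scale (*) F"
      "F (formal_sum xs - formal_sum ys) = 1" "\<forall>r\<in>tensor_rels sV sW. F r = 0"
    using separating_functional[OF vector_space_formal_scale] by blast
  interpret F: Vector_Spaces.linear formal_scale "(*)" F by (rule F(1))
  define f where "f a b = F (formal_sum [(a, b)])" for a b
  have rel: "F r = 0" if "r \<in> tensor_rels sV sW" for r using F(3) that by blast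
  have two: "F (formal_sum [x, x']) = F (formal_sum [x]) + F (formal_sum [x'])" for x x'
    by (simp add: formal_sum_def F.add)
  have "f (v + v') w = f v w + f v' w" for v v' w
  proof -
    have "formal_sum [(v + v', w)] - formal_sum [(v, w), (v', w)] \<in> tensor_rels sV sW"
      unfolding tensor_rels_def by blast
    from rel[OF this] show ?thesis by (simp add: f_def F.diff two)
  qed
  moreover have "f v (w + w') = f v w + f v w'" for v w w'
  proof -
    have "formal_sum [(v, w + w')] - formal_sum [(v, w), (v, w')] \<in> tensor_rels sV sW"
      unfolding tensor_rels_def by blast
    from rel[OF this] show ?thesis by (simp add: f_def F.diff two)
  qed
  moreover have "f (sV c v) w = c * f v w" for c v w
  proof -
    have "formal_sum [(sV c v, w)] - formal_scale c (formal_sum [(v, w)]) \<in> tensor_rels sV sW"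
      unfolding tensor_rels_def by blast
    from rel[OF this] show ?thesis by (simp add: f_def F.diff F.scale)
  qed
  moreover have "f v (sW c w) = c * f v w" for c v w
  proof -
    have "formal_sum [(v, sW c w)] - formal_scale c (formal_sum [(v, w)]) \<in> tensor_rels sV sW"
      unfolding tensor_rels_def by blast
    from rel[OF this] show ?thesis by (simp add: f_def F.diff F.scale)
  qed
  ultimately have "bilinear_map sV sW (*) f"
    using assms(1,2) vector_space_field by (auto simp: bilinear_map_def Vector_Spaces.linear_iff)
  then have "(\<Sum>(a, b)\<leftarrow>xs. f a b) = (\<Sum>(a, b)\<leftarrow>ys. f a b)" by (rule eq)
  moreover have "F (formal_sum zs) = (\<Sum>(a, b)\<leftarrow>zs. f a b)" for zs
    by (induction zs) (auto simp: formal_sum_def f_def F.add F.zero)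
  ultimately show False using F(2) by (simp add: F.diff)
qed

lemma sum_list_concat: "sum_list (concat xss) = sum_list (map sum_list xss)"
  by (induction xss) simp_all

lemma bilinear_map_codomain: "bilinear_map sU sV sW f \<Longrightarrow> vector_space sW"
  by (simp add: bilinear_map_def Vector_Spaces.linear_iff)

subsection \<open>Building linear maps\<close>

text \<open>Sweedler sums are evaluated by replacing one list at a time, and each replacement requires the
  linearity of the rest of the expression. The rules below reduce this to the syntactic structure
  of the expression.\<close>

named_theorems linear_intros

lemma linear_identity [linear_intros]: "vector_space s \<Longrightarrow> Vector_Spaces.linear s s (\<lambda>x. x)"
  by (simp add: Vector_Spaces.linear_iff)

lemma linear_map_zero: "Vector_Spaces.linear s1 s2 f \<Longrightarrow> f 0 = 0"
proof -
  assume "Vector_Spaces.linear s1 s2 f"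
  then interpret Vector_Spaces.linear s1 s2 f .
  show ?thesis by (rule zero)
qed

lemma linear_app:
  assumes "Vector_Spaces.linear s2 s3 g" "Vector_Spaces.linear s1 s2 f"
  shows "Vector_Spaces.linear s1 s3 (\<lambda>x. g (f x))"
  using assms by (simp add: Vector_Spaces.linear_iff)

lemma linear_bilinear_left:
  assumes "bilinear_map s2 s2' s3 g" "Vector_Spaces.linear s1 s2 f"
  shows "Vector_Spaces.linear s1 s3 (\<lambda>x. g (f x) b)"
  using assms by (simp add: Vector_Spaces.linear_iff bilinear_map_def)

lemma linear_bilinear_right:
  assumes "bilinear_map s2' s2 s3 g" "Vector_Spaces.linear s1 s2 f"
  shows "Vector_Spaces.linear s1 s3 (\<lambda>x. g a (f x))"
  using assms by (simp add: Vector_Spaces.linear_iff bilinear_map_def)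

lemma linear_fun_scale [linear_intros]:
  assumes "Vector_Spaces.linear s1 s2 f"
  shows "Vector_Spaces.linear s1 s2 (\<lambda>x. s2 c (f x))"
proof -
  interpret vector_space_pair s1 s2 using assms
    by (simp add: Vector_Spaces.linear_iff vector_space_pair_def)
  from assms show ?thesis by (rule linear_compose_scale_right)
qed

lemma linear_functional_scale [linear_intros]:
  assumes "Vector_Spaces.linear s1 (*) f" "vector_space s2"
  shows "Vector_Spaces.linear s1 s2 (\<lambda>x. s2 (f x) v)"
proof -
  interpret vector_space s2 by fact
  show ?thesis using assms by (simp add: Vector_Spaces.linear_iff scale_left_distrib)
qed

lemma linear_fun_add [linear_intros]:
  assumes "Vector_Spaces.linear s1 s2 f" "Vector_Spaces.linear s1 s2 g"
  shows "Vector_Spaces.linear s1 s2 (\<lambda>x. f x + g x)"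
proof -
  interpret vector_space_pair s1 s2 using assms
    by (simp add: Vector_Spaces.linear_iff vector_space_pair_def)
  from assms show ?thesis by (rule linear_compose_add)
qed

lemma linear_fun_diff [linear_intros]:
  assumes "Vector_Spaces.linear s1 s2 f" "Vector_Spaces.linear s1 s2 g"
  shows "Vector_Spaces.linear s1 s2 (\<lambda>x. f x - g x)"
proof -
  interpret vector_space_pair s1 s2 using assms
    by (simp add: Vector_Spaces.linear_iff vector_space_pair_def)
  from assms show ?thesis by (rule linear_compose_sub)
qed

lemma linear_fun_sum [linear_intros]:
  assumes "vector_space s1" "vector_space s2" "\<And>i. Vector_Spaces.linear s1 s2 (\<lambda>x. f x i)"
  shows "Vector_Spaces.linear s1 s2 (\<lambda>x. sum (f x) A)"
proof -
  interpret vector_space_pair s1 s2 using assms(1,2) by (simp add: vector_space_pair_def)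
  show ?thesis using assms(3) by (intro linear_compose_sum) auto
qed

lemma linear_fun_sum_list [linear_intros]:
  assumes "vector_space s1" "vector_space s2" "\<And>a b. Vector_Spaces.linear s1 s2 (\<lambda>x. f x a b)"
  shows "Vector_Spaces.linear s1 s2 (\<lambda>x. \<Sum>(a, b)\<leftarrow>xs. f x a b)"
proof -
  interpret vector_space_pair s1 s2 using assms(1,2) by (simp add: vector_space_pair_def)
  show ?thesis
  proof (induction xs)
    case Nil
    then show ?case by (simp add: linear_zero)
  next
    case (Cons p xs)
    from linear_fun_add[OF assms(3)[of "fst p" "snd p"] this] show ?case by (simp add: case_prod_beta)
  qed
qed

lemma linear_sum_list_map:
  assumes "Vector_Spaces.linear s1 s2 g"
  shows "g (\<Sum>(a, b)\<leftarrow>xs. f a b) = (\<Sum>(a, b)\<leftarrow>xs. g (f a b))"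
proof -
  interpret g: Vector_Spaces.linear s1 s2 g by fact
  show ?thesis by (induction xs) (auto simp: g.add)
qed

lemma linear_tensor_sum:
  assumes \<Delta>: "linear_into_tensor sU sV sW \<Delta>" and f: "bilinear_map sV sW sX f"
    and "vector_space sU"
  shows "Vector_Spaces.linear sU sX (\<lambda>x. \<Sum>(a, b)\<leftarrow>\<Delta> x. f a b)"
proof -
  have X: "vector_space sX" and scale: "f (sV c a) b = sX c (f a b)" for c a b
    using f by (auto simp: bilinear_map_def Vector_Spaces.linear_iff)
  interpret vector_space sX by (rule X)
  have "(\<Sum>(a, b)\<leftarrow>\<Delta> (sU c x). f a b) = sX c (\<Sum>(a, b)\<leftarrow>\<Delta> x. f a b)" for c x
  proof -
    have "(\<Sum>(a, b)\<leftarrow>\<Delta> (sU c x). f a b) = (\<Sum>(a, b)\<leftarrow>[(sV c a, b). (a, b) \<leftarrow> \<Delta> x]. f a b)"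
      using \<Delta> by (intro tensor_eq_sum_eq[OF f]) (simp add: linear_into_tensor_def)
    also have "(\<Sum>(a, b)\<leftarrow>[(sV c a, b). (a, b) \<leftarrow> xs]. f a b) = sX c (\<Sum>(a, b)\<leftarrow>xs. f a b)" for xs
      by (induction xs) (auto simp: scale scale_right_distrib)
    finally show ?thesis .
  qed
  moreover have "(\<Sum>(a, b)\<leftarrow>\<Delta> (x + x'). f a b) = (\<Sum>(a, b)\<leftarrow>\<Delta> x. f a b) + (\<Sum>(a, b)\<leftarrow>\<Delta> x'. f a b)" for x x'
  proof -
    have "(\<Sum>(a, b)\<leftarrow>\<Delta> (x + x'). f a b) = (\<Sum>(a, b)\<leftarrow>\<Delta> x @ \<Delta> x'. f a b)"
      using \<Delta> by (intro tensor_eq_sum_eq[OF f]) (simp add: linear_into_tensor_def)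
    then show ?thesis by simp
  qed
  ultimately show ?thesis using assms(3) X by (simp add: Vector_Spaces.linear_iff)
qed

text \<open>Compose \<open>f\<close> with a right inverse of \<open>T\<close> on the range of \<open>T\<close>.\<close>

lemma linear_kernel_factor:
  fixes s1 :: "'k::field \<Rightarrow> 'v::ab_group_add \<Rightarrow> 'v" and s2 :: "'k \<Rightarrow> 'w::ab_group_add \<Rightarrow> 'w"
  assumes T: "Vector_Spaces.linear s1 s1 T" and f: "Vector_Spaces.linear s1 s2 f"
    and "\<And>x. T x = 0 \<Longrightarrow> f x = 0"
  shows "\<exists>f'. Vector_Spaces.linear s1 s2 f' \<and> (\<forall>x. f x = f' (T x))"
proof -
  interpret T: Vector_Spaces.linear s1 s1 T by (rule T)
  interpret f: Vector_Spaces.linear s1 s2 f by (rule f)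
  interpret vector_space_pair s1 s1 by unfold_locales
  obtain g where g: "Vector_Spaces.linear s1 s1 g" "\<forall>v\<in>T ` UNIV. T (g v) = v"
    using linear_exists_right_inverse_on[OF T T.vs1.subspace_UNIV] by blast
  have "f x = f (g (T x))" for x
    using assms(3)[of "x - g (T x)"] g(2) by (simp add: T.diff f.diff)
  moreover have "Vector_Spaces.linear s1 s2 (\<lambda>x. f (g x))" by (rule linear_app[OF f g(1)])
  ultimately show ?thesis by blast
qed

section \<open>Finite-dimensional coalgebras with one-dimensional coradical\<close>

context vector_space
begin

text \<open>Identities between vectors of a coalgebra are proved by applying an arbitrary functional, which
  exchanges the left and the right action of the dual algebra.\<close>

lemma functionals_separate:
  assumes "\<And>f. Vector_Spaces.linear scale (*) f \<Longrightarrow> f x = f y"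
  shows "x = y"
proof (rule ccontr)
  assume "x \<noteq> y"
  then have "x - y \<notin> span {}" by simp
  then obtain f where f: "Vector_Spaces.linear scale (*) f" "f (x - y) = 1"
    using separating_functional[OF vector_space_axioms] by blast
  then interpret f: Vector_Spaces.linear scale "(*)" f by simp
  show False using assms[OF f(1)] f(2) by (simp add: f.diff)
qed

end

text \<open>A one-dimensional coradical is spanned by the grouplike element \<open>e\<close>, see \<open>coradical_eq\<close>.\<close>

locale connected_coalgebra = k_coalgebra sC \<Delta> \<epsilon>
  for sC :: "'k::field \<Rightarrow> 'c::ab_group_add \<Rightarrow> 'c"
    and \<Delta> :: "'c \<Rightarrow> ('c \<times> 'c) list"
    and \<epsilon> :: "'c \<Rightarrow> 'k" +
  fixes e :: 'c and n :: nat
  assumes dimension_n: "has_dimension sC n"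
    and dim_coradical: "vector_space.dim sC (coradical sC \<Delta>) = 1"
    and comult_e: "tensor_eq sC sC (\<Delta> e) [(e, e)]"
    and counit_e: "\<epsilon> e = 1"
begin

definition some_basis :: "'c set" where
  "some_basis = (SOME B. finite B \<and> independent B \<and> span B = UNIV)"

lemma some_basis: "finite some_basis" "independent some_basis" "span some_basis = UNIV"
proof -
  have "\<exists>B. finite B \<and> independent B \<and> span B = UNIV"
    using dimension_n by (auto simp: has_dimension_def)
  then have "finite some_basis \<and> independent some_basis \<and> span some_basis = UNIV"
    unfolding some_basis_def by (rule someI_ex)
  then show "finite some_basis" "independent some_basis" "span some_basis = UNIV" by auto
qed

sublocale finite_dimensional_vector_space sC some_basis
  by unfold_locales (use some_basis in auto)

abbreviation functional :: "('c \<Rightarrow> 'k) \<Rightarrow> bool" where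
  "functional \<equiv> Vector_Spaces.linear sC (*)"

lemma functional_counit: "functional \<epsilon>" by (rule counit_linear)

lemma functional_diff_scale:
  assumes "functional f" "functional g"
  shows "functional (\<lambda>x. f x - c * g x)"
  by (intro linear_fun_diff linear_fun_scale assms)

text \<open>The two actions of the dual algebra \<open>C\<^sup>*\<close> (with convolution) on \<open>C\<close>. Subspaces and linear maps
  compatible with the comultiplication are handled through these actions, so that no tensors occur.\<close>

definition contract_right :: "('c \<Rightarrow> 'k) \<Rightarrow> 'c \<Rightarrow> 'c" where
  "contract_right f x = (\<Sum>(a, b)\<leftarrow>\<Delta> x. sC (f b) a)"

definition contract_left :: "('c \<Rightarrow> 'k) \<Rightarrow> 'c \<Rightarrow> 'c" where
  "contract_left f x = (\<Sum>(a, b)\<leftarrow>\<Delta> x. sC (f a) b)"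

definition convolution :: "('c \<Rightarrow> 'k) \<Rightarrow> ('c \<Rightarrow> 'k) \<Rightarrow> 'c \<Rightarrow> 'k" where
  "convolution f g x = (\<Sum>(a, b)\<leftarrow>\<Delta> x. f a * g b)"

lemma bilinear_functional_scale:
  assumes "functional f"
  shows "bilinear_map sC sC sC (\<lambda>a b. sC (f b) a)" "bilinear_map sC sC sC (\<lambda>a b. sC (f a) b)"
  by (intro bilinear_mapI linear_fun_scale linear_functional_scale linear_identity assms
        vector_space_axioms)+

lemma bilinear_functional_mult:
  assumes "functional f" "functional g"
  shows "bilinear_map sC sC (*) (\<lambda>a b. f a * g b)"
  by (intro bilinear_mapI linear_fun_scale linear_functional_scale assms vector_space_field)

lemma linear_contract_right: "functional f \<Longrightarrow> Vector_Spaces.linear sC sC (contract_right f)"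
  unfolding contract_right_def [abs_def]
  by (intro linear_tensor_sum[OF comult_linear] bilinear_functional_scale vector_space_axioms)

lemma linear_contract_left: "functional f \<Longrightarrow> Vector_Spaces.linear sC sC (contract_left f)"
  unfolding contract_left_def [abs_def]
  by (intro linear_tensor_sum[OF comult_linear] bilinear_functional_scale vector_space_axioms)

lemma functional_convolution: "functional f \<Longrightarrow> functional g \<Longrightarrow> functional (convolution f g)"
  unfolding convolution_def [abs_def]
  by (intro linear_tensor_sum[OF comult_linear] bilinear_functional_mult vector_space_axioms)

lemma apply_contract_right:
  assumes "functional g" shows "g (contract_right f x) = convolution g f x"
  using assms unfolding contract_right_def convolution_def linear_sum_list_map[OF assms]
  by (simp add: Vector_Spaces.linear_iff mult.commute)

lemma apply_contract_left:
  assumes "functional g" shows "g (contract_left f x) = convolution f g x"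
  using assms unfolding contract_left_def convolution_def linear_sum_list_map[OF assms]
  by (simp add: Vector_Spaces.linear_iff mult.commute)

lemma contract_counit [simp]: "contract_right \<epsilon> x = x" "contract_left \<epsilon> x = x"
  by (simp_all add: contract_right_def contract_left_def counit_left counit_right)

lemma counit_contract [simp]:
  assumes "functional f"
  shows "\<epsilon> (contract_right f x) = f x" "\<epsilon> (contract_left f x) = f x"
  using apply_contract_right[OF counit_linear, of f x] apply_contract_left[OF counit_linear, of f x]
    apply_contract_left[OF assms, of \<epsilon> x] apply_contract_right[OF assms, of \<epsilon> x]
  by simp_all

lemma coassoc_sum:
  assumes "trilinear_map sC sC sC sX f"
  shows "(\<Sum>(a, b)\<leftarrow>\<Delta> x. \<Sum>(a1, a2)\<leftarrow>\<Delta> a. f a1 a2 b) = (\<Sum>(a, b)\<leftarrow>\<Delta> x. \<Sum>(b1, b2)\<leftarrow>\<Delta> b. f a b1 b2)"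
  using tensor3_eq_sum_eq[OF assms coassoc, of x]
  by (simp add: map_concat comp_def case_prod_unfold sum_list_concat)

lemma trilinear_functionals:
  assumes "functional f" "functional g"
  shows "trilinear_map sC sC sC sC (\<lambda>a b c. sC (f b * g c) a)"
    "trilinear_map sC sC sC sC (\<lambda>a b c. sC (f a * g c) b)"
  by (intro trilinear_mapI linear_fun_scale linear_functional_scale linear_functional_scale[of _ _ "(*)"]
        linear_identity assms vector_space_axioms vector_space_field)+

lemma scale_sum_list: "sC c (\<Sum>(a, b)\<leftarrow>xs. f a b) = (\<Sum>(a, b)\<leftarrow>xs. sC c (f a b))"
  by (induction xs) (auto simp: scale_right_distrib)

lemma sum_list_scale: "sC (\<Sum>(a, b)\<leftarrow>xs. f a b) v = (\<Sum>(a, b)\<leftarrow>xs. sC (f a b) v)"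
  by (induction xs) (auto simp: scale_left_distrib)

lemma contract_right_contract_right:
  assumes "functional f" "functional g"
  shows "contract_right f (contract_right g x) = contract_right (convolution f g) x"
proof -
  have "contract_right f (contract_right g x) =
      (\<Sum>(a, b)\<leftarrow>\<Delta> x. contract_right f (sC (g b) a))"
    unfolding contract_right_def[of g] by (rule linear_sum_list_map[OF linear_contract_right[OF assms(1)]])
  also have "\<dots> = (\<Sum>(a, b)\<leftarrow>\<Delta> x. sC (g b) (contract_right f a))"
    using linear_contract_right[OF assms(1)] by (simp add: Vector_Spaces.linear_iff)
  also have "\<dots> = (\<Sum>(a, b)\<leftarrow>\<Delta> x. \<Sum>(a1, a2)\<leftarrow>\<Delta> a. sC (f a2 * g b) a1)"
    by (simp add: contract_right_def scale_sum_list mult.commute)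
  also have "\<dots> = (\<Sum>(a, b)\<leftarrow>\<Delta> x. \<Sum>(b1, b2)\<leftarrow>\<Delta> b. sC (f b1 * g b2) a)"
    by (rule coassoc_sum[OF trilinear_functionals(1)[OF assms]])
  also have "\<dots> = contract_right (convolution f g) x"
    by (simp add: contract_right_def convolution_def sum_list_scale)
  finally show ?thesis .
qed

text \<open>Coassociativity says that the two actions commute.\<close>

lemma contract_left_contract_right:
  assumes "functional f" "functional g"
  shows "contract_left f (contract_right g x) = contract_right g (contract_left f x)"
proof -
  have "contract_left f (contract_right g x) =
      (\<Sum>(a, b)\<leftarrow>\<Delta> x. contract_left f (sC (g b) a))"
    unfolding contract_right_def[of g] by (rule linear_sum_list_map[OF linear_contract_left[OF assms(1)]])
  also have "\<dots> = (\<Sum>(a, b)\<leftarrow>\<Delta> x. sC (g b) (contract_left f a))"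
    using linear_contract_left[OF assms(1)] by (simp add: Vector_Spaces.linear_iff)
  also have "\<dots> = (\<Sum>(a, b)\<leftarrow>\<Delta> x. \<Sum>(a1, a2)\<leftarrow>\<Delta> a. sC (f a1 * g b) a2)"
    by (simp add: contract_left_def scale_sum_list mult.commute)
  also have "\<dots> = (\<Sum>(a, b)\<leftarrow>\<Delta> x. \<Sum>(b1, b2)\<leftarrow>\<Delta> b. sC (f a * g b2) b1)"
    by (rule coassoc_sum[OF trilinear_functionals(2)[OF assms]])
  also have "\<dots> = (\<Sum>(a, b)\<leftarrow>\<Delta> x. sC (f a) (contract_right g b))"
    by (simp add: contract_right_def scale_sum_list)
  also have "\<dots> = (\<Sum>(a, b)\<leftarrow>\<Delta> x. contract_right g (sC (f a) b))"
    using linear_contract_right[OF assms(2)] by (simp add: Vector_Spaces.linear_iff)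
  also have "\<dots> = contract_right g (contract_left f x)"
    unfolding contract_left_def[of f]
    by (rule linear_sum_list_map[OF linear_contract_right[OF assms(2)], symmetric])
  finally show ?thesis .
qed

text \<open>Expanding the second factors in a basis turns a bilinear form into a finite sum of forms
  \<open>a \<otimes> b \<mapsto> f(b) \<beta>(a, i)\<close> with \<open>f\<close> a coordinate functional.\<close>

lemma tensor_eq_contract_rightI:
  assumes "\<And>f. functional f \<Longrightarrow> (\<Sum>(a, b)\<leftarrow>xs. sC (f b) a) = (\<Sum>(a, b)\<leftarrow>ys. sC (f b) a)"
  shows "tensor_eq sC sC xs ys"
proof (rule tensor_eqI[OF vector_space_axioms vector_space_axioms])
  fix \<beta> :: "'c \<Rightarrow> 'c \<Rightarrow> 'k"
  assume \<beta>: "bilinear_map sC sC (*) \<beta>"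
  let ?r = "representation some_basis"
  have expand: "b = (\<Sum>i\<in>some_basis. sC (?r b i) i)" for b
    using some_basis by (simp add: sum_representation_eq)
  have rep: "functional (\<lambda>b. ?r b i)" for i
    using some_basis vector_space_axioms vector_space_field
    by (simp add: Vector_Spaces.linear_iff representation_add representation_scale)
  have one: "\<beta> a b = (\<Sum>i\<in>some_basis. \<beta> (sC (?r b i) a) i)" for a b
  proof -
    interpret l: Vector_Spaces.linear sC "(*)" "\<beta> a" using \<beta> by (simp add: bilinear_map_def)
    have "\<beta> a b = \<beta> a (\<Sum>i\<in>some_basis. sC (?r b i) i)" using expand by simp
    also have "\<dots> = (\<Sum>i\<in>some_basis. ?r b i * \<beta> a i)" by (simp add: l.sum l.scale)
    also have "\<dots> = (\<Sum>i\<in>some_basis. \<beta> (sC (?r b i) a) i)"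
      using \<beta> by (simp add: bilinear_map_def Vector_Spaces.linear_iff)
    finally show ?thesis .
  qed
  have "(\<Sum>(a, b)\<leftarrow>zs. \<beta> a b) = (\<Sum>i\<in>some_basis. \<beta> (\<Sum>(a, b)\<leftarrow>zs. sC (?r b i) a) i)" for zs
  proof (induction zs)
    case Nil
    have "\<beta> 0 i = 0" for i
    proof -
      interpret l: Vector_Spaces.linear sC "(*)" "\<lambda>a. \<beta> a i" using \<beta> by (simp add: bilinear_map_def)
      show ?thesis by (rule l.zero)
    qed
    then show ?case by simp
  next
    case (Cons p zs)
    then show ?case
      using \<beta> one[of "fst p" "snd p"]
      by (simp add: case_prod_beta bilinear_map_def Vector_Spaces.linear_iff sum.distrib)
  qed
  then show "(\<Sum>(a, b)\<leftarrow>xs. \<beta> a b) = (\<Sum>(a, b)\<leftarrow>ys. \<beta> a b)"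
    using assms[OF rep] by simp
qed


subsection \<open>Left coideals\<close>

text \<open>Stability under the left action is equivalent to \<open>\<Delta>(V) \<subseteq> C \<otimes> V\<close>.\<close>

definition left_coideal :: "'c set \<Rightarrow> bool" where
  "left_coideal V \<longleftrightarrow> subspace V \<and> (\<forall>f v. functional f \<longrightarrow> v \<in> V \<longrightarrow> contract_left f v \<in> V)"

lemma left_coidealD:
  assumes "left_coideal V"
  shows "subspace V" "functional f \<Longrightarrow> v \<in> V \<Longrightarrow> contract_left f v \<in> V"
  using assms by (auto simp: left_coideal_def)

lemma contract_e: "functional f \<Longrightarrow> contract_right f e = sC (f e) e"
    "functional f \<Longrightarrow> contract_left f e = sC (f e) e"
  using tensor_eq_sum_eq[OF bilinear_functional_scale(1) comult_e]
    tensor_eq_sum_eq[OF bilinear_functional_scale(2) comult_e]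
  by (simp_all add: contract_right_def contract_left_def)

lemma e_nonzero: "e \<noteq> 0"
  using counit_e linear_map_zero[OF functional_counit] by force

text \<open>If \<open>D\<close> is stable under both actions then a projection \<open>p\<close> onto \<open>D\<close> satisfies
  \<open>(p \<otimes> p) \<Delta>(x) = \<Delta>(x)\<close> on \<open>D\<close>, and this is a representing list with entries in \<open>D\<close>.\<close>

lemma subcoalgebraI:
  assumes D: "subspace D"
    and right: "\<And>f x. functional f \<Longrightarrow> x \<in> D \<Longrightarrow> contract_right f x \<in> D"
    and left: "\<And>f x. functional f \<Longrightarrow> x \<in> D \<Longrightarrow> contract_left f x \<in> D"
  shows "subcoalgebra sC \<Delta> D"
proof -
  interpret vector_space_pair sC sC by unfold_locales
  obtain p where p: "range p \<subseteq> D" "Vector_Spaces.linear sC sC p" "\<forall>v\<in>D. p v = v"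
    using linear_exists_left_inverse_on[OF linear_id D] by auto
  have "tensor_eq sC sC (\<Delta> x) [(p a, p b). (a, b) \<leftarrow> \<Delta> x]" if x: "x \<in> D" for x
  proof (rule tensor_eq_contract_rightI)
    fix f assume f: "functional f"
    have fp: "functional (\<lambda>b. f (p b))" by (rule linear_app[OF f p(2)])
    have "contract_right (\<lambda>b. f (p b)) x = contract_right f x"
    proof (rule functionals_separate)
      fix g assume g: "functional g"
      show "g (contract_right (\<lambda>b. f (p b)) x) = g (contract_right f x)"
        using left[OF g x] p(3) apply_contract_left[OF fp, of g x] apply_contract_left[OF f, of g x]
        by (simp add: apply_contract_right g)
    qed
    moreover have "p (contract_right (\<lambda>b. f (p b)) x) = (\<Sum>(a, b)\<leftarrow>\<Delta> x. sC (f (p b)) (p a))"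
      using p(2) unfolding contract_right_def linear_sum_list_map[OF p(2)]
      by (simp add: Vector_Spaces.linear_iff)
    moreover have "p (contract_right (\<lambda>b. f (p b)) x) = contract_right (\<lambda>b. f (p b)) x"
      using right[OF fp x] p(3) by blast
    ultimately show "(\<Sum>(a, b)\<leftarrow>\<Delta> x. sC (f b) a) = (\<Sum>(a, b)\<leftarrow>[(p a, p b). (a, b) \<leftarrow> \<Delta> x]. sC (f b) a)"
      by (simp add: contract_right_def comp_def case_prod_unfold)
  qed
  moreover have "set [(p a, p b). (a, b) \<leftarrow> \<Delta> x] \<subseteq> D \<times> D" for x
    using p(1) by auto
  ultimately have "\<exists>xs. set xs \<subseteq> D \<times> D \<and> tensor_eq sC sC (\<Delta> x) xs" if "x \<in> D" for x
    using that by blast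
  then show ?thesis unfolding subcoalgebra_def using D by blast
qed

lemma simple_subcoalgebra_le_coradical:
  assumes "simple_subcoalgebra sC \<Delta> D"
  shows "D \<subseteq> coradical sC \<Delta>"
proof -
  have "D \<subseteq> \<Union> {D. simple_subcoalgebra sC \<Delta> D}" using assms by (intro Union_upper) simp
  also have "\<dots> \<subseteq> coradical sC \<Delta>" unfolding coradical_def by (rule span_superset)
  finally show ?thesis .
qed

lemma coradical_eq: "coradical sC \<Delta> = span {e}"
proof -
  have sub: "subcoalgebra sC \<Delta> (span {e})"
  proof (rule subcoalgebraI)
    fix f x assume f: "functional f" and "x \<in> span {e}"
    then obtain c where x: "x = sC c e" by (auto simp: span_singleton)
    have l: "Vector_Spaces.linear sC sC (contract_right f)" "Vector_Spaces.linear sC sC (contract_left f)"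
      using f by (auto intro: linear_contract_right linear_contract_left)
    show "contract_right f x \<in> span {e}" "contract_left f x \<in> span {e}"
      using l unfolding x Vector_Spaces.linear_iff
      by (simp_all add: contract_e f span_scale span_base)
  qed simp
  have "E = {0} \<or> E = span {e}" if E: "subcoalgebra sC \<Delta> E" and sub: "E \<subseteq> span {e}" for E
  proof (cases "E \<subseteq> {0}")
    case True
    then show ?thesis using E subspace_0 by (auto simp: subcoalgebra_def)
  next
    case False
    then obtain x where x: "x \<in> E" "x \<noteq> 0" by blast
    then obtain c where "x = sC c e" using sub by (auto simp: span_singleton)
    with x have c: "sC c e \<in> E" "c \<noteq> 0" by auto
    have sE: "subspace E" using E by (simp add: subcoalgebra_def)
    have "sC (inverse c) (sC c e) \<in> E" by (rule subspace_scale[OF sE c(1)])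
    then have "e \<in> E" using c(2) by simp
    then show ?thesis using sub sE span_minimal[of "{e}" E] by blast
  qed
  moreover have "span {e} \<noteq> {0}" using e_nonzero span_base[of e "{e}"] by auto
  ultimately have "simple_subcoalgebra sC \<Delta> (span {e})"
    using sub by (auto simp: simple_subcoalgebra_def)
  then have "span {e} \<subseteq> coradical sC \<Delta>" by (rule simple_subcoalgebra_le_coradical)
  moreover have "subspace (coradical sC \<Delta>)" unfolding coradical_def by simp
  moreover have "dim (span {e}) = 1" using e_nonzero by simp
  ultimately show ?thesis
    using subspace_dim_equal[of "span {e}" "coradical sC \<Delta>"] dim_coradical by simp
qed

lemma minimal_dim_exists:
  assumes "P V"
  obtains W where "P W" "\<And>U. P U \<Longrightarrow> U \<subseteq> W \<Longrightarrow> subspace U \<Longrightarrow> subspace W \<Longrightarrow> U = W"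
proof -
  obtain W where W: "P W" "\<And>U. P U \<Longrightarrow> dim W \<le> dim U"
    using ex_has_least_nat[of P V dim, OF assms] by blast
  show ?thesis
    by (rule that[OF W(1)]) (rule subspace_dim_equal, use W(2) in auto)
qed

lemma maximal_dim_exists:
  assumes "P V"
  obtains W where "P W" "\<And>U. P U \<Longrightarrow> W \<subseteq> U \<Longrightarrow> subspace U \<Longrightarrow> subspace W \<Longrightarrow> U = W"
proof -
  obtain W where W: "P W" "\<And>U. P U \<Longrightarrow> dim U \<le> dim W"
    using ex_has_greatest_nat[of P V dim "Suc dimension", OF assms] dim_subset_UNIV
    by (auto simp: less_Suc_eq_le)
  show ?thesis
    by (rule that[OF W(1)]) (rule subspace_dim_equal[symmetric], use W(2) in auto)
qed

text \<open>A nonzero subcoalgebra of least dimension is simple, hence contained in the coradical.\<close>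

lemma e_in_subcoalgebra:
  assumes "subcoalgebra sC \<Delta> D" "D \<noteq> {0}"
  shows "e \<in> D"
proof -
  let ?P = "\<lambda>E. subcoalgebra sC \<Delta> E \<and> E \<noteq> {0} \<and> E \<subseteq> D"
  obtain E where E: "?P E" "\<And>U. ?P U \<Longrightarrow> U \<subseteq> E \<Longrightarrow> subspace U \<Longrightarrow> subspace E \<Longrightarrow> U = E"
    using minimal_dim_exists[of ?P D] assms by blast
  have sE: "subspace E" using E(1) by (simp add: subcoalgebra_def)
  have "simple_subcoalgebra sC \<Delta> E"
    unfolding simple_subcoalgebra_def
  proof (intro conjI allI impI)
    fix U assume U: "subcoalgebra sC \<Delta> U" "U \<subseteq> E"
    then have "U = E" if "U \<noteq> {0}"
      using that E(1) sE by (intro E(2)) (auto simp: subcoalgebra_def)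
    then show "U = {0} \<or> U = E" by blast
  qed (use E(1) in auto)
  then have "E \<subseteq> coradical sC \<Delta>" by (rule simple_subcoalgebra_le_coradical)
  then have sub: "E \<subseteq> span {e}" by (simp add: coradical_eq)
  obtain x where x: "x \<in> E" "x \<noteq> 0" using E(1) sE subspace_0 by blast
  then obtain c where c: "x = sC c e" using sub by (auto simp: span_singleton)
  then have "c \<noteq> 0" using x(2) by auto
  moreover have "sC (inverse c) x \<in> E" using x(1) sE by (simp add: subspace_scale)
  ultimately have "e \<in> E" by (simp add: c)
  then show ?thesis using E(1) by blast
qed

text \<open>Let \<open>W \<subseteq> V\<close> be a minimal nonzero left coideal. Its translates under the right action span a
  subcoalgebra \<open>C\<close>, which contains \<open>e\<close>. Choose a left coideal \<open>X\<close> maximal among those without \<open>e\<close>.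
  Some translate of \<open>W\<close> is not contained in \<open>X\<close>, so by maximality \<open>e = x + z\<close> with \<open>x \<in> X\<close> and \<open>z\<close>
  the translate of some \<open>v \<in> W\<close>. Functionals with \<open>f(e) = 0\<close> annihilate \<open>e\<close>, hence they move \<open>v\<close> into the
  left coideal of those elements of \<open>W\<close> whose translate lies in \<open>X\<close>. That coideal is not \<open>W\<close>, hence
  zero by minimality, and so \<open>v\<close> is a nonzero multiple of \<open>e\<close>.\<close>

lemma e_in_left_coideal:
  assumes "left_coideal V" "V \<noteq> {0}"
  shows "e \<in> V"
proof -
  let ?P = "\<lambda>E. left_coideal E \<and> E \<noteq> {0} \<and> E \<subseteq> V"
  obtain W where W: "?P W" "\<And>U. ?P U \<Longrightarrow> U \<subseteq> W \<Longrightarrow> subspace U \<Longrightarrow> subspace W \<Longrightarrow> U = W"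
    using minimal_dim_exists[of ?P V] assms by blast
  have sW: "subspace W" using W(1) by (simp add: left_coideal_def)
  let ?C = "span (\<Union>g\<in>Collect functional. contract_right g ` W)"
  have "subcoalgebra sC \<Delta> ?C"
  proof (rule subcoalgebraI)
    fix f x assume f: "functional f" and x: "x \<in> ?C"
    interpret r: Vector_Spaces.linear sC sC "contract_right f" by (rule linear_contract_right[OF f])
    interpret l: Vector_Spaces.linear sC sC "contract_left f" by (rule linear_contract_left[OF f])
    show "contract_right f x \<in> ?C"
    proof (rule span_induct[OF x])
      show "subspace {x. contract_right f x \<in> ?C}" by (intro r.subspace_linear_preimage) simp
      fix x assume "x \<in> (\<Union>g\<in>Collect functional. contract_right g ` W)"
      then obtain g v where "functional g" "v \<in> W" "x = contract_right g v" by auto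
      then show "contract_right f x \<in> ?C"
        using f functional_convolution[OF f]
        by (auto simp: contract_right_contract_right intro!: span_base)
    qed
    show "contract_left f x \<in> ?C"
    proof (rule span_induct[OF x])
      show "subspace {x. contract_left f x \<in> ?C}" by (intro l.subspace_linear_preimage) simp
      fix x assume "x \<in> (\<Union>g\<in>Collect functional. contract_right g ` W)"
      then obtain g v where "functional g" "v \<in> W" "x = contract_right g v" by auto
      then show "contract_left f x \<in> ?C"
        using f W(1) left_coidealD(2)[of W f v]
        by (auto simp: contract_left_contract_right intro!: span_base)
    qed
  qed simp
  moreover have "W \<subseteq> ?C"
  proof
    fix w assume "w \<in> W"
    then have "contract_right \<epsilon> w \<in> ?C" using functional_counit by (intro span_base) blast
    then show "w \<in> ?C" by simp
  qed
  ultimately have eC: "e \<in> ?C"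
    using W(1) sW subspace_0 by (intro e_in_subcoalgebra) blast+
  let ?Q = "\<lambda>E. left_coideal E \<and> e \<notin> E"
  have "?Q {0}"
    using e_nonzero linear_map_zero[OF linear_contract_left] by (auto simp: left_coideal_def)
  then obtain X where X: "?Q X" "\<And>U. ?Q U \<Longrightarrow> X \<subseteq> U \<Longrightarrow> subspace U \<Longrightarrow> subspace X \<Longrightarrow> U = X"
    using maximal_dim_exists[of ?Q "{0}"] by blast
  have sX: "subspace X" using X(1) by (simp add: left_coideal_def)
  have "\<exists>g. functional g \<and> \<not> contract_right g ` W \<subseteq> X"
  proof (rule ccontr)
    assume "\<not> ?thesis"
    then have "?C \<subseteq> X" using sX by (intro span_minimal) blast+
    then show False using eC X(1) by blast
  qed
  then obtain g where g: "functional g" "\<not> contract_right g ` W \<subseteq> X" by blast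
  interpret g: Vector_Spaces.linear sC sC "contract_right g" by (rule linear_contract_right[OF g(1)])
  let ?Y = "{x + z | x z. x \<in> X \<and> z \<in> contract_right g ` W}"
  have Y: "left_coideal ?Y"
    unfolding left_coideal_def
  proof (intro conjI allI impI)
    show "subspace ?Y" by (intro subspace_sums sX g.subspace_image sW)
    fix f v assume f: "functional f" and "v \<in> ?Y"
    then obtain x w where v: "v = x + contract_right g w" "x \<in> X" "w \<in> W" by blast
    interpret l: Vector_Spaces.linear sC sC "contract_left f" by (rule linear_contract_left[OF f])
    have "contract_left f v = contract_left f x + contract_right g (contract_left f w)"
      by (simp add: v l.add contract_left_contract_right f g)
    then show "contract_left f v \<in> ?Y"
      using left_coidealD(2)[of X f x] left_coidealD(2)[of W f w] X(1) W(1) f v by blast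
  qed
  have "e \<in> ?Y"
  proof (rule ccontr)
    assume "e \<notin> ?Y"
    moreover have "X \<subseteq> ?Y" using sW subspace_0 g.zero by force
    ultimately have "?Y = X" using X(2)[of ?Y] Y sX left_coidealD(1) by blast
    moreover have "contract_right g ` W \<subseteq> ?Y" using sX subspace_0 by force
    ultimately show False using g(2) by blast
  qed
  then obtain x v where v: "e = x + contract_right g v" "x \<in> X" "v \<in> W" by blast
  let ?U = "{v \<in> W. contract_right g v \<in> X}"
  have "left_coideal ?U"
    unfolding left_coideal_def
  proof (intro conjI allI impI)
    have "?U = W \<inter> {v. contract_right g v \<in> X}" by blast
    then show "subspace ?U"
      using subspace_inter[OF sW g.subspace_linear_preimage[OF sX]] by (simp only:)
    fix f v assume "functional f" "v \<in> ?U"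
    then show "contract_left f v \<in> ?U"
      using left_coidealD(2)[of X f "contract_right g v"] left_coidealD(2)[of W f v] X(1) W(1) g(1)
      by (simp add: contract_left_contract_right)
  qed
  moreover have "?U \<noteq> W" using g(2) by blast
  ultimately have U: "?U = {0}"
    using W(2)[of ?U] W(1) sW left_coidealD(1)[of ?U] by blast
  have kill: "contract_left f v = 0" if f: "functional f" "f e = 0" for f
  proof -
    interpret l: Vector_Spaces.linear sC sC "contract_left f" by (rule linear_contract_left[OF f(1)])
    have "0 = contract_left f e" using f by (simp add: contract_e)
    also have "\<dots> = contract_left f x + contract_right g (contract_left f v)"
      by (simp add: v(1) l.add contract_left_contract_right f g)
    finally have "contract_right g (contract_left f v) = - contract_left f x"
      by (simp add: eq_neg_iff_add_eq_0 add.commute)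
    then have "contract_left f v \<in> ?U"
      using left_coidealD(2)[of X f x] left_coidealD(2)[of W f v] X(1) W(1) f(1) v sX
      by (simp add: subspace_neg)
    then show ?thesis using U by blast
  qed
  have "v = sC (\<epsilon> v) e"
  proof (rule functionals_separate)
    fix f assume f: "functional f"
    interpret f: Vector_Spaces.linear sC "(*)" f by (rule f)
    let ?h = "\<lambda>x. f x - f e * \<epsilon> x"
    have h: "functional ?h" by (intro functional_diff_scale f functional_counit)
    have "contract_left ?h v = 0" using kill[OF h] counit_e by simp
    then have "?h v = \<epsilon> 0" using counit_contract(2)[OF h, of v] by simp
    moreover have "\<epsilon> 0 = 0" by (rule linear_map_zero[OF functional_counit])
    ultimately show "f v = f (sC (\<epsilon> v) e)" by (simp add: f.scale)
  qed
  moreover have "v \<noteq> 0" using v X(1) by auto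
  ultimately have "\<epsilon> v \<noteq> 0" by auto
  moreover have "sC (inverse (\<epsilon> v)) v \<in> W" using v(3) sW by (simp add: subspace_scale)
  moreover have "sC (inverse (\<epsilon> v)) v = e" using \<open>v = sC (\<epsilon> v) e\<close> \<open>\<epsilon> v \<noteq> 0\<close>
    by (simp add: scale_left_imp_eq[of "\<epsilon> v"])
  ultimately show ?thesis using W(1) by auto
qed

end

section \<open>Thin coalgebras\<close>

text \<open>The functional \<open>t\<close> generates the maximal ideal of the dual algebra; \<open>shift\<close> is its action.\<close>

locale thin_coalgebra = connected_coalgebra sC \<Delta> \<epsilon> e n
  for sC :: "'k::field \<Rightarrow> 'c::ab_group_add \<Rightarrow> 'c"
    and \<Delta> :: "'c \<Rightarrow> ('c \<times> 'c) list"
    and \<epsilon> :: "'c \<Rightarrow> 'k" and e :: 'c and n :: nat +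
  fixes y :: 'c and t :: "'c \<Rightarrow> 'k"
  assumes primitives_eq: "primitives sC \<Delta> e = span {y}"
    and t_linear: "Vector_Spaces.linear sC (*) t"
    and t_e: "t e = 0" and t_y: "t y = 1"
begin

abbreviation shift :: "'c \<Rightarrow> 'c" where
  "shift \<equiv> contract_right t"

sublocale shift: Vector_Spaces.linear sC sC shift
  by (rule linear_contract_right[OF t_linear])

lemma shift_e [simp]: "shift e = 0"
  using contract_e(1)[OF t_linear] t_e by simp

lemma shift_primitive: "x \<in> primitives sC \<Delta> e \<Longrightarrow> shift x = sC (t x) e"
  using tensor_eq_sum_eq[OF bilinear_functional_scale(1)[OF t_linear], of "\<Delta> x" "[(x, e), (e, x)]"] t_e
  by (simp add: contract_right_def primitives_def)

lemma shift_y: "shift y = e"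
  using shift_primitive[of y] primitives_eq t_y span_base[of y "{y}"] by simp

lemma left_coideal_UNIV: "left_coideal UNIV"
  by (simp add: left_coideal_def)

lemma left_coideal_shift:
  assumes "left_coideal V"
  shows "left_coideal (shift ` V)"
  unfolding left_coideal_def
proof (intro conjI allI impI)
  show "subspace (shift ` V)" by (intro shift.subspace_image left_coidealD(1)[OF assms])
  fix f v assume f: "functional f" and "v \<in> shift ` V"
  then obtain w where w: "w \<in> V" "v = shift w" by blast
  then have "contract_left f v = shift (contract_left f w)"
    using contract_left_contract_right[OF f t_linear] by simp
  then show "contract_left f v \<in> shift ` V" using left_coidealD(2)[OF assms f w(1)] by blast
qed

text \<open>The image loses a dimension because \<open>V\<close> contains \<open>e\<close>, and \<open>shift e = 0\<close>.\<close>

lemma dim_shift_less: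
  assumes "left_coideal V" "V \<noteq> {0}"
  shows "dim (shift ` V) < dim V"
proof -
  have e: "e \<in> V" by (rule e_in_left_coideal[OF assms])
  have "independent {e}" using e_nonzero by simp
  then obtain B where B: "{e} \<subseteq> B" "B \<subseteq> V" "independent B" "V \<subseteq> span B"
    using maximal_independent_subset_extend[of "{e}" V] e by blast
  have fin: "finite B" using B(3) by (rule finiteI_independent)
  have "shift ` V \<subseteq> span (shift ` B)" using shift.span_image[of B] B(4) by blast
  also have "shift ` B \<subseteq> insert 0 (shift ` (B - {e}))" by auto
  then have "span (shift ` B) \<subseteq> span (shift ` (B - {e}))"
    using span_mono span_insert_0 by metis
  finally have "dim (shift ` V) \<le> card (shift ` (B - {e}))"
    using fin by (intro dim_le_card) auto
  also have "\<dots> \<le> card (B - {e})" using fin by (intro card_image_le) simp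
  also have "\<dots> < card B" using B(1) fin by (intro psubset_card_mono) auto
  also have "\<dots> = dim V" using basis_card_eq_dim[OF B(2,4,3)] by simp
  finally show ?thesis .
qed

lemma shift_nilpotent: "(shift ^^ n) x = 0"
proof -
  obtain B where B: "finite B" "card B = n" "independent B" "span B = UNIV"
    using dimension_n by (auto simp: has_dimension_def)
  have dimU: "dim UNIV = n" using B dim_unique[of B UNIV n] by simp
  have "left_coideal (range (shift ^^ k)) \<and> (dim (range (shift ^^ k)) \<le> n - k)" for k
  proof (induction k)
    case 0
    show ?case using left_coideal_UNIV dimU by simp
  next
    case (Suc k)
    have img: "range (shift ^^ Suc k) = shift ` range (shift ^^ k)"
      by (simp add: image_comp)
    show ?case
    proof (cases "range (shift ^^ k) = {0}")
      case True
      then have "range (shift ^^ Suc k) = {0}" unfolding img by (simp add: shift.zero)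
      then show ?thesis using Suc True by simp
    next
      case False
      then show ?thesis
        using Suc dim_shift_less[of "range (shift ^^ k)"] left_coideal_shift unfolding img
        by force
    qed
  qed
  from this[of n] have "range (shift ^^ n) \<subseteq> {0}" by simp
  then show ?thesis by blast
qed

text \<open>Suppose that the kernel is larger than \<open>span {e}\<close>, and choose a left coideal \<open>W\<close> of least dimension
  in it that contains \<open>e\<close> properly. For a functional with \<open>f(e) = 0\<close> the image of \<open>W\<close> under the right
  action of \<open>f\<close> is zero or contains \<open>e\<close>; either way the preimage of \<open>span {e}\<close> in \<open>W\<close> is all of \<open>W\<close>
  by minimality. This says that \<open>w - \<epsilon>(w) e\<close> is primitive for \<open>w \<in> W\<close>, hence a multiple of \<open>y\<close>; but
  \<open>shift y = e \<noteq> 0\<close>.\<close>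

lemma shift_eq_0_iff: "shift x = 0 \<longleftrightarrow> x = sC (\<epsilon> x) e"
proof
  assume "x = sC (\<epsilon> x) e"
  then have "shift x = sC (\<epsilon> x) (shift e)" using shift.scale by metis
  then show "shift x = 0" by simp
next
  assume x: "shift x = 0"
  let ?P = "\<lambda>E. left_coideal E \<and> e \<in> E \<and> E \<subseteq> {x. shift x = 0} \<and> \<not> E \<subseteq> span {e}"
  show "x = sC (\<epsilon> x) e"
  proof (rule ccontr)
    assume nx: "x \<noteq> sC (\<epsilon> x) e"
    have ker: "left_coideal {x. shift x = 0}"
      using contract_left_contract_right[OF _ t_linear, symmetric] linear_map_zero[OF linear_contract_left]
      by (auto simp: left_coideal_def shift.subspace_kernel)
    have "x \<notin> span {e}"
    proof
      assume "x \<in> span {e}"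
      then obtain c where "x = sC c e" by (auto simp: span_singleton)
      then show False using nx functional_counit counit_e by (simp add: Vector_Spaces.linear_iff)
    qed
    then have "?P {x. shift x = 0}" using ker x by auto
    then obtain W where W: "?P W" "\<And>U. ?P U \<Longrightarrow> U \<subseteq> W \<Longrightarrow> subspace U \<Longrightarrow> subspace W \<Longrightarrow> U = W"
      using minimal_dim_exists[of ?P] by (smt (verit, best))
    have sW: "subspace W" using W(1) left_coidealD(1) by blast
    have inner: "contract_right f w = sC (f w) e" if f: "functional f" "f e = 0" and w: "w \<in> W" for f w
    proof -
      interpret r: Vector_Spaces.linear sC sC "contract_right f" by (rule linear_contract_right[OF f(1)])
      have preimage: "left_coideal {w \<in> W. contract_right f w \<in> X}" if X: "left_coideal X" for X
        unfolding left_coideal_def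
      proof (intro conjI allI impI)
        have "{w \<in> W. contract_right f w \<in> X} = W \<inter> {w. contract_right f w \<in> X}" by blast
        then show "subspace {w \<in> W. contract_right f w \<in> X}"
          using subspace_inter[OF sW r.subspace_linear_preimage[OF left_coidealD(1)[OF X]]] by (simp only:)
        fix h v assume "functional h" "v \<in> {w \<in> W. contract_right f w \<in> X}"
        then show "contract_left h v \<in> {w \<in> W. contract_right f w \<in> X}"
          using left_coidealD(2)[OF X, of h "contract_right f v"] left_coidealD(2)[of W h v] W(1) f(1)
          by (simp add: contract_left_contract_right)
      qed
      have "{w \<in> W. contract_right f w \<in> span {e}} = W"
      proof (cases "contract_right f ` W \<subseteq> {0}")
        case True
        then show ?thesis using span_zero by (auto simp: image_subset_iff)
      next
        case False
        have rW: "left_coideal (contract_right f ` W)"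
          unfolding left_coideal_def
        proof (intro conjI allI impI)
          show "subspace (contract_right f ` W)" by (intro r.subspace_image sW)
          fix h v assume h: "functional h" and "v \<in> contract_right f ` W"
          then obtain u where u: "u \<in> W" "v = contract_right f u" by blast
          then have "contract_left h v = contract_right f (contract_left h u)"
            using contract_left_contract_right[OF h f(1)] by simp
          then show "contract_left h v \<in> contract_right f ` W"
            using left_coidealD(2)[of W h u] W(1) h u(1) by blast
        qed
        then have "e \<in> contract_right f ` W" using e_in_left_coideal False by blast
        then obtain u where u: "u \<in> W" "contract_right f u = e" by force
        have span_e: "left_coideal (span {e})"
          unfolding left_coideal_def
        proof (intro conjI allI impI)
          fix h v assume h: "functional h" and "v \<in> span {e}"
          then obtain c where "v = sC c e" by (auto simp: span_singleton)
          then have "contract_left h v = sC (c * h e) e"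
            using linear_contract_left[OF h] contract_e(2)[OF h] by (simp add: Vector_Spaces.linear_iff)
          then show "contract_left h v \<in> span {e}" by (simp add: span_scale span_base)
        qed simp
        let ?U = "{w \<in> W. contract_right f w \<in> span {e}}"
        have ue: "u \<notin> span {e}"
        proof
          assume "u \<in> span {e}"
          then obtain c where "u = sC c e" by (auto simp: span_singleton)
          then have "contract_right f u = 0" using contract_e(1)[OF f(1)] f(2) by (simp add: r.scale)
          then show False using u(2) e_nonzero by simp
        qed
        have "u \<in> ?U" using u by (simp add: span_base)
        moreover have "e \<in> ?U" using W(1) contract_e(1)[OF f(1)] f(2) span_zero by simp
        moreover have "left_coideal ?U" by (rule preimage[OF span_e])
        ultimately show ?thesis
          using W sW ue left_coidealD(1) by (intro W(2)) blast+
      qed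
      then have "contract_right f w \<in> span {e}" using w by blast
      then obtain c where c: "contract_right f w = sC c e" by (auto simp: span_singleton)
      then have "c = f w"
        using counit_contract(1)[OF f(1), of w] functional_counit counit_e by (simp add: Vector_Spaces.linear_iff)
      then show ?thesis using c by simp
    qed
    obtain w where w: "w \<in> W" "w \<notin> span {e}" using W(1) by blast
    let ?w = "w - sC (\<epsilon> w) e"
    have w': "?w \<in> W" using w W(1) sW by (intro subspace_diff subspace_scale) auto
    have "tensor_eq sC sC (\<Delta> ?w) [(?w, e), (e, ?w)]"
    proof (rule tensor_eq_contract_rightI)
      fix f assume f: "functional f"
      let ?f = "\<lambda>x. f x - f e * \<epsilon> x"
      have f': "functional ?f" by (intro functional_diff_scale f functional_counit)
      have lin: "contract_right ?f x = contract_right f x - sC (f e) x" for x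
      proof (rule functionals_separate)
        fix h assume h: "functional h"
        interpret h: Vector_Spaces.linear sC "(*)" h by (rule h)
        have "h (contract_right ?f x) = ?f (contract_left h x)"
          using apply_contract_right[OF h] apply_contract_left[OF f'] by simp
        also have "\<dots> = h (contract_right f x) - f e * h x"
          using apply_contract_right[OF h] apply_contract_left[OF f] h by simp
        also have "\<dots> = h (contract_right f x - sC (f e) x)" by (simp add: h.diff h.scale)
        finally show "h (contract_right ?f x) = h (contract_right f x - sC (f e) x)" .
      qed
      have "\<epsilon> ?w = 0"
        using functional_counit counit_e module_hom.diff[of sC "(*)" \<epsilon> w "sC (\<epsilon> w) e"]
        by (simp add: linear_iff_module_hom[symmetric] Vector_Spaces.linear_iff)
      then have "contract_right f ?w = sC (f ?w) e + sC (f e) ?w"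
        using inner[OF f' _ w'] lin[of ?w] counit_e by (simp add: algebra_simps)
      then show "(\<Sum>(a, b)\<leftarrow>\<Delta> ?w. sC (f b) a) = (\<Sum>(a, b)\<leftarrow>[(?w, e), (e, ?w)]. sC (f b) a)"
        by (simp add: contract_right_def add.commute)
    qed
    then have prim: "?w \<in> primitives sC \<Delta> e" by (simp add: primitives_def)
    then obtain c where c: "?w = sC c y" using primitives_eq by (auto simp: span_singleton)
    have "shift ?w = 0" using w' W(1) by blast
    then have "c = 0" unfolding c using shift_y e_nonzero by (simp add: shift.scale)
    then have "w = sC (\<epsilon> w) e" using c by simp
    then show False using w(2) by (metis insertI1 span_base span_scale)
  qed
qed

subsection \<open>The coradical filtration\<close>

text \<open>As \<open>shift\<close> is nilpotent with kernel \<open>span {e}\<close>, these are the terms of the coradical filtration,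
  numbered so that \<open>layer k\<close> has dimension \<open>k\<close> for \<open>k \<le> height\<close>.\<close>

definition layer :: "nat \<Rightarrow> 'c set" where
  "layer k = {x. (shift ^^ k) x = 0}"

lemma linear_shift_power: "Vector_Spaces.linear sC sC (shift ^^ k)"
proof (induction k)
  case 0
  then show ?case using linear_ident by (simp add: id_def)
next
  case (Suc k)
  then show ?case using linear_app[OF shift.linear_axioms Suc] by (simp add: comp_def)
qed

lemma shift_power_Suc: "(shift ^^ Suc k) x = (shift ^^ k) (shift x)"
  by (simp add: funpow_swap1)

lemma layer_0 [simp]: "layer 0 = {0}"
  by (simp add: layer_def)

lemma layer_Suc: "x \<in> layer (Suc k) \<longleftrightarrow> shift x \<in> layer k"
  by (simp add: layer_def shift_power_Suc del: funpow.simps)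

lemma shift_layer: "x \<in> layer k \<Longrightarrow> shift x \<in> layer (k - 1)"
  by (cases k) (auto simp: layer_Suc shift.zero)

lemma subspace_layer: "subspace (layer k)"
  unfolding layer_def
  using module_hom.subspace_kernel[OF linear_iff_module_hom[THEN iffD1, OF linear_shift_power]] .

lemma layer_mono: "j \<le> k \<Longrightarrow> x \<in> layer j \<Longrightarrow> x \<in> layer k"
proof (induction k arbitrary: j x)
  case (Suc k)
  show ?case
  proof (cases j)
    case 0
    then show ?thesis using Suc.prems subspace_0[OF subspace_layer] by simp
  next
    case (Suc i)
    then show ?thesis using Suc.IH[of i "shift x"] Suc.prems by (simp add: layer_Suc)
  qed
qed simp

lemma layer_1: "x \<in> layer 1 \<longleftrightarrow> x = sC (\<epsilon> x) e"
  using shift_eq_0_iff by (simp add: layer_def)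

text \<open>\<open>f - f(e) \<epsilon>\<close> vanishes on the kernel of \<open>shift\<close>, so it factors through \<open>shift\<close>. Iterating this would
  express the right action of \<open>f\<close> as a polynomial in \<open>shift\<close>.\<close>

lemma functional_decompose:
  assumes f: "functional f"
  obtains f' where "functional f'"
    "\<And>x. contract_right f x = sC (f e) x + contract_right f' (shift x)"
proof -
  let ?g = "\<lambda>x. f x - f e * \<epsilon> x"
  have g: "functional ?g" by (intro functional_diff_scale f functional_counit)
  have "?g x = 0" if "shift x = 0" for x
  proof -
    have "f x = f (sC (\<epsilon> x) e)" using that shift_eq_0_iff by metis
    then show ?thesis using f by (simp add: Vector_Spaces.linear_iff)
  qed
  then obtain f' where f': "functional f'" "\<And>x. ?g x = f' (shift x)"
    using linear_kernel_factor[OF shift.linear_axioms g] by blast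
  have "contract_right f x = sC (f e) x + contract_right f' (shift x)" for x
  proof (rule functionals_separate)
    fix h assume h: "functional h"
    interpret h: Vector_Spaces.linear sC "(*)" h by (rule h)
    have "h (contract_right f' (shift x)) = f' (contract_left h (shift x))"
      using apply_contract_right[OF h] apply_contract_left[OF f'(1)] by simp
    also have "\<dots> = ?g (contract_left h x)"
      using f'(2) contract_left_contract_right[OF h t_linear] by simp
    also have "\<dots> = h (contract_right f x) - f e * h x"
      using apply_contract_right[OF h] apply_contract_left[OF f] h by simp
    finally show "h (contract_right f x) = h (sC (f e) x + contract_right f' (shift x))"
      by (simp add: h.add h.scale)
  qed
  with f'(1) show ?thesis by (rule that)
qed

lemma contract_right_layer:
  assumes "functional f" "x \<in> layer k"
  shows "contract_right f x \<in> layer k"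
  using assms
proof (induction k arbitrary: f x)
  case 0
  then show ?case using linear_map_zero[OF linear_contract_right] by simp
next
  case (Suc k)
  obtain f' where f': "functional f'"
    "\<And>x. contract_right f x = sC (f e) x + contract_right f' (shift x)"
    using functional_decompose[OF Suc.prems(1)] by blast
  have "contract_right f' (shift x) \<in> layer k" using Suc f'(1) by (simp add: layer_Suc)
  then show ?case unfolding f'(2)
    using Suc.prems layer_mono[of k "Suc k"] by (intro subspace_add subspace_scale subspace_layer) auto
qed


lemma contract_left_shift_power:
  "functional f \<Longrightarrow> contract_left f ((shift ^^ k) x) = (shift ^^ k) (contract_left f x)"
  by (induction k) (simp_all add: contract_left_contract_right t_linear)

lemma contract_right_comp_shift_power:
  assumes f: "functional f"
  shows "contract_right (\<lambda>x. f ((shift ^^ k) x)) x = contract_right f ((shift ^^ k) x)"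
proof (rule functionals_separate)
  fix h assume h: "functional h"
  have fk: "functional (\<lambda>x. f ((shift ^^ k) x))" by (rule linear_app[OF f linear_shift_power])
  show "h (contract_right (\<lambda>x. f ((shift ^^ k) x)) x) = h (contract_right f ((shift ^^ k) x))"
    using apply_contract_right[OF h] apply_contract_left[OF fk] apply_contract_left[OF f]
      contract_left_shift_power[OF h] by metis
qed

lemma shift_power_layer: "x \<in> layer k \<Longrightarrow> (shift ^^ j) x \<in> layer (k - j)"
  by (induction j) (auto simp: Suc_diff_Suc dest: shift_layer simp flip: diff_Suc_eq_diff_pred)

text \<open>A functional vanishing on \<open>layer j\<close> factors through the \<open>j\<close>-th power of the shift.\<close>

lemma contract_right_lowers:
  assumes f: "functional f" and "\<And>x. x \<in> layer j \<Longrightarrow> f x = 0" and x: "x \<in> layer k"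
  shows "contract_right f x \<in> layer (k - j)"
proof -
  obtain f' where f': "functional f'" "\<And>x. f x = f' ((shift ^^ j) x)"
    using linear_kernel_factor[OF linear_shift_power f, of j] assms(2) by (auto simp: layer_def)
  then have "contract_right f x = contract_right f' ((shift ^^ j) x)"
    using contract_right_comp_shift_power[OF f'(1), of j x] by (simp add: f'(2)[abs_def])
  then show ?thesis using contract_right_layer[OF f'(1)] shift_power_layer[OF x] by simp
qed

definition height :: nat where
  "height = (LEAST k. layer k = UNIV)"

lemma layer_height: "x \<in> layer height"
proof -
  have "layer n = UNIV" using shift_nilpotent by (auto simp: layer_def)
  then have "layer height = UNIV" unfolding height_def by (rule LeastI)
  then show ?thesis by simp
qed

lemma height_pos: "height > 0"
  using layer_height[of e] e_nonzero by (cases height) auto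

lemma e_in_range_shift_power:
  assumes "Suc k = height"
  obtains z where "(shift ^^ k) z = e"
proof -
  have "layer k \<noteq> UNIV" using not_less_Least[of k "\<lambda>k. layer k = UNIV"] assms by (simp add: height_def)
  then obtain x where x: "(shift ^^ k) x \<noteq> 0" by (auto simp: layer_def)
  let ?c = "\<epsilon> ((shift ^^ k) x)"
  have "shift ((shift ^^ k) x) = 0" using layer_height[of x] by (simp add: layer_def flip: assms)
  then have c: "(shift ^^ k) x = sC ?c e" using shift_eq_0_iff by blast
  then have "?c \<noteq> 0" using x by auto
  interpret k: Vector_Spaces.linear sC sC "shift ^^ k" by (rule linear_shift_power)
  have "(shift ^^ k) (sC (inverse ?c) x) = sC (inverse ?c) (sC ?c e)"
    using c by (simp only: k.scale)
  then have "(shift ^^ k) (sC (inverse ?c) x) = e" using \<open>?c \<noteq> 0\<close> by simp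
  then show ?thesis by (rule that)
qed

text \<open>A Jordan chain of full length has a vector that \<open>shift\<^sup>k\<close> sends to \<open>e\<close>, and for \<open>k + 1 < height\<close> this
  vector lies in the range. Subtracting a multiple of it moves an element of \<open>layer (k + 1)\<close> into \<open>layer k\<close>.\<close>

lemma layer_le_range_shift: "x \<in> layer k \<Longrightarrow> k < height \<Longrightarrow> x \<in> range shift"
proof (induction k arbitrary: x)
  case 0
  then show ?case using shift.zero by (auto simp: image_iff) (metis shift.zero)
next
  case (Suc k)
  obtain m where m: "height = Suc (Suc m + k)" using Suc.prems(2) less_iff_Suc_add by auto
  then obtain z where z: "(shift ^^ (Suc m + k)) z = e" using e_in_range_shift_power by metis
  let ?z = "shift ((shift ^^ m) z)"
  have "(shift ^^ (k + Suc m)) z = (shift ^^ k) ((shift ^^ Suc m) z)" by (simp only: funpow_add comp_apply)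
  then have zk: "(shift ^^ k) ?z = e" using z by (simp add: add.commute)
  let ?c = "\<epsilon> ((shift ^^ k) x)"
  interpret k: Vector_Spaces.linear sC sC "shift ^^ k" by (rule linear_shift_power)
  have "shift ((shift ^^ k) x) = 0" using Suc.prems(1) by (simp add: layer_def)
  then have c: "(shift ^^ k) x = sC ?c e" using shift_eq_0_iff by blast
  have "x - sC ?c ?z \<in> layer k" using c zk by (simp add: layer_def k.diff k.scale)
  then obtain w where "x - sC ?c ?z = shift w" using Suc.IH Suc.prems(2) by (auto simp: image_iff)
  then have "x = shift (w + sC ?c ((shift ^^ m) z))" by (simp add: shift.add shift.scale algebra_simps)
  then show ?case by blast
qed

text \<open>The chain is a Jordan basis for \<open>shift\<close>. The normalization \<open>\<epsilon> z = 0\<close> makes \<open>\<epsilon>(shift\<^sup>j x)\<close> the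
  \<open>j\<close>-th coordinate of \<open>x\<close>.\<close>

fun chain :: "nat \<Rightarrow> 'c" where
  "chain 0 = e"
| "chain (Suc k) = (SOME z. shift z = chain k \<and> \<epsilon> z = 0)"

lemma chain:
  "k < height \<Longrightarrow> chain k \<in> layer (Suc k)"
  "Suc k < height \<Longrightarrow> shift (chain (Suc k)) = chain k \<and> \<epsilon> (chain (Suc k)) = 0"
proof -
  have *: "shift (chain (Suc k)) = chain k \<and> \<epsilon> (chain (Suc k)) = 0"
    if k: "chain k \<in> layer (Suc k)" "Suc k < height" for k
  proof -
    obtain z where z: "chain k = shift z" using layer_le_range_shift[OF k] by blast
    let ?z = "z - sC (\<epsilon> z) e"
    have "shift ?z = chain k" using z by (simp add: shift.diff shift.scale)
    moreover have "\<epsilon> ?z = 0"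
      using functional_counit counit_e module_hom.diff[of sC "(*)" \<epsilon> z "sC (\<epsilon> z) e"]
      by (simp add: linear_iff_module_hom[symmetric] Vector_Spaces.linear_iff)
    ultimately have "\<exists>z. shift z = chain k \<and> \<epsilon> z = 0" by blast
    then show ?thesis unfolding chain.simps by (rule someI_ex)
  qed
  show 1: "chain k \<in> layer (Suc k)" if "k < height" for k
    using that
  proof (induction k)
    case 0
    then show ?case using layer_1 counit_e by simp
  next
    case (Suc k)
    then show ?case using *[of k] by (simp add: layer_Suc[of _ "Suc k"] del: chain.simps)
  qed
  show "Suc k < height \<Longrightarrow> shift (chain (Suc k)) = chain k \<and> \<epsilon> (chain (Suc k)) = 0"
    using * 1 by simp
qed

definition coord :: "nat \<Rightarrow> 'c \<Rightarrow> 'k" where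
  "coord j x = \<epsilon> ((shift ^^ j) x)"

lemma functional_coord: "functional (coord j)"
  unfolding coord_def [abs_def] by (rule linear_app[OF functional_counit linear_shift_power])

lemma coord_layer: "x \<in> layer j \<Longrightarrow> coord j x = 0"
  using linear_map_zero[OF functional_counit] by (simp add: coord_def layer_def)

lemma coord_chain: "k < height \<Longrightarrow> coord j (chain k) = (if j = k then 1 else 0)"
proof (induction j arbitrary: k)
  case 0
  then show ?case using chain(2) counit_e by (cases k) (auto simp: coord_def simp del: chain.simps(2))
next
  case (Suc j)
  show ?case
  proof (cases k)
    case 0
    then show ?thesis using chain(1)[of 0] Suc.prems layer_mono[of 1 "Suc j" e]
      by (simp add: coord_layer)
  next
    case (Suc i)
    then have "coord (Suc j) (chain k) = coord j (chain i)"
      using chain(2)[of i] Suc.prems by (simp add: coord_def shift_power_Suc del: funpow.simps chain.simps)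
    then show ?thesis using Suc.IH[of i] Suc.prems Suc by simp
  qed
qed

lemma coord_expansion_layer:
  "x \<in> layer k \<Longrightarrow> k \<le> height \<Longrightarrow> x = (\<Sum>j<k. sC (coord j x) (chain j))"
proof (induction k arbitrary: x)
  case (Suc k)
  interpret k: Vector_Spaces.linear sC sC "shift ^^ k" by (rule linear_shift_power)
  have "shift ((shift ^^ k) x) = 0" using Suc.prems(1) by (simp add: layer_def)
  then have "(shift ^^ k) x = sC (coord k x) e" using shift_eq_0_iff by (simp add: coord_def)
  moreover have "(shift ^^ k) (chain k) = e"
  proof -
    have "shift ((shift ^^ k) (chain k)) = 0" using chain(1)[of k] Suc.prems(2) by (simp add: layer_def)
    then have "(shift ^^ k) (chain k) = sC (coord k (chain k)) e" using shift_eq_0_iff by (simp add: coord_def)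
    then show ?thesis using coord_chain[of k k] Suc.prems(2) by simp
  qed
  ultimately have mem: "x - sC (coord k x) (chain k) \<in> layer k"
    by (simp add: layer_def k.diff k.scale)
  have "coord j (x - sC (coord k x) (chain k)) = coord j x" if "j < k" for j
  proof -
    interpret c: Vector_Spaces.linear sC "(*)" "coord j" by (rule functional_coord)
    show ?thesis using coord_chain[of k j] Suc.prems(2) that by (simp add: c.diff c.scale)
  qed
  then have "x - sC (coord k x) (chain k) = (\<Sum>j<k. sC (coord j x) (chain j))"
    using Suc.IH[OF mem] Suc.prems(2) by simp
  then show ?case by (simp add: algebra_simps)
qed simp

lemma coord_expansion: "x = (\<Sum>j<height. sC (coord j x) (chain j))"
  by (rule coord_expansion_layer[OF layer_height]) simp

definition trace :: "('c \<Rightarrow> 'c) \<Rightarrow> 'k" where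
  "trace A = (\<Sum>j<height. coord j (A (chain j)))"

lemma trace_comp_commute:
  assumes "Vector_Spaces.linear sC sC A" "Vector_Spaces.linear sC sC B"
  shows "trace (\<lambda>x. A (B x)) = trace (\<lambda>x. B (A x))"
proof -
  have *: "trace (\<lambda>x. A (B x)) = (\<Sum>j<height. \<Sum>i<height. coord i (B (chain j)) * coord j (A (chain i)))"
    if "Vector_Spaces.linear sC sC A" for A B
  proof -
    have "coord j (A (B (chain j))) = (\<Sum>i<height. coord i (B (chain j)) * coord j (A (chain i)))" for j
    proof -
      interpret f: Vector_Spaces.linear sC "(*)" "\<lambda>x. coord j (A x)"
        by (rule linear_app[OF functional_coord that])
      have "coord j (A (B (chain j))) = coord j (A (\<Sum>i<height. sC (coord i (B (chain j))) (chain i)))"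
        by (rule arg_cong[OF coord_expansion, of "\<lambda>x. coord j (A x)"])
      also have "\<dots> = (\<Sum>i<height. coord i (B (chain j)) * coord j (A (chain i)))"
        by (simp add: f.sum f.scale)
      finally show ?thesis .
    qed
    then show ?thesis by (simp add: trace_def)
  qed
  show ?thesis
    unfolding *[OF assms(1)] *[OF assms(2)] by (subst sum.swap) (simp add: mult.commute)
qed

text \<open>Take traces: a map that strictly lowers the layers has zero diagonal with respect to the chain,
  and the trace of the identity is \<open>height\<close>.\<close>

lemma no_canonical_commutation:
  assumes A: "Vector_Spaces.linear sC sC A" and B: "Vector_Spaces.linear sC sC B"
    and E: "\<And>k x. x \<in> layer (Suc k) \<Longrightarrow> E x \<in> layer k"
    and comm: "\<And>x. A (B x) = B (A x) + x + E x"
  shows "(of_nat height :: 'k) = 0"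
proof -
  have add: "trace (\<lambda>x. C x + D x) = trace C + trace D" for C D
  proof -
    have "coord j (x + z) = coord j x + coord j z" for j x z
      using functional_coord[of j] by (simp add: Vector_Spaces.linear_iff)
    then show ?thesis by (simp add: trace_def sum.distrib)
  qed
  have "trace E = 0"
    unfolding trace_def using chain(1) E coord_layer by (intro sum.neutral) auto
  moreover have "trace (\<lambda>x. x) = of_nat height"
    by (simp add: trace_def coord_chain)
  moreover have "trace (\<lambda>x. A (B x)) = trace (\<lambda>x. B (A x)) + trace (\<lambda>x. x) + trace E"
    by (simp add: comm add)
  ultimately show ?thesis using trace_comp_commute[OF A B] by simp
qed

end

section \<open>Gaussian binomial coefficients\<close>

fun qbinomial :: "'k::field \<Rightarrow> nat \<Rightarrow> nat \<Rightarrow> 'k" where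
  "qbinomial q n 0 = 1"
| "qbinomial q 0 (Suc i) = 0"
| "qbinomial q (Suc n) (Suc i) = qbinomial q n i + q ^ Suc i * qbinomial q n (Suc i)"

lemma qbinomial_eq_0: "n < i \<Longrightarrow> qbinomial q n i = 0"
proof (induction n arbitrary: i)
  case 0
  then show ?case by (cases i) auto
next
  case (Suc n)
  then show ?case by (cases i) auto
qed

lemma qbinomial_self [simp]: "qbinomial q n n = 1"
  by (induction n) (simp_all add: qbinomial_eq_0)

text \<open>With the denominators cleared, the formula for the quotient of neighbouring coefficients holds at
  roots of unity, where it forces coefficients to vanish.\<close>

lemma qbinomial_step:
  "i \<le> n \<Longrightarrow> (1 - q ^ Suc i) * qbinomial q n (Suc i) = (1 - q ^ (n - i)) * qbinomial q n i"
proof (induction n arbitrary: i)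
  case (Suc n)
  show ?case
  proof (cases "i = Suc n")
    case True
    then show ?thesis by (simp add: qbinomial_eq_0)
  next
    case False
    then have i: "i \<le> n" using Suc.prems by simp
    have "(1 - q ^ Suc i) * qbinomial q (Suc n) (Suc i) =
        (1 - q ^ Suc i) * qbinomial q n i + q ^ Suc i * ((1 - q ^ Suc i) * qbinomial q n (Suc i))"
      by (simp add: algebra_simps)
    also have "\<dots> = qbinomial q n i * ((1 - q ^ Suc i) + q ^ Suc i * (1 - q ^ (n - i)))"
      unfolding Suc.IH[OF i] by (simp add: algebra_simps)
    also have "(1 - q ^ Suc i) + q ^ Suc i * (1 - q ^ (n - i)) = 1 - q ^ (Suc i + (n - i))"
      unfolding power_add by (simp add: algebra_simps)
    also have "Suc i + (n - i) = Suc n" using i by simp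
    finally have left: "(1 - q ^ Suc i) * qbinomial q (Suc n) (Suc i) = qbinomial q n i * (1 - q ^ Suc n)" .
    have "(1 - q ^ (Suc n - i)) * qbinomial q (Suc n) i = qbinomial q n i * (1 - q ^ Suc n)"
    proof (cases i)
      case 0
      then show ?thesis by simp
    next
      case (Suc l)
      then have l: "l \<le> n" using i by simp
      have "(1 - q ^ (n - l)) * qbinomial q (Suc n) (Suc l) =
          (1 - q ^ (n - l)) * qbinomial q n l + q ^ Suc l * (1 - q ^ (n - l)) * qbinomial q n (Suc l)"
        by (simp add: algebra_simps)
      also have "\<dots> = qbinomial q n (Suc l) * ((1 - q ^ Suc l) + q ^ Suc l * (1 - q ^ (n - l)))"
        unfolding Suc.IH[OF l, symmetric] by (simp add: algebra_simps)
      also have "(1 - q ^ Suc l) + q ^ Suc l * (1 - q ^ (n - l)) = 1 - q ^ (Suc l + (n - l))"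
        unfolding power_add by (simp add: algebra_simps)
      also have "Suc l + (n - l) = Suc n" using l by simp
      finally show ?thesis using Suc by simp
    qed
    with left show ?thesis by simp
  qed
qed simp

lemma qbinomial_root_of_unity:
  assumes q: "primitive_root_of_unity n q" and "0 < i" "i < n"
  shows "qbinomial q n i = 0"
proof -
  have "qbinomial q n (Suc i) = 0" if "Suc i < n" for i
    using that
  proof (induction i)
    case 0
    have "(1 - q) * qbinomial q n (Suc 0) = (1 - q ^ n) * 1" using qbinomial_step[of 0 n q] by simp
    moreover have "q ^ Suc 0 \<noteq> 1" "q ^ n = 1"
      using q 0 unfolding primitive_root_of_unity_def by blast+
    ultimately show ?case by simp
  next
    case (Suc i)
    have "(1 - q ^ Suc (Suc i)) * qbinomial q n (Suc (Suc i)) = 0"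
      using qbinomial_step[of "Suc i" n q] Suc by simp
    moreover have "q ^ Suc (Suc i) \<noteq> 1"
      using q Suc.prems unfolding primitive_root_of_unity_def by blast
    ultimately show ?case by simp
  qed
  then show ?thesis using assms(2,3) by (cases i) auto
qed

text \<open>This coefficient is the \<open>q\<close>-number \<open>1 + q + \<dots> + q\<^sup>n\<^sup>-\<^sup>1\<close>.\<close>

lemma qbinomial_pred_neq_0:
  assumes q: "primitive_root_of_unity \<theta> q" and "0 < n" "n < \<theta>"
  shows "qbinomial q n (n - 1) \<noteq> 0"
proof
  assume 0: "qbinomial q n (n - 1) = 0"
  obtain k where k: "n = Suc k" using assms(2) by (cases n) auto
  have "(1 - q ^ n) * 1 = (1 - q) * qbinomial q n k"
    using qbinomial_step[of k n q] k by simp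
  then have "q ^ n = 1" using 0 k by simp
  then show False using q assms(2,3) by (simp add: primitive_root_of_unity_def)
qed

lemma primitive_root_power_eq_1:
  assumes "primitive_root_of_unity n q" "n < i" "i < 2 * n"
  shows "q ^ i \<noteq> 1"
proof -
  have "q ^ i = q ^ (n + (i - n))" using assms(2) by simp
  also have "\<dots> = q ^ (i - n)" using assms(1) unfolding power_add by (simp add: primitive_root_of_unity_def)
  finally show ?thesis using assms by (simp add: primitive_root_of_unity_def)
qed

section \<open>Powers of the primitive element\<close>

lemma sum_two_terms:
  fixes F :: "nat \<Rightarrow> nat \<Rightarrow> 'x::comm_monoid_add"
  assumes "(i0, j0) \<noteq> (i1, j1)" "i0 \<le> a" "i1 \<le> a" "j0 \<le> b" "j1 \<le> b"
    and "\<And>i j. i \<le> a \<Longrightarrow> j \<le> b \<Longrightarrow> (i, j) \<noteq> (i0, j0) \<Longrightarrow> (i, j) \<noteq> (i1, j1) \<Longrightarrow> F i j = 0"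
  shows "(\<Sum>i\<le>a. \<Sum>j\<le>b. F i j) = (F i0 j0 + F i1 j1)"
proof -
  have "(\<Sum>i\<le>a. \<Sum>j\<le>b. F i j) = (\<Sum>(i, j)\<in>{..a} \<times> {..b}. F i j)"
    by (simp add: sum.cartesian_product)
  also have "\<dots> = (\<Sum>(i, j)\<in>{(i0, j0), (i1, j1)}. F i j)"
    using assms by (intro sum.mono_neutral_right) auto
  also have "\<dots> = F i0 j0 + F i1 j1" using assms(1) by simp
  finally show ?thesis .
qed

lemma sum_one_term:
  fixes F :: "nat \<Rightarrow> nat \<Rightarrow> 'x::comm_monoid_add"
  assumes "i0 \<le> a" "j0 \<le> b"
    and "\<And>i j. i \<le> a \<Longrightarrow> j \<le> b \<Longrightarrow> (i, j) \<noteq> (i0, j0) \<Longrightarrow> F i j = 0"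
  shows "(\<Sum>i\<le>a. \<Sum>j\<le>b. F i j) = F i0 j0"
proof -
  have "(\<Sum>i\<le>a. \<Sum>j\<le>b. F i j) = (\<Sum>(i, j)\<in>{..a} \<times> {..b}. F i j)"
    by (simp add: sum.cartesian_product)
  also have "\<dots> = (\<Sum>(i, j)\<in>{(i0, j0)}. F i j)"
    using assms by (intro sum.mono_neutral_right) auto
  finally show ?thesis by simp
qed

definition quadrilinear_map ::
  "('k::field \<Rightarrow> 'v::ab_group_add \<Rightarrow> 'v) \<Rightarrow> ('k \<Rightarrow> 'x::ab_group_add \<Rightarrow> 'x) \<Rightarrow>
   ('v \<Rightarrow> 'v \<Rightarrow> 'v \<Rightarrow> 'v \<Rightarrow> 'x) \<Rightarrow> bool" where
  "quadrilinear_map sV sX f \<longleftrightarrow>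
     (\<forall>b c d. Vector_Spaces.linear sV sX (\<lambda>a. f a b c d)) \<and>
     (\<forall>a c d. Vector_Spaces.linear sV sX (\<lambda>b. f a b c d)) \<and>
     (\<forall>a b d. Vector_Spaces.linear sV sX (\<lambda>c. f a b c d)) \<and>
     (\<forall>a b c. Vector_Spaces.linear sV sX (\<lambda>d. f a b c d))"

lemma quadrilinear_mapI:
  assumes "\<And>b c d. Vector_Spaces.linear sV sX (\<lambda>a. f a b c d)"
    "\<And>a c d. Vector_Spaces.linear sV sX (\<lambda>b. f a b c d)"
    "\<And>a b d. Vector_Spaces.linear sV sX (\<lambda>c. f a b c d)"
    "\<And>a b c. Vector_Spaces.linear sV sX (\<lambda>d. f a b c d)"
  shows "quadrilinear_map sV sX f"
  using assms by (simp add: quadrilinear_map_def)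

text \<open>The values of the cocycle on powers of \<open>y\<close> are computed in terms of the order \<open>\<theta>\<close> of \<open>q\<close>; that
  \<open>\<theta>\<close> is the dimension of \<open>R\<close> is a separate matter, settled by \<open>theta_eq\<close>.\<close>

locale yd_line_cocycle = pre_bialgebra_cocycle sH \<Delta> \<epsilon> S sR act \<rho> \<delta> \<epsilon>R m oneR \<xi>
  for sH :: "'k::field \<Rightarrow> 'h::ring_1 \<Rightarrow> 'h"
    and \<Delta> :: "'h \<Rightarrow> ('h \<times> 'h) list"
    and \<epsilon> :: "'h \<Rightarrow> 'k"
    and S :: "'h \<Rightarrow> 'h"
    and sR :: "'k \<Rightarrow> 'r::ab_group_add \<Rightarrow> 'r"
    and act :: "'h \<Rightarrow> 'r \<Rightarrow> 'r"
    and \<rho> :: "'r \<Rightarrow> ('h \<times> 'r) list"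
    and \<delta> :: "'r \<Rightarrow> ('r \<times> 'r) list"
    and \<epsilon>R :: "'r \<Rightarrow> 'k"
    and m :: "'r \<Rightarrow> 'r \<Rightarrow> 'r"
    and oneR :: "'r"
    and \<xi> :: "'r \<Rightarrow> 'r \<Rightarrow> 'h" +
  fixes y :: 'r and g :: 'h and \<chi> :: "'h \<Rightarrow> 'k" and \<theta> :: nat and \<gamma> :: "'h \<Rightarrow> 'k"
  assumes integral: "ad_invariant_integral sH \<Delta> \<epsilon> S \<gamma>"
    and primitives_eq: "primitives sR \<delta> oneR = module.span sR {y}"
    and y_nonzero: "y \<noteq> 0"
    and datum: "yd_datum sH \<Delta> \<epsilon> \<theta> (\<chi> g) g \<chi>" and theta_ge_2: "2 \<le> \<theta>"
    and coact_y: "tensor_eq sH sR (\<rho> y) [(g, y)]"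
    and act_y: "act h y = sR (\<chi> h) y"
begin

abbreviation q :: 'k where "q \<equiv> \<chi> g"
abbreviation pw :: "nat \<Rightarrow> 'r" where "pw \<equiv> mpower m oneR y"

lemma vs_H: "vector_space sH" by (rule vector_space_axioms)
lemma vs_R: "vector_space sR" by (rule V.vector_space_axioms)

lemma mult_bilinear: "bilinear_map sH sH sH (*)"
  by (intro bilinear_mapI) (simp_all add: Vector_Spaces.linear_iff vs_H algebra_simps scale_mult_left scale_mult_right)

lemma chi_linear: "Vector_Spaces.linear sH (*) \<chi>"
  and q_root: "primitive_root_of_unity \<theta> q"
  and comult_g: "tensor_eq sH sH (\<Delta> g) [(g, g)]" and counit_g: "\<epsilon> g = 1"
  using datum by (auto simp: yd_datum_def grouplikes_def)

lemma gamma_linear: "Vector_Spaces.linear sH (*) \<gamma>" and gamma_one: "\<gamma> 1 = 1"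
  and gamma_integral: "(\<Sum>(a, b)\<leftarrow>\<Delta> h. sH (\<gamma> b) a) = sH (\<gamma> h) 1"
  and gamma_ad: "(\<Sum>(a, b)\<leftarrow>\<Delta> h. \<gamma> (a * x * S b)) = \<epsilon> h * \<gamma> x"
  using integral by (auto simp: ad_invariant_integral_def)

lemma linear_coact_sum:
  assumes "bilinear_map sH sR sX f" "Vector_Spaces.linear s1 sR F"
  shows "Vector_Spaces.linear s1 sX (\<lambda>x. \<Sum>(a, b)\<leftarrow>\<rho> (F x). f a b)"
  by (rule linear_app[OF linear_tensor_sum[OF coact_linear assms(1) vs_R] assms(2)])

lemma linear_comult_sum:
  assumes "bilinear_map sR sR sX f" "Vector_Spaces.linear s1 sR F"
  shows "Vector_Spaces.linear s1 sX (\<lambda>x. \<Sum>(a, b)\<leftarrow>\<delta> (F x). f a b)"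
  by (rule linear_app[OF linear_tensor_sum[OF R.comult_linear assms(1) vs_R] assms(2)])

lemma linear_Comult_sum:
  assumes "bilinear_map sH sH sX f" "Vector_Spaces.linear s1 sH F"
  shows "Vector_Spaces.linear s1 sX (\<lambda>x. \<Sum>(a, b)\<leftarrow>\<Delta> (F x). f a b)"
  by (rule linear_app[OF linear_tensor_sum[OF comult_linear assms(1) vs_H] assms(2)])

lemmas yd_linear_intros =
  linear_intros vs_H vs_R vector_space_field
  linear_bilinear_left[OF act_bilinear] linear_bilinear_right[OF act_bilinear]
  linear_bilinear_left[OF m_bilinear] linear_bilinear_right[OF m_bilinear]
  linear_bilinear_left[OF xi_bilinear] linear_bilinear_right[OF xi_bilinear]
  linear_bilinear_left[OF mult_bilinear] linear_bilinear_right[OF mult_bilinear]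
  linear_app[OF counit_linear] linear_app[OF R.counit_linear]
  linear_app[OF chi_linear] linear_app[OF gamma_linear] linear_app[OF antipode_linear]
  linear_coact_sum linear_comult_sum linear_Comult_sum
  bilinear_mapI trilinear_mapI quadrilinear_mapI


lemma coact_tensor_sum:
  "(\<Sum>(u, r0, s0)\<leftarrow>coact_tensor \<rho> r s. f u r0 s0) =
    (\<Sum>(u, r0)\<leftarrow>\<rho> r. \<Sum>(v, s0)\<leftarrow>\<rho> s. f (u * v) r0 s0)"
  unfolding coact_tensor_def by (simp add: map_concat comp_def case_prod_unfold sum_list_concat)

lemma comult_tensor_sum:
  "(\<Sum>((p1, p2), (p3, p4))\<leftarrow>comult_tensor act \<rho> \<delta> r s. f p1 p2 p3 p4) =
    (\<Sum>(r1, r2)\<leftarrow>\<delta> r. \<Sum>(u, r0)\<leftarrow>\<rho> r2. \<Sum>(s1, s2)\<leftarrow>\<delta> s. f r1 (act u s1) r0 s2)"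
  unfolding comult_tensor_def by (simp add: map_concat comp_def case_prod_unfold sum_list_concat)

lemma m_xi_comult_sum:
  "(\<Sum>(x, h)\<leftarrow>m_xi_comult act \<rho> \<delta> m \<xi> r s. f x h) =
    (\<Sum>((p1, p2), (p3, p4))\<leftarrow>comult_tensor act \<rho> \<delta> r s. f (m p1 p2) (\<xi> p3 p4))"
  unfolding m_xi_comult_def by (simp add: map_concat comp_def case_prod_unfold sum_list_concat)

lemma comult_coact_sum:
  assumes "trilinear_map sH sR sR sX f"
  shows "(\<Sum>(u, r0)\<leftarrow>\<rho> r. \<Sum>(r1, r2)\<leftarrow>\<delta> r0. f u r1 r2) =
    (\<Sum>(r1, r2)\<leftarrow>\<delta> r. \<Sum>(u, a)\<leftarrow>\<rho> r1. \<Sum>(v, b)\<leftarrow>\<rho> r2. f (u * v) a b)"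
proof -
  have "(\<Sum>(u, r0)\<leftarrow>\<rho> r. \<Sum>(r1, r2)\<leftarrow>\<delta> r0. f u r1 r2) =
      (\<Sum>(r1, r2)\<leftarrow>\<delta> r. \<Sum>(u, a, b)\<leftarrow>coact_tensor \<rho> r1 r2. f u a b)"
    using tensor3_eq_sum_eq[OF assms comult_coact, of r]
    by (simp add: map_concat comp_def case_prod_unfold sum_list_concat)
  then show ?thesis by (simp only: coact_tensor_sum)
qed

subsection \<open>Action and comultiplication\<close>

lemma act_pw: "act h (pw n) = sR (convolution_power \<Delta> \<epsilon> \<chi> n h) (pw n)"
proof (induction n arbitrary: h)
  case 0
  then show ?case by (simp add: act_oneR)
next
  case (Suc n)
  have "sR (\<Sum>(a, b)\<leftarrow>xs. f a b) (v::'r) = (\<Sum>(a, b)\<leftarrow>xs. sR (f a b) v)" for xs :: "('h \<times> 'h) list" and f v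
    by (induction xs) (auto simp: V.scale_left_distrib)
  moreover have "m (sR c v) (sR d w) = sR (c * d) (m v w)" for c d v w
    using m_bilinear by (simp add: bilinear_map_def Vector_Spaces.linear_iff mult.commute)
  ultimately show ?case by (simp add: act_m act_y Suc)
qed

lemma grouplike_sum:
  assumes "tensor_eq sH sH (\<Delta> x) [(x, x)]" "bilinear_map sH sH sX f"
  shows "(\<Sum>(a, b)\<leftarrow>\<Delta> x. f a b) = f x x"
  using tensor_eq_sum_eq[OF assms(2,1)] by simp

lemma act_g_power: "act (g ^ k) (pw n) = sR (q ^ (k * n)) (pw n)"
proof -
  have g: "act g (pw n) = sR (q ^ n) (pw n)" for n
  proof (induction n)
    case 0
    then show ?case by (simp add: act_oneR counit_g)
  next
    case (Suc n)
    have "act g (pw (Suc n)) = (\<Sum>(a, b)\<leftarrow>\<Delta> g. m (act a y) (act b (pw n)))" by (simp add: act_m)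
    also have "\<dots> = m (act g y) (act g (pw n))"
      by (rule grouplike_sum[OF comult_g, where sX = sR]) (intro yd_linear_intros)
    also have "\<dots> = sR (q ^ Suc n) (pw (Suc n))"
      using m_bilinear by (simp add: act_y Suc bilinear_map_def Vector_Spaces.linear_iff mult.commute)
    finally show ?case .
  qed
  show ?thesis
  proof (induction k)
    case 0
    then show ?case by (simp add: act_one)
  next
    case (Suc k)
    have "act (g ^ Suc k) (pw n) = act g (sR (q ^ (k * n)) (pw n))" by (simp add: act_mult Suc)
    also have "\<dots> = sR (q ^ (k * n)) (act g (pw n))"
      using act_bilinear by (simp add: bilinear_map_def Vector_Spaces.linear_iff)
    finally show ?case by (simp add: g power_add mult.commute)
  qed
qed

lemma comult_y: "tensor_eq sR sR (\<delta> y) [(y, oneR), (oneR, y)]"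
proof -
  have "y \<in> primitives sR \<delta> oneR" using primitives_eq V.span_base by simp
  then show ?thesis by (simp add: primitives_def)
qed

lemma comult_y_sum:
  assumes "bilinear_map sR sR sX f"
  shows "(\<Sum>(a, b)\<leftarrow>\<delta> y. f a b) = f y oneR + f oneR y"
  using tensor_eq_sum_eq[OF assms comult_y] by simp

lemma coact_y_sum:
  assumes "bilinear_map sH sR sX f"
  shows "(\<Sum>(a, b)\<leftarrow>\<rho> y. f a b) = f g y"
  using tensor_eq_sum_eq[OF assms coact_y] by simp

lemma coact_oneR_sum:
  assumes "bilinear_map sH sR sX f"
  shows "(\<Sum>(a, b)\<leftarrow>\<rho> oneR. f a b) = f 1 oneR"
  using tensor_eq_sum_eq[OF assms coact_oneR] by simp

text \<open>In \<open>\<delta>(y y\<^sup>n)\<close> only the first factor \<open>y\<close> has to be moved past a power of \<open>y\<close>, so only the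
  coaction on \<open>y\<close> enters; the coaction on higher powers is deduced from this formula later.\<close>

lemma comult_pw_sum:
  assumes f: "bilinear_map sR sR sX f"
  shows "(\<Sum>(a, b)\<leftarrow>\<delta> (pw n). f a b) = (\<Sum>i\<le>n. sX (qbinomial q n i) (f (pw i) (pw (n - i))))"
  using f
proof (induction n arbitrary: f)
  case 0
  interpret X: vector_space sX by (rule bilinear_map_codomain[OF 0])
  show ?case using tensor_eq_sum_eq[OF 0 comult_oneR] by simp
next
  case (Suc n)
  note f = Suc.prems
  have X: "vector_space sX" by (rule bilinear_map_codomain[OF f])
  interpret X: vector_space sX by (rule X)
  note f_linear = linear_bilinear_left[OF f] linear_bilinear_right[OF f]
  have hom1: "f (sR c a) b = sX c (f a b)" for a b c
    using f by (simp add: bilinear_map_def Vector_Spaces.linear_iff)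
  have mh: "m a (sR c b) = sR c (m a b)" for a b c
    using m_bilinear by (simp add: bilinear_map_def Vector_Spaces.linear_iff)
  have "(\<Sum>(a, b)\<leftarrow>\<delta> (pw (Suc n)). f a b) =
      (\<Sum>(a, b)\<leftarrow>[(m p1 p2, m p3 p4). ((p1, p2), (p3, p4)) \<leftarrow> comult_tensor act \<rho> \<delta> y (pw n)]. f a b)"
    using tensor_eq_sum_eq[OF f comult_m] by simp
  also have "\<dots> = (\<Sum>((p1, p2), (p3, p4))\<leftarrow>comult_tensor act \<rho> \<delta> y (pw n). f (m p1 p2) (m p3 p4))"
    by (simp add: map_concat comp_def case_prod_unfold sum_list_concat)
  also have "\<dots> = (\<Sum>(r1, r2)\<leftarrow>\<delta> y. \<Sum>(u, r0)\<leftarrow>\<rho> r2. \<Sum>(s1, s2)\<leftarrow>\<delta> (pw n). f (m r1 (act u s1)) (m r0 s2))"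
    by (rule comult_tensor_sum)
  also have "\<dots> = (\<Sum>(u, r0)\<leftarrow>\<rho> oneR. \<Sum>(s1, s2)\<leftarrow>\<delta> (pw n). f (m y (act u s1)) (m r0 s2)) +
      (\<Sum>(u, r0)\<leftarrow>\<rho> y. \<Sum>(s1, s2)\<leftarrow>\<delta> (pw n). f (m oneR (act u s1)) (m r0 s2))"
    by (rule comult_y_sum[where sX = sX]) (intro yd_linear_intros f_linear X)
  also have "(\<Sum>(u, r0)\<leftarrow>\<rho> oneR. \<Sum>(s1, s2)\<leftarrow>\<delta> (pw n). f (m y (act u s1)) (m r0 s2)) =
      (\<Sum>(s1, s2)\<leftarrow>\<delta> (pw n). f (m y s1) s2)"
    by (subst coact_oneR_sum[where sX = sX]) (intro yd_linear_intros f_linear X, simp add: act_one m_oneR_left)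
  also have "\<dots> = (\<Sum>i\<le>n. sX (qbinomial q n i) (f (pw (Suc i)) (pw (n - i))))"
    by (subst Suc.IH) (intro yd_linear_intros f_linear X, simp)
  also have "(\<Sum>(u, r0)\<leftarrow>\<rho> y. \<Sum>(s1, s2)\<leftarrow>\<delta> (pw n). f (m oneR (act u s1)) (m r0 s2)) =
      (\<Sum>(s1, s2)\<leftarrow>\<delta> (pw n). f (act g s1) (m y s2))"
    by (subst coact_y_sum[where sX = sX]) (intro yd_linear_intros f_linear X, simp add: m_oneR_left)
  also have "\<dots> = (\<Sum>i\<le>n. sX (q ^ i * qbinomial q n i) (f (pw i) (pw (Suc n - i))))"
    using act_g_power[of 1]
    by (subst Suc.IH) (intro yd_linear_intros f_linear X, simp add: hom1 mult.commute Suc_diff_le)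
  also have "(\<Sum>i\<le>n. sX (qbinomial q n i) (f (pw (Suc i)) (pw (n - i)))) +
      (\<Sum>i\<le>n. sX (q ^ i * qbinomial q n i) (f (pw i) (pw (Suc n - i)))) =
      (\<Sum>i\<le>Suc n. sX (qbinomial q (Suc n) i) (f (pw i) (pw (Suc n - i))))"
  proof -
    have "(\<Sum>i\<le>n. sX (q ^ i * qbinomial q n i) (f (pw i) (pw (Suc n - i)))) =
        (\<Sum>i\<le>Suc n. sX (q ^ i * qbinomial q n i) (f (pw i) (pw (Suc n - i))))"
      by (simp add: qbinomial_eq_0)
    also have "\<dots> = f (pw 0) (pw (Suc n)) + (\<Sum>i\<le>n. sX (q ^ Suc i * qbinomial q n (Suc i)) (f (pw (Suc i)) (pw (n - i))))"
      by (subst sum.atMost_Suc_shift) simp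
    finally show ?thesis
      by (subst sum.atMost_Suc_shift)
        (simp add: X.scale_left_distrib sum.distrib algebra_simps del: mpower.simps)
  qed
  finally show ?case .
qed

text \<open>The Gaussian binomial coefficients of level \<open>\<theta>\<close> vanish, so \<open>pw \<theta>\<close> is primitive, hence
  a multiple of \<open>y\<close>; but \<open>g\<close> fixes \<open>pw \<theta>\<close> and multiplies \<open>y\<close> by \<open>q \<noteq> 1\<close>.\<close>

lemma pw_theta: "pw \<theta> = 0"
proof -
  have "tensor_eq sR sR (\<delta> (pw \<theta>)) [(pw \<theta>, oneR), (oneR, pw \<theta>)]"
  proof (rule tensor_eqI[OF vs_R vs_R])
    fix f :: "'r \<Rightarrow> 'r \<Rightarrow> 'k"
    assume f: "bilinear_map sR sR (*) f"
    have "(\<Sum>i\<le>\<theta>. qbinomial q \<theta> i * f (pw i) (pw (\<theta> - i))) =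
        (\<Sum>i\<in>{0, \<theta>}. qbinomial q \<theta> i * f (pw i) (pw (\<theta> - i)))"
      using qbinomial_root_of_unity[OF q_root] by (intro sum.mono_neutral_right) auto
    then show "(\<Sum>(a, b)\<leftarrow>\<delta> (pw \<theta>). f a b) = (\<Sum>(a, b)\<leftarrow>[(pw \<theta>, oneR), (oneR, pw \<theta>)]. f a b)"
      using theta_ge_2 by (simp add: comult_pw_sum[OF f])
  qed
  then have "pw \<theta> \<in> primitives sR \<delta> oneR" by (simp add: primitives_def)
  then obtain c where c: "pw \<theta> = sR c y"
    unfolding primitives_eq by (auto simp: V.span_singleton)
  have act_h: "act g (sR c y) = sR (c * q) y"
    using act_bilinear act_y by (simp add: bilinear_map_def Vector_Spaces.linear_iff)
  have "act g (pw \<theta>) = pw \<theta>"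
    using act_g_power[of 1 \<theta>] q_root by (simp add: primitive_root_of_unity_def)
  then have "sR (c * q) y = sR c y" using c act_h by simp
  then have "c * q = c" using y_nonzero by simp
  moreover have "q \<noteq> 1"
    using q_root theta_ge_2 unfolding primitive_root_of_unity_def
    by (metis One_nat_def Suc_1 Suc_le_eq power_one_right zero_less_one)
  ultimately have "c = 0" by simp
  then show ?thesis using c by simp
qed

lemma pw_eq_0: "\<theta> \<le> n \<Longrightarrow> pw n = 0"
proof (induction n rule: dec_induct)
  case base
  then show ?case by (rule pw_theta)
next
  case (step n)
  then show ?case using linear_bilinear_right[OF m_bilinear] m_bilinear
    by (metis V.scale_zero_right bilinear_map_def linear_iff_module_hom module_hom.zero mpower.simps(2))
qed

subsection \<open>The comultiplication of a tensor product of powers\<close>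

text \<open>The coaction on \<open>y\<^sup>n\<close> is obtained together with the vanishing of the cocycle in degree \<open>n\<close>, by a
  joint induction. Until then it is available only below a given degree.\<close>

definition coact_pw_upto :: "nat \<Rightarrow> bool" where
  "coact_pw_upto n \<longleftrightarrow> (\<forall>k\<le>n. tensor_eq sH sR (\<rho> (pw k)) [(g ^ k, pw k)])"

lemma coact_pw_sum:
  assumes "coact_pw_upto n" "k \<le> n" "bilinear_map sH sR sX f"
  shows "(\<Sum>(a, b)\<leftarrow>\<rho> (pw k). f a b) = f (g ^ k) (pw k)"
  using tensor_eq_sum_eq[OF assms(3), of "\<rho> (pw k)" "[(g ^ k, pw k)]"] assms(1,2)
  by (simp add: coact_pw_upto_def)

lemma comult_tensor_pw:
  assumes \<rho>: "coact_pw_upto a" and f: "quadrilinear_map sR sX f"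
  shows "(\<Sum>((p1, p2), (p3, p4))\<leftarrow>comult_tensor act \<rho> \<delta> (pw a) (pw b). f p1 p2 p3 p4) =
    (\<Sum>i\<le>a. \<Sum>j\<le>b. sX (qbinomial q a i * qbinomial q b j * q ^ ((a - i) * j))
      (f (pw i) (pw j) (pw (a - i)) (pw (b - j))))"
proof -
  have lin: "Vector_Spaces.linear sR sX (\<lambda>a. f a b c d)" "Vector_Spaces.linear sR sX (\<lambda>b. f a b c d)"
    "Vector_Spaces.linear sR sX (\<lambda>c. f a b c d)" "Vector_Spaces.linear sR sX (\<lambda>d. f a b c d)" for a b c d
    using f by (simp_all add: quadrilinear_map_def)
  have X: "vector_space sX" using lin(1) by (simp add: Vector_Spaces.linear_iff)
  interpret X: vector_space sX by (rule X)
  note f_linear = linear_app[OF lin(1)] linear_app[OF lin(2)] linear_app[OF lin(3)] linear_app[OF lin(4)]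
  have hom: "f a (sR k b) c d = sX k (f a b c d)" for a b c d k
    using lin(2) by (simp add: Vector_Spaces.linear_iff)
  have "(\<Sum>((p1, p2), (p3, p4))\<leftarrow>comult_tensor act \<rho> \<delta> (pw a) (pw b). f p1 p2 p3 p4) =
      (\<Sum>(r1, r2)\<leftarrow>\<delta> (pw a). \<Sum>(u, r0)\<leftarrow>\<rho> r2. \<Sum>(s1, s2)\<leftarrow>\<delta> (pw b). f r1 (act u s1) r0 s2)"
    by (rule comult_tensor_sum)
  also have "\<dots> = (\<Sum>i\<le>a. sX (qbinomial q a i)
      (\<Sum>(u, r0)\<leftarrow>\<rho> (pw (a - i)). \<Sum>(s1, s2)\<leftarrow>\<delta> (pw b). f (pw i) (act u s1) r0 s2))"
    by (rule comult_pw_sum[where sX = sX]) (intro yd_linear_intros f_linear X)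
  also have "\<dots> = (\<Sum>i\<le>a. sX (qbinomial q a i)
      (\<Sum>(s1, s2)\<leftarrow>\<delta> (pw b). f (pw i) (act (g ^ (a - i)) s1) (pw (a - i)) s2))"
    by (intro sum.cong refl arg_cong[where f = "sX _"] coact_pw_sum[OF \<rho>, where sX = sX])
      (simp, intro yd_linear_intros f_linear X)
  also have "\<dots> = (\<Sum>i\<le>a. sX (qbinomial q a i)
      (\<Sum>j\<le>b. sX (qbinomial q b j) (f (pw i) (act (g ^ (a - i)) (pw j)) (pw (a - i)) (pw (b - j)))))"
    by (intro sum.cong refl arg_cong[where f = "sX _"] comult_pw_sum[where sX = sX])
      (intro yd_linear_intros f_linear X)
  also have "\<dots> = (\<Sum>i\<le>a. \<Sum>j\<le>b. sX (qbinomial q a i * qbinomial q b j * q ^ ((a - i) * j))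
      (f (pw i) (pw j) (pw (a - i)) (pw (b - j))))"
    by (simp add: act_g_power hom X.scale_sum_right mult.assoc)
  finally show ?thesis .
qed

end

section \<open>The values of the cocycle\<close>

context yd_line_cocycle
begin

lemma xi_one: "\<xi> oneR oneR = 1"
  using xi_oneR_right[of oneR] by (simp add: counit_oneR)

lemma counit_pw: "0 < n \<Longrightarrow> \<epsilon>R (pw n) = 0"
proof -
  have "Vector_Spaces.linear sR (*) \<epsilon>R" by (rule R.counit_linear)
  moreover have "y = y + sR (\<epsilon>R y) oneR"
  proof -
    have "(\<Sum>(a, b)\<leftarrow>\<delta> y. sR (\<epsilon>R b) a) = sR (\<epsilon>R oneR) y + sR (\<epsilon>R y) oneR"
      by (rule comult_y_sum[where sX = sR]) (intro yd_linear_intros)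
    then show ?thesis using R.counit_right[of y] by (simp add: counit_oneR)
  qed
  ultimately show "0 < n \<Longrightarrow> \<epsilon>R (pw n) = 0"
    using counit_oneR linear_map_zero[OF R.counit_linear] by (cases n) (auto simp: counit_m)
qed

lemma xi_zero_left: "\<xi> 0 s = 0" and xi_zero_right: "\<xi> r 0 = 0"
  using xi_bilinear linear_map_zero[of sR sH "\<lambda>r. \<xi> r s"] linear_map_zero[of sR sH "\<xi> r"]
  by (auto simp: bilinear_map_def)

lemma xi_oneR_pw: "0 < n \<Longrightarrow> \<xi> oneR (pw n) = 0" "0 < n \<Longrightarrow> \<xi> (pw n) oneR = 0"
  using counit_pw by (simp_all add: xi_oneR_left xi_oneR_right)

lemma g_antipode: "g * S g = 1"
proof -
  have "(\<Sum>(a, b)\<leftarrow>\<Delta> g. a * S b) = g * S g"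
    by (rule grouplike_sum[OF comult_g, where sX = sH]) (intro yd_linear_intros)
  then show ?thesis using antipode_right[of g] by (simp add: counit_g)
qed

lemma comult_xi_pw_sum:
  assumes \<rho>: "coact_pw_upto a" "coact_pw_upto b" and f: "bilinear_map sH sH sX f"
  shows "(\<Sum>(u, v)\<leftarrow>\<Delta> (\<xi> (pw a) (pw b)). f u v) =
    (\<Sum>i\<le>a. \<Sum>j\<le>b. sX (qbinomial q a i * qbinomial q b j * q ^ ((a - i) * j))
      (f (\<xi> (pw i) (pw j) * (g ^ (a - i) * g ^ (b - j))) (\<xi> (pw (a - i)) (pw (b - j)))))"
proof -
  have X: "vector_space sX" by (rule bilinear_map_codomain[OF f])
  note f_linear = linear_bilinear_left[OF f] linear_bilinear_right[OF f]
  let ?F = "\<lambda>p1 p2 p3 p4. \<Sum>(u, r0)\<leftarrow>\<rho> p3. \<Sum>(v, s0)\<leftarrow>\<rho> p4. f (\<xi> p1 p2 * (u * v)) (\<xi> r0 s0)"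
  have "(\<Sum>(u, v)\<leftarrow>\<Delta> (\<xi> (pw a) (pw b)). f u v) =
      (\<Sum>(u, v)\<leftarrow>[(\<xi> p1 p2 * u, \<xi> t3 t4).
        ((p1, p2), (p3, p4)) \<leftarrow> comult_tensor act \<rho> \<delta> (pw a) (pw b), (u, t3, t4) \<leftarrow> coact_tensor \<rho> p3 p4]. f u v)"
    by (rule tensor_eq_sum_eq[OF f comult_xi])
  also have "\<dots> = (\<Sum>((p1, p2), (p3, p4))\<leftarrow>comult_tensor act \<rho> \<delta> (pw a) (pw b).
      \<Sum>(u, t3, t4)\<leftarrow>coact_tensor \<rho> p3 p4. f (\<xi> p1 p2 * u) (\<xi> t3 t4))"
    by (simp add: map_concat comp_def case_prod_unfold sum_list_concat)
  also have "\<dots> = (\<Sum>((p1, p2), (p3, p4))\<leftarrow>comult_tensor act \<rho> \<delta> (pw a) (pw b). ?F p1 p2 p3 p4)"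
    by (simp only: coact_tensor_sum)
  also have "\<dots> = (\<Sum>i\<le>a. \<Sum>j\<le>b. sX (qbinomial q a i * qbinomial q b j * q ^ ((a - i) * j))
      (?F (pw i) (pw j) (pw (a - i)) (pw (b - j))))"
    by (rule comult_tensor_pw[OF \<rho>(1)]) (intro yd_linear_intros f_linear X)
  also have "\<dots> = (\<Sum>i\<le>a. \<Sum>j\<le>b. sX (qbinomial q a i * qbinomial q b j * q ^ ((a - i) * j))
      (f (\<xi> (pw i) (pw j) * (g ^ (a - i) * g ^ (b - j))) (\<xi> (pw (a - i)) (pw (b - j)))))"
  proof (intro sum.cong refl arg_cong[where f = "sX _"])
    fix i j
    have "?F (pw i) (pw j) (pw (a - i)) (pw (b - j)) =
        (\<Sum>(v, s0)\<leftarrow>\<rho> (pw (b - j)). f (\<xi> (pw i) (pw j) * (g ^ (a - i) * v)) (\<xi> (pw (a - i)) s0))"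
      by (rule coact_pw_sum[OF \<rho>(1), where sX = sX]) (simp, intro yd_linear_intros f_linear X)
    also have "\<dots> = f (\<xi> (pw i) (pw j) * (g ^ (a - i) * g ^ (b - j))) (\<xi> (pw (a - i)) (pw (b - j)))"
      by (rule coact_pw_sum[OF \<rho>(2), where sX = sX]) (simp, intro yd_linear_intros f_linear X)
    finally show "?F (pw i) (pw j) (pw (a - i)) (pw (b - j)) = \<dots>" .
  qed
  finally show ?thesis .
qed

definition middle_vanishes :: "nat \<Rightarrow> nat \<Rightarrow> bool" where
  "middle_vanishes a b \<longleftrightarrow> (\<forall>i\<le>a. \<forall>j\<le>b. (i, j) \<noteq> (0, 0) \<longrightarrow> (i, j) \<noteq> (a, b) \<longrightarrow>
     \<xi> (pw i) (pw j) = 0 \<or> \<xi> (pw (a - i)) (pw (b - j)) = 0)"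

text \<open>Only the extreme terms of \<open>\<Delta>(w)\<close> survive, \<open>w = \<xi>(y\<^sup>a \<otimes> y\<^sup>b)\<close>. The integral, applied to the second
  factor of \<open>\<Delta>(w) = w \<otimes> 1 + g\<^sup>n \<otimes> w\<close>, gives \<open>\<gamma>(w) 1 = w + \<gamma>(w) g\<^sup>n\<close>.\<close>

lemma xi_eq_multiple:
  assumes \<rho>: "coact_pw_upto a" "coact_pw_upto b" and ab: "0 < a + b" and mid: "middle_vanishes a b"
  shows "\<xi> (pw a) (pw b) = sH (\<gamma> (\<xi> (pw a) (pw b))) (1 - g ^ (a + b))"
proof -
  let ?w = "\<xi> (pw a) (pw b)"
  let ?T = "\<lambda>i j. sH (qbinomial q a i * qbinomial q b j * q ^ ((a - i) * j))
      (sH (\<gamma> (\<xi> (pw (a - i)) (pw (b - j)))) (\<xi> (pw i) (pw j) * (g ^ (a - i) * g ^ (b - j))))"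
  have bil: "bilinear_map sH sH sH (\<lambda>u v. sH (\<gamma> v) u)" by (intro yd_linear_intros)
  have \<gamma>0: "\<gamma> 0 = 0" by (rule linear_map_zero[OF gamma_linear])
  have "sH (\<gamma> ?w) 1 = (\<Sum>(u, v)\<leftarrow>\<Delta> ?w. sH (\<gamma> v) u)" by (rule gamma_integral[symmetric])
  also have "\<dots> = (\<Sum>i\<le>a. \<Sum>j\<le>b. sH (qbinomial q a i * qbinomial q b j * q ^ ((a - i) * j))
      (sH (\<gamma> (\<xi> (pw (a - i)) (pw (b - j)))) (\<xi> (pw i) (pw j) * (g ^ (a - i) * g ^ (b - j)))))"
    by (rule comult_xi_pw_sum[OF \<rho> bil])
  also have "\<dots> = ?T 0 0 + ?T a b"
  proof (rule sum_two_terms)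
    fix i j assume ij: "i \<le> a" "j \<le> b" "(i, j) \<noteq> (0, 0)" "(i, j) \<noteq> (a, b)"
    then have "\<xi> (pw i) (pw j) = 0 \<or> \<xi> (pw (a - i)) (pw (b - j)) = 0"
      using mid unfolding middle_vanishes_def by blast
    then show "?T i j = 0" using \<gamma>0 by auto
  qed (use ab in auto)
  also have "\<dots> = sH (\<gamma> ?w) (g ^ (a + b)) + ?w"
    by (simp add: xi_one gamma_one power_add)
  finally show ?thesis by (simp add: scale_right_diff_distrib algebra_simps)
qed

lemma xi_act_pw:
  "sH (\<Sum>(h1, h2)\<leftarrow>\<Delta> h. convolution_power \<Delta> \<epsilon> \<chi> a h1 * convolution_power \<Delta> \<epsilon> \<chi> b h2) (\<xi> (pw a) (pw b)) =
    (\<Sum>(h1, h2)\<leftarrow>\<Delta> h. h1 * \<xi> (pw a) (pw b) * S h2)"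
proof -
  have "sH (\<Sum>(a, b)\<leftarrow>xs. f a b) v = (\<Sum>(a, b)\<leftarrow>xs. sH (f a b) v)" for xs :: "('h \<times> 'h) list" and f v
    by (induction xs) (auto simp: scale_left_distrib)
  moreover have "\<xi> (sR c v) (sR d w) = sH (c * d) (\<xi> v w)" for c d v w
    using xi_bilinear by (simp add: bilinear_map_def Vector_Spaces.linear_iff mult.commute)
  ultimately show ?thesis
    unfolding xi_act[symmetric] by (simp add: act_pw)
qed

lemma xi_g_commute:
  "sH (q ^ (a + b)) (\<xi> (pw a) (pw b)) = g * \<xi> (pw a) (pw b) * S g"
proof -
  have "(\<Sum>(h1, h2)\<leftarrow>\<Delta> g. \<xi> (act h1 (pw a)) (act h2 (pw b))) = \<xi> (act g (pw a)) (act g (pw b))"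
    by (rule grouplike_sum[OF comult_g, where sX = sH]) (intro yd_linear_intros)
  moreover have "(\<Sum>(h1, h2)\<leftarrow>\<Delta> g. h1 * \<xi> (pw a) (pw b) * S h2) = g * \<xi> (pw a) (pw b) * S g"
    by (rule grouplike_sum[OF comult_g, where sX = sH]) (intro yd_linear_intros)
  moreover have "\<xi> (sR c v) (sR d w) = sH (c * d) (\<xi> v w)" for c d v w
    using xi_bilinear by (simp add: bilinear_map_def Vector_Spaces.linear_iff mult.commute)
  ultimately show ?thesis
    using xi_act[of "pw a" "pw b" g] act_g_power[of 1 a] act_g_power[of 1 b] by (simp add: power_add)
qed

text \<open>By \<open>xi_eq_multiple\<close> the value commutes with \<open>g\<close>, but conjugation by \<open>g\<close> multiplies it by
  \<open>q\<close> to the power \<open>a + b\<close>.\<close>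

lemma xi_eq_0:
  assumes "coact_pw_upto a" "coact_pw_upto b" "0 < a + b" "middle_vanishes a b" "q ^ (a + b) \<noteq> 1"
  shows "\<xi> (pw a) (pw b) = 0"
proof -
  let ?w = "\<xi> (pw a) (pw b)"
  have "g * (1 - g ^ (a + b)) * S g = (1 - g ^ (a + b)) * (g * S g)"
    by (simp add: algebra_simps power_commutes flip: mult.assoc)
  then have "g * ?w * S g = ?w"
    by (subst (1 2) xi_eq_multiple[OF assms(1-4)])
      (simp add: scale_mult_left scale_mult_right g_antipode)
  then have "sH (q ^ (a + b)) ?w = sH 1 ?w" using xi_g_commute[of a b] by simp
  then show ?thesis using assms(5) unfolding scale_cancel_right by simp
qed

lemma coact_pw_upto_mono: "coact_pw_upto n \<Longrightarrow> k \<le> n \<Longrightarrow> coact_pw_upto k"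
  by (simp add: coact_pw_upto_def)

text \<open>The vanishing in degree \<open>n + 1\<close> needs the coaction on the powers up to \<open>y\<^sup>n\<close>. Conversely, once the
  cocycle vanishes up to degree \<open>n + 1\<close>, the compatibility of \<open>\<xi>\<close> with \<open>m\<close>, evaluated at
  \<open>y \<otimes> y\<^sup>n\<close>, reduces to the coaction on \<open>y\<^sup>n\<^sup>+\<^sup>1\<close>.\<close>

lemma xi_coact_below:
  "n < \<theta> \<Longrightarrow> coact_pw_upto n \<and> (\<forall>a b. 0 < a + b \<longrightarrow> a + b \<le> n \<longrightarrow> \<xi> (pw a) (pw b) = 0)"
proof (induction n)
  case 0
  then show ?case using coact_oneR by (simp add: coact_pw_upto_def)
next
  case (Suc n)
  then have \<rho>: "coact_pw_upto n" and low: "\<And>a b. 0 < a + b \<Longrightarrow> a + b \<le> n \<Longrightarrow> \<xi> (pw a) (pw b) = 0"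
    by auto
  have new: "\<xi> (pw a) (pw b) = 0" if ab: "a + b = Suc n" for a b
  proof (cases "a = 0 \<or> b = 0")
    case True
    then show ?thesis using ab xi_oneR_pw[of "Suc n"] by auto
  next
    case False
    then have le: "a \<le> n" "b \<le> n" using ab by auto
    have "middle_vanishes a b"
      unfolding middle_vanishes_def using low ab by (metis Suc_leI add_gr_0 add_less_le_mono
          add_le_less_mono gr0I le_neq_implies_less less_Suc_eq_le prod.inject)
    moreover have "q ^ (a + b) \<noteq> 1"
      using q_root Suc.prems unfolding ab primitive_root_of_unity_def by blast
    ultimately show ?thesis using ab le coact_pw_upto_mono[OF \<rho>] by (intro xi_eq_0) auto
  qed
  have all: "\<xi> (pw a) (pw b) = 0" if "0 < a + b" "a + b \<le> Suc n" for a b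
    using that low new by (cases "a + b = Suc n") auto
  have "tensor_eq sH sR (\<rho> (pw (Suc n))) [(g ^ Suc n, pw (Suc n))]"
  proof (cases n)
    case 0
    then show ?thesis using coact_y by (simp add: m_oneR_right)
  next
    case (Suc l)
    then have \<rho>1: "coact_pw_upto 1" using coact_pw_upto_mono[OF \<rho>] by simp
    show ?thesis
    proof (rule tensor_eqI[OF vs_H vs_R])
      fix f :: "'h \<Rightarrow> 'r \<Rightarrow> 'k"
      assume f: "bilinear_map sH sR (*) f"
      note X = vector_space_field
      note f_linear = linear_bilinear_left[OF f] linear_bilinear_right[OF f]
      have f0: "f 0 b = 0" for b using f linear_map_zero[of sH "(*)" "\<lambda>a. f a b"] by (simp add: bilinear_map_def)
      let ?F = "\<lambda>p1 p2 p3 p4. \<Sum>(u, t0)\<leftarrow>\<rho> (m p1 p2). f (u * \<xi> p3 p4) t0"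
      let ?G = "\<lambda>p1 p2 p3 p4. \<Sum>(u, r0)\<leftarrow>\<rho> p3. \<Sum>(v, s0)\<leftarrow>\<rho> p4. f (\<xi> p1 p2 * (u * v)) (m r0 s0)"
      have "(\<Sum>(a, b)\<leftarrow>[(u * h, t0). (t, h) \<leftarrow> m_xi_comult act \<rho> \<delta> m \<xi> (pw 1) (pw n), (u, t0) \<leftarrow> \<rho> t]. f a b) =
          (\<Sum>(t, h)\<leftarrow>m_xi_comult act \<rho> \<delta> m \<xi> (pw 1) (pw n). \<Sum>(u, t0)\<leftarrow>\<rho> t. f (u * h) t0)"
        by (simp add: map_concat comp_def case_prod_unfold sum_list_concat)
      also have "\<dots> = (\<Sum>((p1, p2), (p3, p4))\<leftarrow>comult_tensor act \<rho> \<delta> (pw 1) (pw n). ?F p1 p2 p3 p4)"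
        by (rule m_xi_comult_sum)
      also have "\<dots> = (\<Sum>i\<le>1. \<Sum>j\<le>n. qbinomial q 1 i * qbinomial q n j * q ^ ((1 - i) * j) *
          ?F (pw i) (pw j) (pw (1 - i)) (pw (n - j)))"
        by (rule comult_tensor_pw[OF \<rho>1]) (intro yd_linear_intros f_linear X)
      also have "\<dots> = (\<Sum>(u, t0)\<leftarrow>\<rho> (pw (Suc n)). f u t0)"
      proof (subst sum_one_term[of 1 1 n n])
        fix i j :: nat assume ij: "i \<le> 1" "j \<le> n" "(i, j) \<noteq> (1, n)"
        then have "\<xi> (pw (1 - i)) (pw (n - j)) = 0" by (intro all) auto
        then show "qbinomial q 1 i * qbinomial q n j * q ^ ((1 - i) * j) *
          ?F (pw i) (pw j) (pw (1 - i)) (pw (n - j)) = 0" by (simp add: f0 case_prod_unfold)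
      qed (simp_all add: xi_one m_oneR_right)
      finally have lhs: "(\<Sum>(a, b)\<leftarrow>[(u * h, t0). (t, h) \<leftarrow> m_xi_comult act \<rho> \<delta> m \<xi> (pw 1) (pw n), (u, t0) \<leftarrow> \<rho> t]. f a b) =
        (\<Sum>(u, t0)\<leftarrow>\<rho> (pw (Suc n)). f u t0)" .
      have "(\<Sum>(a, b)\<leftarrow>[(\<xi> p1 p2 * u, m t3 t4).
          ((p1, p2), (p3, p4)) \<leftarrow> comult_tensor act \<rho> \<delta> (pw 1) (pw n), (u, t3, t4) \<leftarrow> coact_tensor \<rho> p3 p4]. f a b) =
          (\<Sum>((p1, p2), (p3, p4))\<leftarrow>comult_tensor act \<rho> \<delta> (pw 1) (pw n).
            \<Sum>(u, t3, t4)\<leftarrow>coact_tensor \<rho> p3 p4. f (\<xi> p1 p2 * u) (m t3 t4))"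
        by (simp add: map_concat comp_def case_prod_unfold sum_list_concat)
      also have "\<dots> = (\<Sum>((p1, p2), (p3, p4))\<leftarrow>comult_tensor act \<rho> \<delta> (pw 1) (pw n). ?G p1 p2 p3 p4)"
        by (simp only: coact_tensor_sum)
      also have "\<dots> = (\<Sum>i\<le>1. \<Sum>j\<le>n. qbinomial q 1 i * qbinomial q n j * q ^ ((1 - i) * j) *
          ?G (pw i) (pw j) (pw (1 - i)) (pw (n - j)))"
        by (rule comult_tensor_pw[OF \<rho>1]) (intro yd_linear_intros f_linear X)
      also have "\<dots> = ?G (pw 0) (pw 0) (pw 1) (pw n)"
      proof (subst sum_one_term[of 0 1 0 n])
        fix i j :: nat assume ij: "i \<le> 1" "j \<le> n" "(i, j) \<noteq> (0, 0)"
        then have "\<xi> (pw i) (pw j) = 0" by (intro all) auto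
        then show "qbinomial q 1 i * qbinomial q n j * q ^ ((1 - i) * j) *
          ?G (pw i) (pw j) (pw (1 - i)) (pw (n - j)) = 0" by (simp add: f0 case_prod_unfold)
      qed (simp_all del: mpower.simps)
      also have "\<dots> = (\<Sum>(v, s0)\<leftarrow>\<rho> (pw n). f (\<xi> (pw 0) (pw 0) * (g ^ 1 * v)) (m (pw 1) s0))"
        by (rule coact_pw_sum[OF \<rho>1, where sX = "(*)"]) (simp, intro yd_linear_intros f_linear X)
      also have "\<dots> = f (\<xi> (pw 0) (pw 0) * (g ^ 1 * g ^ n)) (m (pw 1) (pw n))"
        by (rule coact_pw_sum[OF \<rho>, where sX = "(*)"]) (simp, intro yd_linear_intros f_linear X)
      also have "\<dots> = f (g ^ Suc n) (pw (Suc n))" by (simp add: xi_one m_oneR_right)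
      finally show "(\<Sum>(a, b)\<leftarrow>\<rho> (pw (Suc n)). f a b) = (\<Sum>(a, b)\<leftarrow>[(g ^ Suc n, pw (Suc n))]. f a b)"
        using tensor_eq_sum_eq[OF f xi_m_compat, of "pw 1" "pw n"] lhs by simp
    qed
  qed
  then have "coact_pw_upto (Suc n)" using \<rho> by (auto simp: coact_pw_upto_def le_Suc_eq)
  then show ?case using all by blast
qed

lemma coact_zero: "tensor_eq sH sR (\<rho> 0) [(h, 0)]"
proof (rule tensor_eqI[OF vs_H vs_R])
  fix f :: "'h \<Rightarrow> 'r \<Rightarrow> 'k"
  assume f: "bilinear_map sH sR (*) f"
  have "(\<Sum>(a, b)\<leftarrow>\<rho> 0. f a b) = 0"
    by (rule linear_map_zero[OF linear_tensor_sum[OF coact_linear f vs_R]])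
  then show "(\<Sum>(a, b)\<leftarrow>\<rho> 0. f a b) = (\<Sum>(a, b)\<leftarrow>[(h, 0)]. f a b)"
    using f linear_map_zero[of sR "(*)" "f h"] by (simp add: bilinear_map_def)
qed

lemma coact_pw: "tensor_eq sH sR (\<rho> (pw n)) [(g ^ n, pw n)]"
  using xi_coact_below[of n] pw_eq_0[of n] coact_zero
  by (cases "n < \<theta>") (auto simp: coact_pw_upto_def)

lemma coact_pw_upto: "coact_pw_upto n"
  using coact_pw by (simp add: coact_pw_upto_def)

lemma xi_below: "0 < a + b \<Longrightarrow> a + b < \<theta> \<Longrightarrow> \<xi> (pw a) (pw b) = 0"
  by (rule xi_coact_below[of "a + b", THEN conjunct2, rule_format, OF _ _ order_refl])

text \<open>For \<open>a, b < \<theta>\<close> the degree lies strictly between \<open>\<theta>\<close> and \<open>2 \<theta>\<close>, so \<open>q\<close> to this power is not \<open>1\<close>.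
  A middle term of \<open>\<Delta>(w)\<close> with first factor of degree \<open>\<theta>\<close> has a second factor of degree between \<open>0\<close> and \<open>\<theta>\<close>,
  which vanishes.\<close>

lemma xi_above: "\<theta> < a + b \<Longrightarrow> \<xi> (pw a) (pw b) = 0"
proof (induction "a + b" arbitrary: a b rule: less_induct)
  case less
  show ?case
  proof (cases "a < \<theta> \<and> b < \<theta>")
    case False
    then show ?thesis using pw_eq_0 xi_zero_left xi_zero_right by (metis not_le)
  next
    case True
    have zero: "\<xi> (pw i) (pw j) = 0" if "i \<le> a" "j \<le> b" "0 < i + j" "i + j < a + b" "i + j \<noteq> \<theta>" for i j
      using that less.hyps xi_below by (meson nat_neq_iff)
    have "middle_vanishes a b"
      unfolding middle_vanishes_def
    proof (intro allI impI)
      fix i j assume ij: "i \<le> a" "j \<le> b" "(i, j) \<noteq> (0, 0)" "(i, j) \<noteq> (a, b)"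
      then have lt: "0 < i + j" "i + j < a + b" by auto
      show "\<xi> (pw i) (pw j) = 0 \<or> \<xi> (pw (a - i)) (pw (b - j)) = 0"
      proof (cases "i + j = \<theta>")
        case False
        then show ?thesis using zero ij lt by blast
      next
        case i: True
        have "\<xi> (pw (a - i)) (pw (b - j)) = 0" using ij lt True i less.prems by (intro zero) auto
        then show ?thesis by blast
      qed
    qed
    moreover have "q ^ (a + b) \<noteq> 1"
      using primitive_root_power_eq_1[OF q_root less.prems] True by simp
    ultimately show ?thesis using less.prems coact_pw_upto by (intro xi_eq_0) auto
  qed
qed

lemma middle_vanishes_theta: "a + b = \<theta> \<Longrightarrow> middle_vanishes a b"
  unfolding middle_vanishes_def by (auto intro!: xi_below)

lemma xi_theta_eq:
  assumes "a + b = \<theta>"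
  shows "\<xi> (pw a) (pw b) = sH (\<gamma> (\<xi> (pw a) (pw b))) (1 - g ^ \<theta>)"
  using xi_eq_multiple[OF coact_pw_upto coact_pw_upto _ middle_vanishes_theta[OF assms]] theta_ge_2 assms
  by simp

subsection \<open>Products of powers\<close>

text \<open>The defect of associativity is measured by \<open>\<xi>\<close>, which is trivial below degree \<open>\<theta>\<close>.\<close>

lemma m_y_m_pw:
  assumes "Suc a < \<theta>"
  shows "m y (m (pw a) t) = m (pw (Suc a)) t"
proof -
  let ?F = "\<lambda>p1 p2 p3 p4. m (m p1 p2) (act (\<xi> p3 p4) t)"
  let ?T = "\<lambda>i j. sR (qbinomial q 1 i * qbinomial q a j * q ^ ((1 - i) * j))
      (?F (pw i) (pw j) (pw (1 - i)) (pw (a - j)))"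
  have zero: "m v (act 0 t) = 0" for v
    by (rule linear_map_zero[of sH sR "\<lambda>h. m v (act h t)"]) (intro yd_linear_intros)
  have "m y (m (pw a) t) = (\<Sum>(x, h)\<leftarrow>m_xi_comult act \<rho> \<delta> m \<xi> (pw 1) (pw a). m x (act h t))"
    unfolding m_quasi_assoc[symmetric] by (simp add: m_oneR_right)
  also have "\<dots> = (\<Sum>((p1, p2), (p3, p4))\<leftarrow>comult_tensor act \<rho> \<delta> (pw 1) (pw a). ?F p1 p2 p3 p4)"
    by (rule m_xi_comult_sum)
  also have "\<dots> = (\<Sum>i\<le>1. \<Sum>j\<le>a. ?T i j)"
    by (rule comult_tensor_pw[OF coact_pw_upto]) (intro yd_linear_intros)
  also have "\<dots> = ?T 1 a"
  proof (rule sum_one_term)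
    fix i j :: nat assume ij: "i \<le> 1" "j \<le> a" "(i, j) \<noteq> (1, a)"
    then have "\<xi> (pw (1 - i)) (pw (a - j)) = 0" using assms by (intro xi_below) auto
    then show "?T i j = 0" by (simp only: zero V.scale_zero_right)
  qed auto
  also have "?T 1 a = m (pw (Suc a)) t" by (simp add: xi_one act_one m_oneR_right)
  finally show ?thesis .
qed

lemma m_pw: "m (pw a) (pw b) = pw (a + b)"
proof (cases "a < \<theta>")
  case True
  then show ?thesis
  proof (induction a)
    case 0
    then show ?case by (simp add: m_oneR_left)
  next
    case (Suc a)
    then have "m y (m (pw a) (pw b)) = m (pw (Suc a)) (pw b)" using m_y_m_pw[of a "pw b"] by simp
    then show ?case using Suc by simp
  qed
next
  case False
  then show ?thesis
    using pw_eq_0[of a] pw_eq_0[of "a + b"] m_bilinear linear_map_zero[of sR sR "\<lambda>r. m r (pw b)"]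
    by (simp add: bilinear_map_def)
qed

subsection \<open>The values in degree \<open>\<theta>\<close> agree\<close>

lemma m_xi_comult_pw_below:
  assumes ab: "a + b < \<theta>" and f: "bilinear_map sR sH sX f"
  shows "(\<Sum>(x, h)\<leftarrow>m_xi_comult act \<rho> \<delta> m \<xi> (pw a) (pw b). f x h) = f (pw (a + b)) 1"
proof -
  have X: "vector_space sX" by (rule bilinear_map_codomain[OF f])
  interpret X: vector_space sX by (rule X)
  note f_linear = linear_bilinear_left[OF f] linear_bilinear_right[OF f]
  have f0: "f x 0 = 0" for x using f linear_map_zero[of sH sX "f x"] by (simp add: bilinear_map_def)
  let ?T = "\<lambda>i j. sX (qbinomial q a i * qbinomial q b j * q ^ ((a - i) * j))
      (f (m (pw i) (pw j)) (\<xi> (pw (a - i)) (pw (b - j))))"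
  have "(\<Sum>(x, h)\<leftarrow>m_xi_comult act \<rho> \<delta> m \<xi> (pw a) (pw b). f x h) =
      (\<Sum>((p1, p2), (p3, p4))\<leftarrow>comult_tensor act \<rho> \<delta> (pw a) (pw b). f (m p1 p2) (\<xi> p3 p4))"
    by (rule m_xi_comult_sum)
  also have "\<dots> = (\<Sum>i\<le>a. \<Sum>j\<le>b. ?T i j)"
    by (rule comult_tensor_pw[OF coact_pw_upto]) (intro yd_linear_intros f_linear X)
  also have "\<dots> = ?T a b"
  proof (rule sum_one_term)
    fix i j :: nat assume ij: "i \<le> a" "j \<le> b" "(i, j) \<noteq> (a, b)"
    then have "\<xi> (pw (a - i)) (pw (b - j)) = 0" using ab by (intro xi_below) auto
    then show "?T i j = 0" by (simp add: f0)
  qed auto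
  also have "\<dots> = f (pw (a + b)) 1" by (simp add: xi_one m_pw)
  finally show ?thesis .
qed

text \<open>The cocycle identity at \<open>y\<^sup>a \<otimes> y\<^sup>b \<otimes> y\<^sup>c\<close>: as \<open>a\<close> and \<open>c\<close> are positive, both inner applications of
  \<open>\<xi>\<close> take place below degree \<open>\<theta>\<close>.\<close>

lemma xi_shift:
  assumes "a + b + c = \<theta>" "0 < a" "0 < c"
  shows "\<xi> (pw a) (pw (b + c)) = \<xi> (pw (a + b)) (pw c)"
proof -
  have "(\<Sum>(x, h)\<leftarrow>m_xi_comult act \<rho> \<delta> m \<xi> (pw b) (pw c). \<xi> (pw a) x * h) = \<xi> (pw a) (pw (b + c)) * 1"
    using assms by (intro m_xi_comult_pw_below[where sX = sH]) (simp, intro yd_linear_intros)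
  moreover have "(\<Sum>(x, h)\<leftarrow>m_xi_comult act \<rho> \<delta> m \<xi> (pw a) (pw b). \<Sum>(h1, h2)\<leftarrow>\<Delta> h. \<xi> x (act h1 (pw c)) * h2) =
      (\<Sum>(h1, h2)\<leftarrow>\<Delta> 1. \<xi> (pw (a + b)) (act h1 (pw c)) * h2)"
    using assms by (intro m_xi_comult_pw_below[where sX = sH]) (simp, intro yd_linear_intros)
  moreover have "\<dots> = \<xi> (pw (a + b)) (act 1 (pw c)) * 1"
    by (rule grouplike_sum[OF comult_one, where sX = sH]) (intro yd_linear_intros)
  ultimately show ?thesis using xi_cocycle[of "pw a" "pw b" "pw c"] by (simp add: act_one)
qed

definition top_value :: 'h where
  "top_value = \<xi> (pw 1) (pw (\<theta> - 1))"

lemma xi_pw: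
  "\<xi> (pw a) (pw b) = (if a + b = 0 then 1 else if a + b = \<theta> \<and> a \<noteq> 0 \<and> b \<noteq> 0 then top_value else 0)"
proof -
  consider "a + b = 0" | "0 < a + b" "a + b < \<theta>" | "a + b = \<theta>" "a \<noteq> 0" "b \<noteq> 0"
    | "a + b = \<theta>" "a = 0 \<or> b = 0" | "\<theta> < a + b"
    by linarith
  then show ?thesis
  proof cases
    case 1
    then show ?thesis by (simp add: xi_one)
  next
    case 2
    then show ?thesis using xi_below by simp
  next
    case 3
    then have "\<xi> (pw 1) (pw (a - 1 + b)) = \<xi> (pw (1 + (a - 1))) (pw b)" by (intro xi_shift) auto
    moreover have "a - 1 + b = \<theta> - 1" using 3 by simp
    ultimately show ?thesis using 3 by (simp add: top_value_def)
  next
    case 4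
    then show ?thesis using xi_oneR_pw[of \<theta>] theta_ge_2 by auto
  next
    case 5
    then have "a + b \<noteq> 0" "a + b \<noteq> \<theta>" by auto
    then show ?thesis using xi_above[OF 5] by (simp del: add_is_0 add_eq_0_iff_both_eq_0)
  qed
qed

lemma top_value_eq: "top_value = sH (\<gamma> top_value) (1 - g ^ \<theta>)"
  using xi_theta_eq[of 1 "\<theta> - 1"] theta_ge_2 by (simp add: top_value_def)

lemma top_value_ad:
  "sH (convolution_power \<Delta> \<epsilon> \<chi> \<theta> h) top_value = (\<Sum>(h1, h2)\<leftarrow>\<Delta> h. h1 * top_value * S h2)"
proof -
  obtain n where n: "\<theta> = Suc n" using theta_ge_2 by (cases \<theta>) auto
  have n1: "\<theta> - 1 = n" using n by simp
  have top: "top_value = \<xi> (pw 1) (pw n)" by (simp only: top_value_def n1)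
  have one: "convolution_power \<Delta> \<epsilon> \<chi> 1 x = \<chi> x" for x
  proof -
    have *: "\<chi> (\<Sum>(a, b)\<leftarrow>xs. sH (\<epsilon> b) a) = (\<Sum>(a, b)\<leftarrow>xs. \<chi> a * \<epsilon> b)" for xs
      using chi_linear linear_map_zero[OF chi_linear]
      by (induction xs) (auto simp: Vector_Spaces.linear_iff mult.commute)
    show ?thesis using *[of "\<Delta> x"] by (simp add: counit_right)
  qed
  have "convolution_power \<Delta> \<epsilon> \<chi> \<theta> h =
      (\<Sum>(h1, h2)\<leftarrow>\<Delta> h. convolution_power \<Delta> \<epsilon> \<chi> 1 h1 * convolution_power \<Delta> \<epsilon> \<chi> n h2)"
    by (simp only: n convolution_power.simps(2) one)
  then show ?thesis using xi_act_pw[of 1 n h] by (simp only: top)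
qed

text \<open>Apply \<open>\<gamma>\<close> to \<open>top_value_ad\<close>. If \<open>\<gamma>\<close> vanished on \<open>top_value\<close>, then so would \<open>top_value\<close> itself, by
  \<open>top_value_eq\<close>.\<close>

lemma top_value_ad_trivial:
  assumes "top_value \<noteq> 0"
  shows "convolution_power \<Delta> \<epsilon> \<chi> \<theta> = \<epsilon>"
proof
  fix h
  have "\<gamma> top_value \<noteq> 0" using assms top_value_eq by auto
  moreover have "\<gamma> (\<Sum>(a, b)\<leftarrow>xs. a * top_value * S b) = (\<Sum>(a, b)\<leftarrow>xs. \<gamma> (a * top_value * S b))" for xs
    using gamma_linear linear_map_zero[OF gamma_linear]
    by (induction xs) (auto simp: Vector_Spaces.linear_iff)
  then have "convolution_power \<Delta> \<epsilon> \<chi> \<theta> h * \<gamma> top_value = \<epsilon> h * \<gamma> top_value"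
    using arg_cong[OF top_value_ad[of h], of \<gamma>] gamma_ad[of top_value h] gamma_linear
    by (simp add: Vector_Spaces.linear_iff)
  ultimately show "convolution_power \<Delta> \<epsilon> \<chi> \<theta> h = \<epsilon> h" by simp
qed

text \<open>Insert \<open>S(h\<^sub>2) h\<^sub>3\<close> on the right: \<open>h z = h\<^sub>1 z S(h\<^sub>2) h\<^sub>3 = z h\<close>.\<close>

lemma ad_trivial_central:
  assumes "\<And>h. (\<Sum>(h1, h2)\<leftarrow>\<Delta> h. h1 * z * S h2) = sH (\<epsilon> h) z"
  shows "h * z = z * h"
proof -
  have tri: "trilinear_map sH sH sH sH (\<lambda>a b c. a * z * S b * c)"
    by (intro yd_linear_intros)
  have mult_sum: "(\<Sum>(a, b)\<leftarrow>xs. f a b) * c = (\<Sum>(a, b)\<leftarrow>xs. f a b * c)"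
    "c * (\<Sum>(a, b)\<leftarrow>xs. f a b) = (\<Sum>(a, b)\<leftarrow>xs. c * f a b)"
    for xs :: "('h \<times> 'h) list" and f and c :: 'h
    by (induction xs) (auto simp: algebra_simps)
  have "h * z = (\<Sum>(a, b)\<leftarrow>\<Delta> h. sH (\<epsilon> b) a) * z" by (simp add: counit_right)
  also have "\<dots> = (\<Sum>(a, b)\<leftarrow>\<Delta> h. a * z * (\<Sum>(b1, b2)\<leftarrow>\<Delta> b. S b1 * b2))"
    by (simp add: mult_sum(1) antipode_left scale_mult_left scale_mult_right)
  also have "\<dots> = (\<Sum>(a, b)\<leftarrow>\<Delta> h. \<Sum>(b1, b2)\<leftarrow>\<Delta> b. a * z * S b1 * b2)"
    by (simp add: mult_sum(2) mult.assoc)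
  also have "\<dots> = (\<Sum>(a, b)\<leftarrow>\<Delta> h. \<Sum>(a1, a2)\<leftarrow>\<Delta> a. a1 * z * S a2 * b)"
    using tensor3_eq_sum_eq[OF tri coassoc, of h]
    by (simp add: map_concat comp_def case_prod_unfold sum_list_concat)
  also have "\<dots> = (\<Sum>(a, b)\<leftarrow>\<Delta> h. (\<Sum>(a1, a2)\<leftarrow>\<Delta> a. a1 * z * S a2) * b)"
    by (simp add: mult_sum(1))
  also have "\<dots> = z * (\<Sum>(a, b)\<leftarrow>\<Delta> h. sH (\<epsilon> a) b)"
    by (simp add: assms mult_sum(2) scale_mult_left scale_mult_right)
  also have "\<dots> = z * h" by (simp add: counit_left)
  finally show ?thesis .
qed

lemma top_value_central:
  assumes "top_value \<noteq> 0"
  shows "g ^ \<theta> \<in> center - {1}"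
proof -
  have \<gamma>: "\<gamma> top_value \<noteq> 0" "g ^ \<theta> \<noteq> 1" using assms top_value_eq by auto
  define c where "c = \<gamma> top_value"
  have eq: "top_value = sH c (1 - g ^ \<theta>)" unfolding c_def by (rule top_value_eq)
  have "h * top_value = top_value * h" for h
    by (rule ad_trivial_central) (simp add: top_value_ad[symmetric] top_value_ad_trivial[OF assms])
  then have "sH c (h * (1 - g ^ \<theta>)) = sH c ((1 - g ^ \<theta>) * h)" for h
    unfolding eq by (simp add: scale_mult_left scale_mult_right)
  then have "h * (1 - g ^ \<theta>) = (1 - g ^ \<theta>) * h" for h
    using \<gamma>(1) by (simp add: c_def[symmetric])
  then have "g ^ \<theta> * h = h * g ^ \<theta>" for h by (simp add: left_diff_distrib right_diff_distrib)
  then show ?thesis using \<gamma>(2) by (simp add: center_def)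
qed

end

section \<open>The order of \<open>q\<close> is the dimension\<close>

context yd_line_cocycle
begin

lemma y_notin_span_oneR: "y \<notin> module.span sR {oneR}"
proof
  assume "y \<in> V.span {oneR}"
  then obtain c where c: "y = sR c oneR" by (auto simp: V.span_singleton)
  then have "\<epsilon>R y = c" using R.counit_linear counit_oneR by (simp add: Vector_Spaces.linear_iff)
  then show False using counit_pw[of 1] c y_nonzero by (simp add: m_oneR_right)
qed

text \<open>Averaging over the powers of \<open>g\<close> projects onto the part of weight \<open>q\<close>.\<close>

lemma dual_of_y_exists:
  assumes "(of_nat \<theta> :: 'k) \<noteq> 0"
  obtains t where "Vector_Spaces.linear sR (*) t" "\<And>i. i < \<theta> \<Longrightarrow> t (pw i) = (if i = 1 then 1 else 0)"
proof -
  obtain s where s: "Vector_Spaces.linear sR (*) s" "s y = 1" "s oneR = 0"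
    using separating_functional[OF vs_R y_notin_span_oneR] by blast
  let ?t = "\<lambda>r. inverse (of_nat \<theta>) * (\<Sum>k<\<theta>. inverse q ^ k * s (act (g ^ k) r))"
  have q0: "q \<noteq> 0" and q1: "q ^ \<theta> = 1" and qk: "\<And>k. 0 < k \<Longrightarrow> k < \<theta> \<Longrightarrow> q ^ k \<noteq> 1"
    using q_root theta_ge_2 by (auto simp: primitive_root_of_unity_def power_0_left)
  have "Vector_Spaces.linear sR (*) ?t"
    by (intro yd_linear_intros linear_app[OF s(1)])
  moreover have "?t (pw i) = (if i = 1 then 1 else 0)" if i: "i < \<theta>" for i
  proof -
    let ?x = "inverse q * q ^ i"
    have "inverse q ^ k * s (act (g ^ k) (pw i)) = ?x ^ k * s (pw i)" for k
      using s(1) by (simp add: act_g_power Vector_Spaces.linear_iff power_mult_distrib mult.commute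
          flip: power_mult)
    then have t: "?t (pw i) = inverse (of_nat \<theta>) * ((\<Sum>k<\<theta>. ?x ^ k) * s (pw i))"
      by (simp add: sum_distrib_right)
    show ?thesis
    proof (cases "i = 1")
      case True
      then show ?thesis using t s(2) q0 assms by (simp add: m_oneR_right)
    next
      case False
      have "?x \<noteq> 1"
      proof
        assume "?x = 1"
        then have "q ^ i = q" using q0 by (simp add: field_simps)
        then show False
          using False qk[of "i - 1"] i q0 qk[of 1] theta_ge_2
          by (cases i) auto
      qed
      moreover have "?x ^ \<theta> = 1"
        using q1 by (simp add: power_mult_distrib power_inverse flip: power_mult)
          (simp add: power_mult mult.commute[of i])
      ultimately have "(\<Sum>k<\<theta>. ?x ^ k) = 0" by (simp add: geometric_sum)
      then show ?thesis using t False by simp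
    qed
  qed
  ultimately show ?thesis by (rule that)
qed

end

locale thin_line_cocycle =
  yd_line_cocycle sH \<Delta> \<epsilon> S sR act \<rho> \<delta> \<epsilon>R m oneR \<xi> y g \<chi> \<theta> \<gamma> + T: thin_coalgebra sR \<delta> \<epsilon>R oneR N y t
  for sH :: "'k::field_char_0 \<Rightarrow> 'h::ring_1 \<Rightarrow> 'h"
    and \<Delta> :: "'h \<Rightarrow> ('h \<times> 'h) list"
    and \<epsilon> :: "'h \<Rightarrow> 'k"
    and S :: "'h \<Rightarrow> 'h"
    and sR :: "'k \<Rightarrow> 'r::ab_group_add \<Rightarrow> 'r"
    and act :: "'h \<Rightarrow> 'r \<Rightarrow> 'r"
    and \<rho> :: "'r \<Rightarrow> ('h \<times> 'r) list"
    and \<delta> :: "'r \<Rightarrow> ('r \<times> 'r) list"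
    and \<epsilon>R :: "'r \<Rightarrow> 'k"
    and m :: "'r \<Rightarrow> 'r \<Rightarrow> 'r"
    and oneR :: "'r"
    and \<xi> :: "'r \<Rightarrow> 'r \<Rightarrow> 'h"
    and y g \<chi> \<theta> \<gamma> N t +
  assumes t_pw: "\<And>i. i < \<theta> \<Longrightarrow> t (pw i) = (if i = 1 then 1 else 0)"
begin

lemmas t_linear_intros = yd_linear_intros linear_app[OF T.t_linear]

definition qnum :: "nat \<Rightarrow> 'k" where
  "qnum n = qbinomial q n (n - 1)"

lemma qnum_nonzero: "0 < n \<Longrightarrow> n < \<theta> \<Longrightarrow> qnum n \<noteq> 0"
  using qbinomial_pred_neq_0[OF q_root] by (simp add: qnum_def)

lemma contract_right_pw:
  assumes "Vector_Spaces.linear sR (*) f"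
  shows "T.contract_right f (pw n) = (\<Sum>i\<le>n. sR (qbinomial q n i * f (pw (n - i))) (pw i))"
  unfolding T.contract_right_def comult_pw_sum[OF T.bilinear_functional_scale(1)[OF assms]] by simp

text \<open>Here the choice \<open>t(y\<^sup>i) = 0\<close> for \<open>1 < i < \<theta>\<close> leaves a single term of \<open>\<delta>(y\<^sup>n\<^sup>+\<^sup>1)\<close>.\<close>

lemma shift_pw:
  assumes "Suc n < \<theta>"
  shows "T.shift (pw (Suc n)) = sR (qnum (Suc n)) (pw n)"
proof -
  have "T.shift (pw (Suc n)) = (\<Sum>i\<le>Suc n. sR (qbinomial q (Suc n) i * t (pw (Suc n - i))) (pw i))"
    by (rule contract_right_pw[OF T.t_linear])
  also have "\<dots> = (\<Sum>i\<in>{n}. sR (qbinomial q (Suc n) i * t (pw (Suc n - i))) (pw i))"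
    using assms by (intro sum.mono_neutral_right) (auto simp: t_pw simp del: mpower.simps)
  also have "\<dots> = sR (qnum (Suc n)) (pw n)" using T.t_y by (simp add: qnum_def m_oneR_right)
  finally show ?thesis .
qed

lemma shift_power_pw:
  "k < \<theta> \<Longrightarrow> \<exists>c. c \<noteq> 0 \<and> (T.shift ^^ k) (pw k) = sR c oneR"
proof (induction k)
  case 0
  then show ?case by (intro exI[of _ 1]) simp
next
  case (Suc k)
  then obtain c where c: "c \<noteq> 0" "(T.shift ^^ k) (pw k) = sR c oneR" by auto
  have "(T.shift ^^ Suc k) (pw (Suc k)) = (T.shift ^^ k) (sR (qnum (Suc k)) (pw k))"
    using shift_pw[OF Suc.prems] by (simp only: T.shift_power_Suc)
  also have "\<dots> = sR (qnum (Suc k) * c) oneR"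
    using T.linear_shift_power[of k] c by (simp add: Vector_Spaces.linear_iff)
  finally show ?case using c(1) qnum_nonzero[OF _ Suc.prems] by (intro exI[of _ "qnum (Suc k) * c"]) simp
qed

lemma pw_layer: "k < \<theta> \<Longrightarrow> pw k \<in> T.layer (Suc k)"
proof (induction k)
  case 0
  then show ?case using T.layer_1 counit_oneR by simp
next
  case (Suc k)
  then show ?case using shift_pw[OF Suc.prems]
    by (simp add: T.layer_Suc[of _ "Suc k"] V.subspace_scale T.subspace_layer del: mpower.simps)
qed

lemma layer_span: "x \<in> T.layer k \<Longrightarrow> k \<le> \<theta> \<Longrightarrow> x \<in> V.span (pw ` {..<k})"
proof (induction k arbitrary: x)
  case 0
  then show ?case by simp
next
  case (Suc k)
  obtain c where c: "c \<noteq> 0" "(T.shift ^^ k) (pw k) = sR c oneR"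
    using shift_power_pw[of k] Suc.prems(2) by auto
  interpret k: Vector_Spaces.linear sR sR "T.shift ^^ k" by (rule T.linear_shift_power)
  have "T.shift ((T.shift ^^ k) x) = 0" using Suc.prems(1) by (simp add: T.layer_def)
  then obtain a where a: "(T.shift ^^ k) x = sR a oneR" using T.shift_eq_0_iff by blast
  have "x - sR (a / c) (pw k) \<in> T.layer k"
    using a c by (simp add: T.layer_def k.diff k.scale)
  then have "x - sR (a / c) (pw k) \<in> V.span (pw ` {..<k})" using Suc by simp
  then have "x - sR (a / c) (pw k) \<in> V.span (pw ` {..<Suc k})"
    using V.span_mono[OF image_mono[of "{..<k}" "{..<Suc k}" pw]] by auto
  moreover have "sR (a / c) (pw k) \<in> V.span (pw ` {..<Suc k})" by (intro V.span_scale V.span_base) simp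
  ultimately show ?case using V.span_add by fastforce
qed

subsection \<open>Action and multiplication on the coradical filtration\<close>

lemma contract_right_kill:
  assumes "Vector_Spaces.linear sR (*) f" "f oneR = 0" "x \<in> T.layer (Suc k)"
  shows "T.contract_right f x \<in> T.layer k"
proof -
  have "f z = 0" if "z \<in> T.layer 1" for z
  proof -
    have "f z = f (sR (\<epsilon>R z) oneR)" using that T.layer_1 by metis
    then show ?thesis using assms(1,2) by (simp add: Vector_Spaces.linear_iff)
  qed
  then show ?thesis using T.contract_right_lowers[OF assms(1) _ assms(3), of 1] by simp
qed

lemma layer_sum_list:
  assumes "\<And>a b. f a b \<in> T.layer k"
  shows "(\<Sum>(a, b)\<leftarrow>xs. f a b) \<in> T.layer k"
  using assms V.subspace_0[OF T.subspace_layer] V.subspace_add[OF T.subspace_layer]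
  by (induction xs) auto

lemma contract_right_act:
  assumes f: "Vector_Spaces.linear sR (*) f"
  shows "T.contract_right f (act h x) =
    (\<Sum>(h1, h2)\<leftarrow>\<Delta> h. act h1 (T.contract_right (\<lambda>s. f (act h2 s)) x))"
proof -
  have bil: "bilinear_map sR sR sR (\<lambda>a b. sR (f b) a)" by (rule T.bilinear_functional_scale(1)[OF f])
  have lin: "Vector_Spaces.linear sR sR (act h)" for h using act_bilinear by (simp add: bilinear_map_def)
  have "T.contract_right f (act h x) =
      (\<Sum>(a, b)\<leftarrow>[(act h1 r1, act h2 r2). (h1, h2) \<leftarrow> \<Delta> h, (r1, r2) \<leftarrow> \<delta> x]. sR (f b) a)"
    unfolding T.contract_right_def by (rule tensor_eq_sum_eq[OF bil comult_act])
  also have "\<dots> = (\<Sum>(h1, h2)\<leftarrow>\<Delta> h. \<Sum>(r1, r2)\<leftarrow>\<delta> x. sR (f (act h2 r2)) (act h1 r1))"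
    by (simp add: map_concat comp_def case_prod_unfold sum_list_concat)
  also have "\<dots> = (\<Sum>(h1, h2)\<leftarrow>\<Delta> h. act h1 (T.contract_right (\<lambda>s. f (act h2 s)) x))"
    unfolding T.contract_right_def linear_sum_list_map[OF lin]
    using lin by (simp add: Vector_Spaces.linear_iff)
  finally show ?thesis .
qed

lemma t_act_linear: "Vector_Spaces.linear sR (*) (\<lambda>s. t (act h s))"
  by (intro t_linear_intros)

lemma t_act_oneR: "t (act h oneR) = 0"
  using T.t_linear T.t_e by (simp add: act_oneR Vector_Spaces.linear_iff)

text \<open>Every \<open>t(h _)\<close> vanishes at \<open>1\<close>, so \<open>shift (h x)\<close> is a sum of elements \<open>h\<^sub>1 z\<close> with \<open>z\<close> one layer
  below \<open>x\<close>.\<close>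

lemma act_layer: "x \<in> T.layer k \<Longrightarrow> act h x \<in> T.layer k"
proof (induction k arbitrary: h x)
  case 0
  then show ?case using act_bilinear linear_map_zero[of sR sR "act h"] by (simp add: bilinear_map_def)
next
  case (Suc k)
  have "T.shift (act h x) \<in> T.layer k"
    unfolding contract_right_act[OF T.t_linear]
    by (intro layer_sum_list Suc.IH contract_right_kill t_act_linear t_act_oneR Suc.prems)
  then show ?case by (simp add: T.layer_Suc)
qed

text \<open>The functionals \<open>t(g _)\<close> and \<open>q t\<close> agree at \<open>1\<close> and at \<open>y\<close>. So \<open>shift g\<close> equals \<open>q g shift\<close> up to
  a term that lowers by two layers, and \<open>g\<close> acts on the \<open>k\<close>-th quotient as \<open>q\<^sup>k\<close>.\<close>

lemma act_g_layer: "x \<in> T.layer (Suc k) \<Longrightarrow> act g x - sR (q ^ k) x \<in> T.layer k"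
proof (induction k arbitrary: x)
  case 0
  then have "x = sR (\<epsilon>R x) oneR" using T.layer_1 by simp
  then have "act g x = x"
    using act_bilinear act_oneR[of g] counit_g
    by (metis V.scale_one bilinear_map_def Vector_Spaces.linear_iff)
  then show ?case by simp
next
  case (Suc k)
  let ?f = "\<lambda>s. t (act g s)"
  obtain f' where f': "Vector_Spaces.linear sR (*) f'"
    "\<And>x. T.contract_right ?f x = sR (?f oneR) x + T.contract_right f' (T.shift x)"
    using T.functional_decompose[OF t_act_linear[of g]] by blast
  have ff': "?f x = f' (T.shift x)" for x
  proof -
    have "?f x = \<epsilon>R (T.contract_right ?f x)" using T.counit_contract(1)[OF t_act_linear] by simp
    also have "\<dots> = f' (T.shift x)" using f' T.counit_contract(1)[OF f'(1)] by (simp add: t_act_oneR)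
    finally show ?thesis .
  qed
  have "f' oneR = q"
    using ff'[of y] T.shift_y T.t_y T.t_linear by (simp add: act_y Vector_Spaces.linear_iff)
  then obtain f'' where f'': "Vector_Spaces.linear sR (*) f''"
    "\<And>x. T.contract_right f' x = sR q x + T.contract_right f'' (T.shift x)"
    using T.functional_decompose[OF f'(1)] by metis
  have bil: "bilinear_map sH sH sR (\<lambda>h1 h2. act h1 (T.contract_right (\<lambda>s. t (act h2 s)) x))"
    unfolding T.contract_right_def by (intro t_linear_intros)
  have "T.shift (act g x) = act g (T.contract_right ?f x)"
    unfolding contract_right_act[OF T.t_linear] by (rule grouplike_sum[OF comult_g bil])
  also have "\<dots> = act g (sR q (T.shift x) + T.contract_right f'' (T.shift (T.shift x)))"
    by (simp add: f'(2) f''(2) t_act_oneR)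
  also have "\<dots> = sR q (act g (T.shift x)) + act g (T.contract_right f'' (T.shift (T.shift x)))"
    using act_bilinear by (simp add: bilinear_map_def Vector_Spaces.linear_iff)
  finally have "T.shift (act g x - sR (q ^ Suc k) x) =
      sR q (act g (T.shift x) - sR (q ^ k) (T.shift x)) + act g (T.contract_right f'' (T.shift (T.shift x)))"
    by (simp add: T.shift.diff T.shift.scale V.scale_right_diff_distrib)
  moreover have "T.shift x \<in> T.layer (Suc k)" using Suc.prems by (simp add: T.layer_Suc)
  moreover have "T.shift (T.shift x) \<in> T.layer k" using Suc.prems by (simp add: T.layer_Suc)
  ultimately have "T.shift (act g x - sR (q ^ Suc k) x) \<in> T.layer k"
    using Suc.IH T.contract_right_layer[OF f''(1)] act_layer
    by (simp add: V.subspace_add V.subspace_scale T.subspace_layer)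
  then show ?case by (simp add: T.layer_Suc)
qed

lemma act_g_power_layer:
  assumes x: "x \<in> T.layer (Suc k)"
  shows "act (g ^ j) x - sR (q ^ (j * k)) x \<in> T.layer k"
proof (induction j)
  case 0
  then show ?case using V.subspace_0[OF T.subspace_layer] by (simp add: act_one)
next
  case (Suc j)
  have lin: "act g (a - b) = act g a - act g b" "act g (sR c a) = sR c (act g a)" for a b c
    using act_bilinear module_hom.diff[of sR sR "act g"]
    by (simp_all add: bilinear_map_def linear_iff_module_hom[symmetric] Vector_Spaces.linear_iff)
  have "act (g ^ Suc j) x - sR (q ^ (Suc j * k)) x =
      act g (act (g ^ j) x - sR (q ^ (j * k)) x) + sR (q ^ (j * k)) (act g x - sR (q ^ k) x)"
    by (simp add: act_mult lin V.scale_right_diff_distrib power_add mult.commute)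
  then show ?case
    using act_layer[OF Suc] act_g_layer[OF x] by (simp add: V.subspace_add V.subspace_scale T.subspace_layer)
qed

lemma act_g_theta_layer: "x \<in> T.layer (Suc k) \<Longrightarrow> act (g ^ \<theta>) x - x \<in> T.layer k"
  using act_g_power_layer[of x k \<theta>] q_root by (simp add: power_mult primitive_root_of_unity_def)

lemma contract_right_m:
  assumes f: "Vector_Spaces.linear sR (*) f"
  shows "T.contract_right f (m r s) =
    (\<Sum>(r1, r2)\<leftarrow>\<delta> r. \<Sum>(u, r0)\<leftarrow>\<rho> r2. m r1 (act u (T.contract_right (\<lambda>s. f (m r0 s)) s)))"
proof -
  have bil: "bilinear_map sR sR sR (\<lambda>a b. sR (f b) a)" by (rule T.bilinear_functional_scale(1)[OF f])
  have lin: "Vector_Spaces.linear sR sR (\<lambda>x. m r (act h x))" for r h by (intro t_linear_intros)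
  have "T.contract_right f (m r s) =
      (\<Sum>(a, b)\<leftarrow>[(m p1 p2, m p3 p4). ((p1, p2), (p3, p4)) \<leftarrow> comult_tensor act \<rho> \<delta> r s]. sR (f b) a)"
    unfolding T.contract_right_def by (rule tensor_eq_sum_eq[OF bil comult_m])
  also have "\<dots> = (\<Sum>((p1, p2), (p3, p4))\<leftarrow>comult_tensor act \<rho> \<delta> r s. sR (f (m p3 p4)) (m p1 p2))"
    by (simp add: map_concat comp_def case_prod_unfold sum_list_concat)
  also have "\<dots> = (\<Sum>(r1, r2)\<leftarrow>\<delta> r. \<Sum>(u, r0)\<leftarrow>\<rho> r2. \<Sum>(s1, s2)\<leftarrow>\<delta> s. sR (f (m r0 s2)) (m r1 (act u s1)))"
    by (rule comult_tensor_sum)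
  also have "\<dots> = (\<Sum>(r1, r2)\<leftarrow>\<delta> r. \<Sum>(u, r0)\<leftarrow>\<rho> r2. m r1 (act u (T.contract_right (\<lambda>s. f (m r0 s)) s)))"
    unfolding T.contract_right_def linear_sum_list_map[OF lin]
    using lin by (simp add: Vector_Spaces.linear_iff)
  finally show ?thesis .
qed

text \<open>As \<open>y\<close> is primitive, \<open>shift (y x)\<close> is the sum of \<open>y (shift x)\<close> and of an element of the layer of \<open>x\<close>.\<close>

lemma m_y_layer: "x \<in> T.layer k \<Longrightarrow> m y x \<in> T.layer (Suc k)"
proof (induction k arbitrary: x)
  case 0
  then have "m y x = 0" using m_bilinear linear_map_zero[of sR sR "m y"] by (simp add: bilinear_map_def)
  then show ?case using V.subspace_0[OF T.subspace_layer] by simp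
next
  case (Suc k)
  let ?F = "\<lambda>r1 r2. \<Sum>(u, r0)\<leftarrow>\<rho> r2. m r1 (act u (T.contract_right (\<lambda>s. t (m r0 s)) x))"
  have f: "Vector_Spaces.linear sR (*) (\<lambda>s. t (m r s))" for r by (intro t_linear_intros)
  have "T.shift (m y x) = ?F y oneR + ?F oneR y"
    unfolding contract_right_m[OF T.t_linear]
    by (rule comult_y_sum[where sX = sR], unfold T.contract_right_def) (intro t_linear_intros)
  also have "?F y oneR = m y (act 1 (T.contract_right (\<lambda>s. t (m oneR s)) x))"
    by (rule coact_oneR_sum[where sX = sR], unfold T.contract_right_def) (intro t_linear_intros)
  also have "\<dots> = m y (T.shift x)" by (simp add: act_one m_oneR_left)
  also have "?F oneR y = m oneR (act g (T.contract_right (\<lambda>s. t (m y s)) x))"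
    by (rule coact_y_sum[where sX = sR], unfold T.contract_right_def) (intro t_linear_intros)
  finally have "T.shift (m y x) = m y (T.shift x) + act g (T.contract_right (\<lambda>s. t (m y s)) x)"
    by (simp add: m_oneR_left)
  moreover have "m y (T.shift x) \<in> T.layer (Suc k)" using Suc by (simp add: T.layer_Suc)
  moreover have "act g (T.contract_right (\<lambda>s. t (m y s)) x) \<in> T.layer (Suc k)"
    by (intro act_layer T.contract_right_layer f Suc.prems)
  ultimately have "T.shift (m y x) \<in> T.layer (Suc k)" by (simp add: V.subspace_add T.subspace_layer)
  then show ?case by (simp add: T.layer_Suc[of _ "Suc k"])
qed

lemma m_pw_layer: "i < \<theta> \<Longrightarrow> x \<in> T.layer k \<Longrightarrow> m (pw i) x \<in> T.layer (i + k)"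
proof (induction i)
  case 0
  then show ?case by (simp add: m_oneR_left)
next
  case (Suc i)
  then have "m (pw (Suc i)) x = m y (m (pw i) x)" using m_y_m_pw[of i x] by simp
  then show ?case using Suc m_y_layer by simp
qed

subsection \<open>The comparison of dimensions\<close>

context
  fixes d :: 'r
  assumes shift_d: "T.shift d = pw (\<theta> - 1)" and counit_d: "\<epsilon>R d = 0"
begin

definition coef :: "nat \<Rightarrow> 'k" where
  "coef i = qbinomial q (\<theta> - 1) i / qnum (\<theta> - i)"

text \<open>Since \<open>(id \<otimes> shift) \<delta>(d) = \<delta>(shift d) = \<delta>(y\<^sup>\<theta>\<^sup>-\<^sup>1)\<close> is known and the kernel of \<open>shift\<close> is \<open>K 1\<close>,
  \<open>\<delta>(d)\<close> is determined up to a term \<open>x \<otimes> 1\<close>, which the counit fixes.\<close>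

lemma comult_d:
  "tensor_eq sR sR (\<delta> d) ((d, oneR) # (oneR, d) # map (\<lambda>i. (sR (coef i) (pw i), pw (\<theta> - i))) [1..<\<theta>])"
proof (rule T.tensor_eq_contract_rightI)
  fix f assume f: "Vector_Spaces.linear sR (*) f"
  obtain f' where f': "Vector_Spaces.linear sR (*) f'"
    "\<And>x. T.contract_right f x = sR (f oneR) x + T.contract_right f' (T.shift x)"
    using T.functional_decompose[OF f] by blast
  have ff': "f x = f oneR * \<epsilon>R x + f' (T.shift x)" for x
  proof -
    have "f x = \<epsilon>R (T.contract_right f x)" using T.counit_contract(1)[OF f] by simp
    also have "\<dots> = f oneR * \<epsilon>R x + f' (T.shift x)"
      using f' T.counit_contract(1)[OF f'(1)] R.counit_linear by (simp add: Vector_Spaces.linear_iff)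
    finally show ?thesis .
  qed
  have top: "f' (pw (\<theta> - 1)) = f d" using ff'[of d] shift_d counit_d by simp
  have low: "f' (pw (\<theta> - 1 - i)) = f (pw (\<theta> - i)) / qnum (\<theta> - i)" if i: "1 \<le> i" "i < \<theta>" for i
  proof -
    have s: "\<theta> - i = Suc (\<theta> - 1 - i)" using i by simp
    have "f (pw (\<theta> - i)) = f' (T.shift (pw (\<theta> - i)))"
      using ff'[of "pw (\<theta> - i)"] counit_pw[of "\<theta> - i"] i by simp
    also have "\<dots> = qnum (\<theta> - i) * f' (pw (\<theta> - 1 - i))"
      using shift_pw[of "\<theta> - 1 - i"] i f'(1) s by (simp add: Vector_Spaces.linear_iff)
    finally show ?thesis using qnum_nonzero[of "\<theta> - i"] i by simp
  qed
  have set: "{..\<theta> - 1} = insert 0 {1..<\<theta>}" using theta_ge_2 by auto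
  have "T.contract_right f d = sR (f oneR) d + T.contract_right f' (pw (\<theta> - 1))"
    by (simp add: f'(2) shift_d)
  also have "T.contract_right f' (pw (\<theta> - 1)) =
      (\<Sum>i\<le>\<theta> - 1. sR (qbinomial q (\<theta> - 1) i * f' (pw (\<theta> - 1 - i))) (pw i))"
    by (rule contract_right_pw[OF f'(1)])
  also have "\<dots> = sR (f d) oneR + (\<Sum>i\<in>{1..<\<theta>}. sR (qbinomial q (\<theta> - 1) i * f' (pw (\<theta> - 1 - i))) (pw i))"
    unfolding set using top by simp
  also have "(\<Sum>i\<in>{1..<\<theta>}. sR (qbinomial q (\<theta> - 1) i * f' (pw (\<theta> - 1 - i))) (pw i)) =
      (\<Sum>i\<in>{1..<\<theta>}. sR (f (pw (\<theta> - i))) (sR (coef i) (pw i)))"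
  proof (intro sum.cong refl)
    fix i assume "i \<in> {1..<\<theta>}"
    then show "sR (qbinomial q (\<theta> - 1) i * f' (pw (\<theta> - 1 - i))) (pw i) = sR (f (pw (\<theta> - i))) (sR (coef i) (pw i))"
      using low[of i] by (simp add: coef_def)
  qed
  also have "\<dots> = (\<Sum>i\<leftarrow>[1..<\<theta>]. sR (f (pw (\<theta> - i))) (sR (coef i) (pw i)))"
    by (simp add: interv_sum_list_conv_sum_set_nat)
  finally show "(\<Sum>(a, b)\<leftarrow>\<delta> d. sR (f b) a) =
      (\<Sum>(a, b)\<leftarrow>(d, oneR) # (oneR, d) # map (\<lambda>i. (sR (coef i) (pw i), pw (\<theta> - i))) [1..<\<theta>]. sR (f b) a)"
    by (simp add: T.contract_right_def comp_def)
qed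

lemma comult_d_sum:
  assumes "bilinear_map sR sR sX f"
  shows "(\<Sum>(a, b)\<leftarrow>\<delta> d. f a b) =
    f d oneR + (f oneR d + (\<Sum>i\<in>{1..<\<theta>}. sX (coef i) (f (pw i) (pw (\<theta> - i)))))"
proof -
  have "f (sR c a) b = sX c (f a b)" for a b c
    using assms by (simp add: bilinear_map_def Vector_Spaces.linear_iff)
  then show ?thesis
    using tensor_eq_sum_eq[OF assms comult_d] by (simp add: comp_def interv_sum_list_conv_sum_set_nat)
qed

lemma dual_of_d_exists:
  obtains F where "Vector_Spaces.linear sR (*) F" "\<And>i. i < \<theta> - 1 \<Longrightarrow> F (pw i) = 0" "F (pw (\<theta> - 1)) = 1"
proof -
  obtain c where c: "c \<noteq> 0" "(T.shift ^^ (\<theta> - 1)) (pw (\<theta> - 1)) = sR c oneR"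
    using shift_power_pw[of "\<theta> - 1"] theta_ge_2 by auto
  let ?F = "\<lambda>x. inverse c * T.coord (\<theta> - 1) x"
  have "Vector_Spaces.linear sR (*) ?F" by (intro linear_fun_scale T.functional_coord)
  moreover have "?F (pw i) = 0" if "i < \<theta> - 1" for i
    using pw_layer[of i] T.layer_mono[of "Suc i" "\<theta> - 1" "pw i"] that by (simp add: T.coord_layer)
  moreover have "?F (pw (\<theta> - 1)) = 1"
    using c R.counit_linear counit_oneR by (simp add: T.coord_def Vector_Spaces.linear_iff)
  ultimately show ?thesis by (rule that)
qed

text \<open>Write \<open>D(x) = F(shift x)\<close>, so that \<open>D\<close> vanishes on the powers of \<open>y\<close> and \<open>D(d) = 1\<close>, and let \<open>A\<close> be the
  right action of \<open>D\<close>. The three kinds of terms of \<open>\<delta>(d)\<close> contribute to \<open>A(d x)\<close> as follows. The term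
  \<open>d \<otimes> 1\<close> gives \<open>d A(x)\<close>. The term \<open>1 \<otimes> d\<close> gives \<open>g\<^sup>\<theta> x\<close> up to lower layers, and \<open>g\<^sup>\<theta>\<close> acts as the
  identity up to lower layers because \<open>q\<^sup>\<theta> = 1\<close>. The term \<open>y\<^sup>i \<otimes> y\<^sup>\<theta>\<^sup>-\<^sup>i\<close> raises the layer by \<open>i\<close> and
  lowers it by at least \<open>i + 1\<close>, because \<open>D(y\<^sup>\<theta>\<^sup>-\<^sup>i y\<^sup>l) = 0\<close> for \<open>l \<le> i\<close>. So \<open>A\<close> and the multiplication
  by \<open>d\<close> satisfy the commutation relation excluded by \<open>no_canonical_commutation\<close>.\<close>

lemma no_vector_above_pw: False
proof -
  obtain F where F: "Vector_Spaces.linear sR (*) F" "\<And>i. i < \<theta> - 1 \<Longrightarrow> F (pw i) = 0" "F (pw (\<theta> - 1)) = 1"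
    using dual_of_d_exists by blast
  note lin = t_linear_intros linear_app[OF F(1)] linear_functional_scale[where ?s2.0 = "(*)"]
  let ?D = "\<lambda>x. F (T.shift x)"
  have D: "Vector_Spaces.linear sR (*) ?D" by (rule linear_app[OF F(1) T.shift.linear_axioms])
  have D_conv: "?D x = (\<Sum>(a, b)\<leftarrow>\<delta> x. F a * t b)" for x
    using T.apply_contract_right[OF F(1), of t x] by (simp add: T.convolution_def)
  have D_pw: "?D (pw i) = 0" if "i < \<theta>" for i
  proof (cases i)
    case (Suc j)
    then show ?thesis using shift_pw[of j] F(1,2) that by (simp add: Vector_Spaces.linear_iff del: mpower.simps)
  qed (use linear_map_zero[OF F(1)] in simp)
  \<comment> \<open>\<open>D\<close> is the convolution of \<open>F\<close> and \<open>t\<close>, so only the term \<open>y\<^sup>\<theta>\<^sup>-\<^sup>1 \<otimes> y\<close> of \<open>\<delta>(d)\<close> contributes\<close>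
  have coact_D: "(\<Sum>(u, x)\<leftarrow>\<rho> d. sH (?D x) u) = g ^ \<theta>"
  proof -
    let ?G = "\<lambda>r1 r2. \<Sum>(u, a)\<leftarrow>\<rho> r1. \<Sum>(v, b)\<leftarrow>\<rho> r2. sH (F a * t b) (u * v)"
    have bil: "bilinear_map sR sR sH ?G" by (intro lin)
    have scale_sum: "sH (\<Sum>(a, b)\<leftarrow>xs. f a b) v = (\<Sum>(a, b)\<leftarrow>xs. sH (f a b) v)" for xs :: "('r \<times> 'r) list" and f v
      by (induction xs) (auto simp: scale_left_distrib)
    have "(\<Sum>(u, x)\<leftarrow>\<rho> d. sH (?D x) u) = (\<Sum>(u, x)\<leftarrow>\<rho> d. \<Sum>(a, b)\<leftarrow>\<delta> x. sH (F a * t b) u)"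
      by (simp only: D_conv scale_sum)
    also have "\<dots> = (\<Sum>(r1, r2)\<leftarrow>\<delta> d. ?G r1 r2)"
      by (rule comult_coact_sum[where sX = sH]) (intro lin)
    also have "\<dots> = ?G d oneR + (?G oneR d + (\<Sum>i\<in>{1..<\<theta>}. sH (coef i) (?G (pw i) (pw (\<theta> - i)))))"
      by (rule comult_d_sum[OF bil])
    also have "?G d oneR = 0"
    proof -
      have "(\<Sum>(v, b)\<leftarrow>\<rho> oneR. sH (F a * t b) (u * v)) = sH (F a * t oneR) (u * 1)" for a u
        by (rule coact_oneR_sum[where sX = sH]) (intro lin)
      then show ?thesis using T.t_e by (simp add: case_prod_unfold)
    qed
    also have "?G oneR d = 0"
    proof -
      have "?G oneR d = (\<Sum>(v, b)\<leftarrow>\<rho> d. sH (F oneR * t b) (1 * v))"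
        by (rule coact_oneR_sum[where sX = sH]) (intro lin)
      then show ?thesis using F(2)[of 0] theta_ge_2 by (simp add: case_prod_unfold)
    qed
    also have "(\<Sum>i\<in>{1..<\<theta>}. sH (coef i) (?G (pw i) (pw (\<theta> - i)))) =
        (\<Sum>i\<in>{1..<\<theta>}. if i = \<theta> - 1 then sH (coef i) (g ^ \<theta>) else 0)"
    proof (intro sum.cong refl)
      fix i assume i: "i \<in> {1..<\<theta>}"
      have "?G (pw i) (pw (\<theta> - i)) = (\<Sum>(v, b)\<leftarrow>\<rho> (pw (\<theta> - i)). sH (F (pw i) * t b) (g ^ i * v))"
        by (rule coact_pw_sum[OF coact_pw_upto order_refl, where sX = sH]) (intro lin)
      also have "\<dots> = sH (F (pw i) * t (pw (\<theta> - i))) (g ^ i * g ^ (\<theta> - i))"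
        by (rule coact_pw_sum[OF coact_pw_upto order_refl, where sX = sH]) (intro lin)
      also have "g ^ i * g ^ (\<theta> - i) = g ^ \<theta>" using i by (simp flip: power_add)
      finally have G: "?G (pw i) (pw (\<theta> - i)) = sH (F (pw i) * t (pw (\<theta> - i))) (g ^ \<theta>)" .
      show "sH (coef i) (?G (pw i) (pw (\<theta> - i))) = (if i = \<theta> - 1 then sH (coef i) (g ^ \<theta>) else 0)"
      proof (cases "i = \<theta> - 1")
        case True
        then have "\<theta> - i = 1" using theta_ge_2 by simp
        then show ?thesis unfolding G using True F(3) T.t_y by (simp add: m_oneR_right)
      next
        case False
        then have "F (pw i) = 0" using i by (intro F(2)) auto
        then show ?thesis unfolding G using False by simp
      qed
    qed
    also have "\<dots> = g ^ \<theta>"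
    proof -
      have "Suc 0 \<le> \<theta> - Suc 0" using theta_ge_2 by linarith
      then show ?thesis using theta_ge_2 by (simp add: coef_def qnum_def)
    qed
    finally show ?thesis by simp
  qed
  let ?A = "T.contract_right ?D"
  let ?E1 = "\<lambda>x. \<Sum>(u, v)\<leftarrow>\<rho> d. act u (T.contract_right (\<lambda>s. ?D (m v s)) x)"
  let ?E2 = "\<lambda>x. \<Sum>i\<in>{1..<\<theta>}. sR (coef i) (m (pw i) (act (g ^ (\<theta> - i)) (T.contract_right (\<lambda>s. ?D (m (pw (\<theta> - i)) s)) x)))"
  have Dm: "Vector_Spaces.linear sR (*) (\<lambda>s. ?D (m v s))" for v
    by (intro linear_app[OF D] t_linear_intros)
  note lin2 = t_linear_intros linear_app[OF D]
  have comm: "?A (m d x) = m d (?A x) + x + ((?E1 x - x) + ?E2 x)" for x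
  proof -
    let ?F = "\<lambda>r1 r2. \<Sum>(u, r0)\<leftarrow>\<rho> r2. m r1 (act u (T.contract_right (\<lambda>s. ?D (m r0 s)) x))"
    have "?A (m d x) = ?F d oneR + (?F oneR d + (\<Sum>i\<in>{1..<\<theta>}. sR (coef i) (?F (pw i) (pw (\<theta> - i)))))"
      unfolding contract_right_m[OF D]
      by (rule comult_d_sum[where sX = sR], unfold T.contract_right_def[where f = "\<lambda>s. ?D (m _ s)"]) (intro lin2)
    also have "?F d oneR = m d (act 1 (T.contract_right (\<lambda>s. ?D (m oneR s)) x))"
      by (rule coact_oneR_sum[where sX = sR], unfold T.contract_right_def[where f = "\<lambda>s. ?D (m _ s)"]) (intro lin2)
    also have "\<dots> = m d (?A x)" by (simp add: act_one m_oneR_left)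
    also have "?F oneR d = ?E1 x" by (simp add: m_oneR_left)
    also have "(\<Sum>i\<in>{1..<\<theta>}. sR (coef i) (?F (pw i) (pw (\<theta> - i)))) = ?E2 x"
      by (intro sum.cong refl arg_cong[where f = "sR _"] coact_pw_sum[OF coact_pw_upto order_refl, where sX = sR],
          unfold T.contract_right_def[where f = "\<lambda>s. ?D (m _ s)"]) (intro lin2)
    finally show ?thesis by simp
  qed
  have E1: "?E1 x - x \<in> T.layer k" if x: "x \<in> T.layer (Suc k)" for x k
  proof -
    have "act u (T.contract_right (\<lambda>s. ?D (m v s)) x) - act (sH (?D v) u) x \<in> T.layer k" for u v
    proof -
      obtain f' where f': "Vector_Spaces.linear sR (*) f'"
        "\<And>x. T.contract_right (\<lambda>s. ?D (m v s)) x = sR (?D (m v oneR)) x + T.contract_right f' (T.shift x)"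
        using T.functional_decompose[OF Dm] by blast
      have "act u (T.contract_right (\<lambda>s. ?D (m v s)) x) - act (sH (?D v) u) x =
          act u (T.contract_right f' (T.shift x))"
        using act_bilinear by (simp add: f'(2) m_oneR_right bilinear_map_def Vector_Spaces.linear_iff)
      moreover have "T.shift x \<in> T.layer k" using x by (simp add: T.layer_Suc)
      ultimately show ?thesis using act_layer T.contract_right_layer[OF f'(1)] by simp
    qed
    then have "(\<Sum>(u, v)\<leftarrow>\<rho> d. act u (T.contract_right (\<lambda>s. ?D (m v s)) x) - act (sH (?D v) u) x) \<in> T.layer k"
      by (rule layer_sum_list)
    moreover have "(\<Sum>(u, v)\<leftarrow>xs. f u v - h u v) = (\<Sum>(u, v)\<leftarrow>xs. f u v) - (\<Sum>(u, v)\<leftarrow>xs. h u v)"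
      for xs :: "('h \<times> 'r) list" and f h :: "'h \<Rightarrow> 'r \<Rightarrow> 'r"
      by (induction xs) auto
    moreover have "(\<Sum>(u, v)\<leftarrow>\<rho> d. act (sH (?D v) u) x) = act (g ^ \<theta>) x"
    proof -
      have "Vector_Spaces.linear sH sR (\<lambda>h. act h x)" using act_bilinear by (simp add: bilinear_map_def)
      then show ?thesis unfolding coact_D[symmetric] by (rule linear_sum_list_map[symmetric])
    qed
    ultimately have "?E1 x - act (g ^ \<theta>) x \<in> T.layer k" by simp
    then have "(?E1 x - act (g ^ \<theta>) x) + (act (g ^ \<theta>) x - x) \<in> T.layer k"
      using act_g_theta_layer[OF x] by (rule V.subspace_add[OF T.subspace_layer])
    then show ?thesis by simp
  qed
  have E2: "?E2 x \<in> T.layer k" if x: "x \<in> T.layer (Suc k)" for x k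
  proof (intro V.subspace_sum T.subspace_layer V.subspace_scale)
    fix i assume i: "i \<in> {1..<\<theta>}"
    let ?f = "\<lambda>s. ?D (m (pw (\<theta> - i)) s)"
    interpret f: Vector_Spaces.linear sR "(*)" ?f by (rule Dm)
    have "?f s = 0" if "s \<in> T.layer (Suc i)" for s
    proof -
      have "?f v = 0" if v: "v \<in> pw ` {..<Suc i}" for v
      proof -
        obtain l where l: "v = pw l" "l \<le> i" using v by auto
        then have le: "\<theta> - i + l \<le> \<theta>" using i by simp
        show ?thesis
          using D_pw[of "\<theta> - i + l"] pw_theta linear_map_zero[OF D] le
          unfolding l(1) m_pw by (cases "\<theta> - i + l = \<theta>") auto
      qed
      moreover have "s \<in> V.span (pw ` {..<Suc i})" using layer_span[OF that] i by simp
      ultimately show ?thesis by (rule f.eq_0_on_span)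
    qed
    then have mem: "T.contract_right ?f x \<in> T.layer (Suc k - Suc i)"
      using x by (intro T.contract_right_lowers Dm)
    let ?z = "act (g ^ (\<theta> - i)) (T.contract_right ?f x)"
    have z: "?z \<in> T.layer (k - i)" using act_layer[OF mem] by simp
    show "m (pw i) ?z \<in> T.layer k"
    proof (cases "i \<le> k")
      case True
      then show ?thesis using m_pw_layer[OF _ z, of i] i by simp
    next
      case False
      then have "?z = 0" using z by simp
      then have "m (pw i) ?z = 0" using m_bilinear linear_map_zero[of sR sR "m (pw i)"] by (simp add: bilinear_map_def)
      then show ?thesis using V.subspace_0[OF T.subspace_layer] by simp
    qed
  qed
  have "(of_nat T.height :: 'k) = 0"
  proof (rule T.no_canonical_commutation)
    show "Vector_Spaces.linear sR sR ?A" by (rule T.linear_contract_right[OF D])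
    show "Vector_Spaces.linear sR sR (m d)" using m_bilinear by (simp add: bilinear_map_def)
    show "?A (m d x) = m d (?A x) + x + ((?E1 x - x) + ?E2 x)" for x by (rule comm)
    show "(?E1 x - x) + ?E2 x \<in> T.layer k" if "x \<in> T.layer (Suc k)" for k x
      using E1[OF that] E2[OF that] by (rule V.subspace_add[OF T.subspace_layer])
  qed
  then show False using T.height_pos by simp
qed

end

lemma layer_theta: "x \<in> T.layer \<theta>"
proof -
  have "\<not> \<theta> < T.height"
  proof
    assume less: "\<theta> < T.height"
    have "pw (\<theta> - 1) \<in> T.layer \<theta>" using pw_layer[of "\<theta> - 1"] theta_ge_2 by simp
    then obtain z where z: "T.shift z = pw (\<theta> - 1)" using T.layer_le_range_shift[OF _ less] by (metis rangeE)
    let ?d = "z - sR (\<epsilon>R z) oneR"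
    have "T.shift ?d = pw (\<theta> - 1)" using z by (simp add: T.shift.diff T.shift.scale)
    moreover have "\<epsilon>R ?d = 0"
      using R.counit_linear counit_oneR module_hom.diff[of sR "(*)" \<epsilon>R z "sR (\<epsilon>R z) oneR"]
      by (simp add: linear_iff_module_hom[symmetric] Vector_Spaces.linear_iff)
    ultimately show False by (rule no_vector_above_pw)
  qed
  then show ?thesis using T.layer_mono[OF _ T.layer_height] by simp
qed

lemma span_pw: "V.span (pw ` {..<\<theta>}) = UNIV"
  using layer_span[OF layer_theta order_refl] by blast

end

section \<open>The quantum line\<close>

context thin_line_cocycle
begin

lemma dim_UNIV_eq: "vector_space.dim sR UNIV = N"
proof -
  obtain B where B: "finite B" "card B = N" "V.independent B" "V.span B = UNIV"
    using T.dimension_n by (auto simp: has_dimension_def)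
  show ?thesis using B V.dim_unique[of B UNIV N] by simp
qed

lemma card_pw: "N \<le> card (pw ` {..<\<theta>})" "card (pw ` {..<\<theta>}) \<le> \<theta>"
  using V.dim_le_card[of UNIV "pw ` {..<\<theta>}"] span_pw dim_UNIV_eq card_image_le[of "{..<\<theta>}" pw]
  by simp_all

lemma theta_eq:
  assumes "\<theta> \<le> N"
  shows "N = \<theta>"
  using card_pw assms by simp

lemma pw_basis:
  assumes "\<theta> \<le> N"
  shows "V.independent (pw ` {..<\<theta>})" "inj_on pw {..<\<theta>}"
proof -
  have eq: "card (pw ` {..<\<theta>}) = \<theta>" using card_pw assms by simp
  then show "inj_on pw {..<\<theta>}" by (intro eq_card_imp_inj_on) auto
  show "V.independent (pw ` {..<\<theta>})"
    using T.card_le_dim_spanning[of "pw ` {..<\<theta>}" UNIV] span_pw eq theta_eq[OF assms] dim_UNIV_eq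
    by simp
qed

lemma linear_eq_on_pw:
  assumes "Vector_Spaces.linear sR sX f" "Vector_Spaces.linear sR sX h" "\<And>i. f (pw i) = h (pw i)"
  shows "f r = h r"
proof -
  interpret vector_space_pair sR sX
    using assms(1) by (simp add: Vector_Spaces.linear_iff vector_space_pair_def)
  show ?thesis
    by (rule linear_eq_on[OF assms(1,2), of r "pw ` {..<\<theta>}"]) (use span_pw assms(3) in auto)
qed

lemma m_assoc: "m (m r s) u = m r (m s u)"
proof (rule linear_eq_on_pw[where sX = sR and f = "\<lambda>r. m (m r s) u"])
  fix a
  show "m (m (pw a) s) u = m (pw a) (m s u)"
  proof (rule linear_eq_on_pw[where sX = sR and f = "\<lambda>s. m (m (pw a) s) u"])
    fix b
    show "m (m (pw a) (pw b)) u = m (pw a) (m (pw b) u)"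
    proof (rule linear_eq_on_pw[where sX = sR and f = "\<lambda>u. m (m (pw a) (pw b)) u"])
      show "m (m (pw a) (pw b)) (pw c) = m (pw a) (m (pw b) (pw c))" for c
        by (simp add: m_pw add.assoc)
    qed (intro yd_linear_intros)+
  qed (intro yd_linear_intros)+
qed (intro yd_linear_intros)+

lemma coact_m: "tensor_eq sH sR (\<rho> (m r s)) [(u, m r0 s0). (u, r0, s0) \<leftarrow> coact_tensor \<rho> r s]"
proof (rule tensor_eqI[OF vs_H vs_R])
  fix f :: "'h \<Rightarrow> 'r \<Rightarrow> 'k"
  assume f: "bilinear_map sH sR (*) f"
  note lin = yd_linear_intros linear_bilinear_left[OF f] linear_bilinear_right[OF f]
  let ?L = "\<lambda>r s. \<Sum>(a, b)\<leftarrow>\<rho> (m r s). f a b"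
  let ?R = "\<lambda>r s. \<Sum>(u, r0)\<leftarrow>\<rho> r. \<Sum>(v, s0)\<leftarrow>\<rho> s. f (u * v) (m r0 s0)"
  have "?L r s = ?R r s"
  proof (rule linear_eq_on_pw[where sX = "(*)" and f = "\<lambda>r. ?L r s"])
    fix a
    show "?L (pw a) s = ?R (pw a) s"
    proof (rule linear_eq_on_pw[where sX = "(*)" and f = "\<lambda>s. ?L (pw a) s"])
      fix b
      have "?L (pw a) (pw b) = f (g ^ (a + b)) (pw (a + b))"
        unfolding m_pw by (rule coact_pw_sum[OF coact_pw_upto order_refl f])
      also have "\<dots> = (\<Sum>(v, s0)\<leftarrow>\<rho> (pw b). f (g ^ a * v) (m (pw a) s0))"
        unfolding power_add m_pw[symmetric]
        by (rule coact_pw_sum[OF coact_pw_upto order_refl, where sX = "(*)", symmetric]) (intro lin)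
      also have "\<dots> = ?R (pw a) (pw b)"
        by (rule coact_pw_sum[OF coact_pw_upto order_refl, where sX = "(*)", symmetric]) (intro lin)
      finally show "?L (pw a) (pw b) = ?R (pw a) (pw b)" .
    qed (intro lin)+
  qed (intro lin)+
  then show "?L r s = (\<Sum>(a, b)\<leftarrow>[(u, m r0 s0). (u, r0, s0) \<leftarrow> coact_tensor \<rho> r s]. f a b)"
    unfolding coact_tensor_def by (simp add: map_concat comp_def case_prod_unfold sum_list_concat)
qed

definition poly_eval :: "'k poly \<Rightarrow> 'r" where
  "poly_eval p = (\<Sum>i<\<theta>. sR (coeff p i) (pw i))"

lemma poly_eval_eq: "poly_eval p = (\<Sum>i\<le>n. sR (coeff p i) (pw i))" if "degree p \<le> n"
proof -
  have "poly_eval p = (\<Sum>i\<in>{..<\<theta>} \<union> {..n}. sR (coeff p i) (pw i))"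
    unfolding poly_eval_def using pw_eq_0 by (intro sum.mono_neutral_left) auto
  also have "\<dots> = (\<Sum>i\<le>n. sR (coeff p i) (pw i))"
    using that coeff_eq_0[of p] by (intro sum.mono_neutral_right) auto
  finally show ?thesis .
qed

lemma vs_poly: "vector_space (smult :: 'k \<Rightarrow> 'k poly \<Rightarrow> 'k poly)"
  by unfold_locales (auto simp: smult_add_right smult_add_left)

lemma poly_eval_linear: "Vector_Spaces.linear smult sR poly_eval"
  unfolding Vector_Spaces.linear_iff
  using vs_poly vs_R by (auto simp: poly_eval_def V.scale_left_distrib sum.distrib V.scale_sum_right)

lemma poly_eval_monom: "poly_eval (monom c n) = sR c (pw n)"
proof -
  have "poly_eval (monom c n) = (\<Sum>i\<le>n. sR (coeff (monom c n) i) (pw i))"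
    by (rule poly_eval_eq[OF degree_monom_le])
  also have "\<dots> = (\<Sum>i\<in>{n}. sR (coeff (monom c n) i) (pw i))"
    by (intro sum.mono_neutral_right) auto
  finally show ?thesis by simp
qed


lemma poly_eval_pCons: "poly_eval (pCons a p) = sR a oneR + m y (poly_eval p)"
proof -
  interpret y: Vector_Spaces.linear sR sR "m y" using m_bilinear by (simp add: bilinear_map_def)
  have "poly_eval (pCons a p) = (\<Sum>i\<le>Suc (degree p). sR (coeff (pCons a p) i) (pw i))"
    by (rule poly_eval_eq[OF degree_pCons_le])
  also have "\<dots> = sR a oneR + (\<Sum>i\<le>degree p. sR (coeff p i) (m y (pw i)))"
    by (subst sum.atMost_Suc_shift) simp
  also have "(\<Sum>i\<le>degree p. sR (coeff p i) (m y (pw i))) = m y (poly_eval p)"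
    by (simp add: poly_eval_eq[OF order_refl] y.sum y.scale)
  finally show ?thesis .
qed

lemma poly_eval_mult: "poly_eval (p * p') = m (poly_eval p) (poly_eval p')"
proof -
  interpret e: Vector_Spaces.linear smult sR poly_eval by (rule poly_eval_linear)
  interpret l: Vector_Spaces.linear sR sR "\<lambda>a. m a (poly_eval p')"
    using m_bilinear by (simp add: bilinear_map_def)
  show ?thesis
  proof (induction p)
    case 0
    then show ?case by (simp add: e.zero l.zero)
  next
    case (pCons a p)
    have "poly_eval (pCons a p * p') = sR a (poly_eval p') + m y (poly_eval (p * p'))"
      by (simp add: mult_pCons_left e.add e.scale poly_eval_pCons)
    then show ?case by (simp add: pCons.IH poly_eval_pCons l.add l.scale m_oneR_left m_assoc)
  qed
qed

lemma poly_eval_eq_0_iff: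
  assumes "\<theta> \<le> N"
  shows "poly_eval p = 0 \<longleftrightarrow> [:0, 1:] ^ \<theta> dvd p"
proof -
  have "poly_eval p = 0 \<longleftrightarrow> (\<forall>i<\<theta>. coeff p i = 0)"
  proof
    assume 0: "poly_eval p = 0"
    let ?c = "\<lambda>v. coeff p (the_inv_into {..<\<theta>} pw v)"
    note inj = pw_basis(2)[OF assms]
    have inv: "?c (pw i) = coeff p i" if "i < \<theta>" for i
      using the_inv_into_f_f[OF inj] that by simp
    have "(\<Sum>v\<in>pw ` {..<\<theta>}. sR (?c v) v) = poly_eval p"
      unfolding sum.reindex[OF inj] poly_eval_def comp_apply using inv by (intro sum.cong) auto
    then have "?c (pw i) = 0" if "i < \<theta>" for i
      using V.independentD[OF pw_basis(1)[OF assms], of "pw ` {..<\<theta>}" ?c "pw i"] that 0 by simp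
    then show "\<forall>i<\<theta>. coeff p i = 0" using inv by simp
  qed (simp add: poly_eval_def)
  also have "\<dots> \<longleftrightarrow> [:0, 1:] ^ \<theta> dvd p"
    by (simp add: monom_1_dvd_iff'[symmetric] monom_altdef)
  finally show ?thesis .
qed

lemma surj_poly_eval: "surj poly_eval"
proof -
  interpret e: Vector_Spaces.linear smult sR poly_eval by (rule poly_eval_linear)
  have "V.subspace (range poly_eval)"
    using e.subspace_image[OF e.vs1.subspace_UNIV] .
  moreover have "pw ` {..<\<theta>} \<subseteq> range poly_eval"
    using poly_eval_monom[of 1] by (metis V.scale_one image_subsetI rangeI)
  ultimately have "V.span (pw ` {..<\<theta>}) \<subseteq> range poly_eval" by (intro V.span_minimal)
  then show ?thesis using span_pw by auto
qed

lemma is_quantum_line: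
  assumes "\<theta> \<le> N"
  shows "is_quantum_line sH \<Delta> \<epsilon> S sR act \<rho> \<delta> \<epsilon>R m oneR \<theta> q g \<chi> y"
proof -
  have "braided_bialgebra sH \<Delta> \<epsilon> S sR act \<rho> \<delta> \<epsilon>R m oneR"
    by unfold_locales (fact m_assoc coact_m)+
  moreover have "poly_eval 1 = oneR"
    using poly_eval_monom[of 1 0] by simp
  moreover have "poly_eval [:0, 1:] = y"
    using poly_eval_monom[of 1 1] by (simp add: monom_altdef m_oneR_right)
  ultimately show ?thesis
    unfolding is_quantum_line_def
    using datum act_y coact_y comult_y poly_eval_linear poly_eval_mult surj_poly_eval
      poly_eval_eq_0_iff[OF assms]
    by blast
qed

lemma top_value_zero_imp_trivial:
  assumes "top_value = 0"
  shows "\<xi> r s = sH (\<epsilon>R r * \<epsilon>R s) 1"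
proof -
  have lin: "Vector_Spaces.linear sR sH (\<lambda>r. sH (\<epsilon>R r * \<epsilon>R s) 1)" "Vector_Spaces.linear sR sH (\<lambda>s. sH (\<epsilon>R r * \<epsilon>R s) 1)" for r s
    by (intro yd_linear_intros linear_functional_scale[where ?s2.0 = "(*)"] R.counit_linear)+
  show ?thesis
  proof (rule linear_eq_on_pw[where f = "\<lambda>r. \<xi> r s", OF _ lin(1)])
    fix a
    show "\<xi> (pw a) s = sH (\<epsilon>R (pw a) * \<epsilon>R s) 1"
    proof (rule linear_eq_on_pw[where f = "\<lambda>s. \<xi> (pw a) s", OF _ lin(2)])
      show "\<xi> (pw a) (pw b) = sH (\<epsilon>R (pw a) * \<epsilon>R (pw b)) 1" for b
        using assms counit_pw[of a] counit_pw[of b] xi_oneR_pw[of a] xi_oneR_pw[of b] counit_oneR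
        by (cases a; cases b) (simp_all add: xi_pw xi_one del: mpower.simps(2))
    qed (intro yd_linear_intros)
  qed (intro yd_linear_intros)
qed

end

theorem proposition3p7:
  fixes sH :: "'k::field_char_0 \<Rightarrow> 'h::ring_1 \<Rightarrow> 'h"
    and \<Delta> :: "'h \<Rightarrow> ('h \<times> 'h) list" and \<epsilon> :: "'h \<Rightarrow> 'k" and S :: "'h \<Rightarrow> 'h"
    and sR :: "'k \<Rightarrow> 'r::ab_group_add \<Rightarrow> 'r"
    and act :: "'h \<Rightarrow> 'r \<Rightarrow> 'r" and \<rho> :: "'r \<Rightarrow> ('h \<times> 'r) list"
    and \<delta> :: "'r \<Rightarrow> ('r \<times> 'r) list" and \<epsilon>R :: "'r \<Rightarrow> 'k"
    and m :: "'r \<Rightarrow> 'r \<Rightarrow> 'r" and oneR :: 'r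
    and \<xi> :: "'r \<Rightarrow> 'r \<Rightarrow> 'h"
    and N :: nat and y :: 'r and g :: 'h and \<chi> :: "'h \<Rightarrow> 'k" and q :: 'k
  assumes hopf: "hopf_algebra sH \<Delta> \<epsilon> S"
    and integral: "\<exists>\<gamma>. ad_invariant_integral sH \<Delta> \<epsilon> S \<gamma>"
    and pre_bialgebra: "pre_bialgebra sH \<Delta> \<epsilon> S sR act \<rho> \<delta> \<epsilon>R m oneR"
    and dimension: "has_dimension sR N"
    and cocycle: "pre_bialgebra_cocycle sH \<Delta> \<epsilon> S sR act \<rho> \<delta> \<epsilon>R m oneR \<xi>"
    and thin: "thin sR \<delta> oneR"
    and primitives: "primitives sR \<delta> oneR = module.span sR {y}"
    and datum: "associated_yd_datum sH \<Delta> \<epsilon> sR act \<rho> N y g \<chi>"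
    and q: "q = \<chi> g"
  shows "\<exists>lam.
      ((\<forall>a b. \<xi> (mpower m oneR y a) (mpower m oneR y b) =
          (if a + b = 0 then 1
           else if a + b = N \<and> a \<noteq> 0 \<and> b \<noteq> 0 then sH lam (1 - g ^ N)
           else 0)) \<and>
       compatible_datum sH \<Delta> \<epsilon> S N q g \<chi> lam) \<and>
      is_quantum_line sH \<Delta> \<epsilon> S sR act \<rho> \<delta> \<epsilon>R m oneR N q g \<chi> y \<and>
      ((\<exists>r s. \<xi> r s \<noteq> sH (\<epsilon>R r * \<epsilon>R s) 1) \<longrightarrow>
        convolution_power \<Delta> \<epsilon> \<chi> N = \<epsilon> \<and> g ^ N \<in> center - {1})"
proof -
  interpret C: pre_bialgebra_cocycle sH \<Delta> \<epsilon> S sR act \<rho> \<delta> \<epsilon>R m oneR \<xi> by (rule cocycle)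
  obtain \<gamma> where \<gamma>: "ad_invariant_integral sH \<Delta> \<epsilon> S \<gamma>" using integral by blast
  obtain \<theta> where \<theta>: "2 \<le> \<theta>" "\<theta> \<le> N" "yd_datum sH \<Delta> \<epsilon> \<theta> (\<chi> g) g \<chi>"
    using datum by (auto simp: associated_yd_datum_def yd_datum_def)
  have y: "y \<noteq> 0"
  proof
    assume "y = 0"
    then have "C.V.dim (primitives sR \<delta> oneR) = C.V.dim (C.V.span {})"
      using primitives by simp
    also have "\<dots> = 0" using C.V.dim_span_eq_card_independent[OF C.V.independent_empty] by simp
    finally show False using thin by (simp add: thin_def)
  qed
  interpret L: yd_line_cocycle sH \<Delta> \<epsilon> S sR act \<rho> \<delta> \<epsilon>R m oneR \<xi> y g \<chi> \<theta> \<gamma>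
    using \<gamma> \<theta> y primitives datum
    by unfold_locales (auto simp: associated_yd_datum_def)
  obtain t where t: "Vector_Spaces.linear sR (*) t"
      "\<And>i. i < \<theta> \<Longrightarrow> t (mpower m oneR y i) = (if i = 1 then 1 else 0)"
    using L.dual_of_y_exists \<theta>(1) by (metis of_nat_eq_0_iff not_numeral_le_zero)
  interpret T: thin_coalgebra sR \<delta> \<epsilon>R oneR N y t
  proof (intro thin_coalgebra.intro thin_coalgebra_axioms.intro
      connected_coalgebra.intro connected_coalgebra_axioms.intro)
    show "C.V.dim (coradical sR \<delta>) = 1" using thin by (simp add: thin_def)
    show "t oneR = 0" "t y = 1" using t(2)[of 0] t(2)[of 1] \<theta>(1) by (simp_all add: C.m_oneR_right)
  qed (fact C.R.k_coalgebra_axioms dimension C.comult_oneR C.counit_oneR primitives t(1))+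
  interpret M: thin_line_cocycle sH \<Delta> \<epsilon> S sR act \<rho> \<delta> \<epsilon>R m oneR \<xi> y g \<chi> \<theta> \<gamma> N t
    by (intro thin_line_cocycle.intro thin_line_cocycle_axioms.intro
        L.yd_line_cocycle_axioms T.thin_coalgebra_axioms t(2))
  have N: "N = \<theta>" by (rule M.theta_eq[OF \<theta>(2)])
  define lam where "lam = \<gamma> L.top_value"
  have top: "L.top_value = sH lam (1 - g ^ N)"
    unfolding lam_def N by (rule L.top_value_eq)
  have lam0: "lam = 0" if "L.top_value = 0"
    unfolding lam_def that using L.gamma_linear by (rule linear_map_zero)
  have table: "\<forall>a b. \<xi> (mpower m oneR y a) (mpower m oneR y b) =
      (if a + b = 0 then 1 else if a + b = N \<and> a \<noteq> 0 \<and> b \<noteq> 0 then sH lam (1 - g ^ N) else 0)"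
    unfolding top[symmetric] unfolding N using L.xi_pw by blast
  have "compatible_datum sH \<Delta> \<epsilon> S N q g \<chi> lam"
    unfolding compatible_datum_def
  proof (intro conjI impI)
    show "yd_datum sH \<Delta> \<epsilon> N q g \<chi>" using \<theta>(3) by (simp add: N q)
    assume bad: "g ^ N = 1 \<or> (\<exists>h. sH (convolution_power \<Delta> \<epsilon> \<chi> N h) (1 - g ^ N) \<noteq>
        (\<Sum>(a, b)\<leftarrow>\<Delta> h. a * (1 - g ^ N) * S b))"
    show "lam = 0"
    proof (rule ccontr)
      assume lam: "lam \<noteq> 0"
      then have nz: "L.top_value \<noteq> 0" using lam0 by blast
      then have "g ^ N \<noteq> 1" using L.top_value_central by (simp add: N)
      moreover have "sH (convolution_power \<Delta> \<epsilon> \<chi> N h) (1 - g ^ N) = (\<Sum>(a, b)\<leftarrow>\<Delta> h. a * (1 - g ^ N) * S b)" for h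
      proof -
        have scale: "sH lam (\<Sum>(a, b)\<leftarrow>xs. a * z * S b) = (\<Sum>(a, b)\<leftarrow>xs. a * sH lam z * S b)" for xs z
          by (induction xs) (auto simp: C.scale_right_distrib C.scale_mult_left C.scale_mult_right)
        define w where "w = L.top_value"
        have w: "w = sH lam (1 - g ^ N)" unfolding w_def by (rule top)
        have "sH (convolution_power \<Delta> \<epsilon> \<chi> N h) w = (\<Sum>(a, b)\<leftarrow>\<Delta> h. a * w * S b)"
          unfolding w_def N by (rule L.top_value_ad)
        then have "sH lam (sH (convolution_power \<Delta> \<epsilon> \<chi> N h) (1 - g ^ N)) =
            sH lam (\<Sum>(a, b)\<leftarrow>\<Delta> h. a * (1 - g ^ N) * S b)"
          unfolding scale w by (simp add: mult.commute)
        then show ?thesis using C.scale_left_imp_eq[OF lam] by blast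
      qed
      ultimately show False using bad by blast
    qed
  qed
  moreover have "is_quantum_line sH \<Delta> \<epsilon> S sR act \<rho> \<delta> \<epsilon>R m oneR N q g \<chi> y"
    using M.is_quantum_line[OF \<theta>(2)] by (simp add: N q)
  moreover have "convolution_power \<Delta> \<epsilon> \<chi> N = \<epsilon> \<and> g ^ N \<in> center - {1}"
    if nontrivial: "\<exists>r s. \<xi> r s \<noteq> sH (\<epsilon>R r * \<epsilon>R s) 1"
  proof -
    have "L.top_value \<noteq> 0" using nontrivial M.top_value_zero_imp_trivial by blast
    then show ?thesis using L.top_value_ad_trivial L.top_value_central by (simp add: N)
  qed
  ultimately show ?thesis using table by blast
qed

end
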